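(* Let $\Gamma\subset\mathbb{R}^3$ be a smooth simple closed curve of length $\mathcal{L}$, parametrized by arc length as $\gamma:\mathbb{R}/\mathcal{L}\mathbb{Z}\to\mathbb{R}^3$, and let $\mu_0>0$ be a constant. For $\varepsilon>0$ put $D_\varepsilon=\{(s_1,s_2):|\gamma(s_1)-\gamma(s_2)|>\varepsilon\}\subset(\mathbb{R}/\mathcal{L}\mathbb{Z})^2$. For $s_1,s_2$ with $\gamma(s_1)\neq\gamma(s_2)$ write $\vec r_{12}=\gamma(s_2)-\gamma(s_1)$ and $\hat r_{12}=\vec r_{12}/|\vec r_{12}|$, and set $$\rho_N(s_1,s_2)=\gamma'(s_1)\cdot\gamma'(s_2),\qquad \rho_W(s_1,s_2)=(\hat r_{12}\cdot\gamma'(s_1))(\hat r_{12}\cdot\gamma'(s_2)).$$ Then: (1) The limits $$H_N(\Gamma)=\lim_{\varepsilon\to0^+}\Big(\frac{\mu_0}{4\pi}\iint_{D_\varepsilon}\frac{\rho_N(s_1,s_2)}{|\gamma(s_1)-\gamma(s_2)|}\,ds_1ds_2+\frac{\mu_0\mathcal{L}}{2\pi}\log\varepsilon\Big),$$ $$H_W(\Gamma)=\lim_{\varepsilon\to0^+}\Big(\frac{\mu_0}{4\pi}\iint_{D_\varepsilon}\frac{\rho_W(s_1,s_2)}{|\gamma(s_1)-\gamma(s_2)|}\,ds_1ds_2+\frac{\mu_0\mathcal{L}}{2\pi}\log\varepsilon\Big)$$ exist. (2) The functions $$F_N(z)=\frac{\mu_0}{4\pi}\iint|\gamma(s_1)-\gamma(s_2)|^z\rho_N(s_1,s_2)\,ds_1ds_2,\qquad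 F_W(z)=\frac{\mu_0}{4\pi}\iint|\gamma(s_1)-\gamma(s_2)|^z\rho_W(s_1,s_2)\,ds_1ds_2$$ (integrals over $(\mathbb{R}/\mathcal{L}\mathbb{Z})^2$) are well defined and holomorphic on $\{z\in\mathbb{C}:\operatorname{Re}z>-1\}$, and they extend by analytic continuation to meromorphic functions on $\mathbb{C}$ (denoted by the same symbols) whose only possible poles are simple poles at negative odd integers. Moreover $\operatorname{Res}(F_N,-1)=\operatorname{Res}(F_W,-1)=\frac{\mu_0\mathcal{L}}{2\pi}$, and the limits $$A_N(\Gamma)=\lim_{z\to-1}\Big(F_N(z)-\frac{\mu_0\mathcal{L}}{2\pi(z+1)}\Big),\qquad A_W(\Gamma)=\lim_{z\to-1}\Big(F_W(z)-\frac{\mu_0\mathcal{L}}{2\pi(z+1)}\Big)$$ exist. (3) $H_N(\Gamma)=A_N(\Gamma)$ and $H_W(\Gamma)=A_W(\Gamma)$. (4) $H_W(\Gamma)=H_N(\Gamma)+\frac{\mu_0}{2\pi}\mathcal{L}$.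
   Context: $\mu_0$ denotes the permeability of free space (a positive constant). The integrands correspond to Neumann's formula $\frac{d\vec x_1\cdot d\vec x_2}{|\vec x_1-\vec x_2|}$ and Weber's formula $\frac{(\hat r_{12}\cdot d\vec x_1)(\hat r_{12}\cdot d\vec x_2)}{|\vec x_1-\vec x_2|}$ for the mutual inductance, applied to the pair $(\Gamma,\Gamma)$; $D_\varepsilon$ is the complement in $\Gamma\times\Gamma$ of the set $\{(\vec x_1,\vec x_2):|\vec x_1-\vec x_2|\le\varepsilon\}$. *)

theory Defs
  imports "HOL-Analysis.Analysis" "HOL-Complex_Analysis.Complex_Analysis"
begin

definition smooth_curve :: "(real \<Rightarrow> 'a::real_normed_vector) \<Rightarrow> bool" where
  "smooth_curve g \<longleftrightarrow>
     (\<exists>D::nat \<Rightarrow> real \<Rightarrow> 'a. D 0 = g \<and> (\<forall>k t. (D k has_vector_derivative D (Suc k) t) (at t)))"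

text \<open>Smooth simple closed curve of length L parametrized by arc length,
  viewed as an L-periodic map on the reals (i.e. a map on R/LZ).\<close>
definition arclength_simple_closed_curve :: "(real \<Rightarrow> real^3) \<Rightarrow> real \<Rightarrow> bool" where
  "arclength_simple_closed_curve g L \<longleftrightarrow>
     L > 0 \<and> smooth_curve g \<and> (\<forall>s. g (s + L) = g s) \<and> inj_on g {0..<L} \<and>
     (\<forall>s. norm (vector_derivative g (at s)) = 1)"

definition torus_dom :: "real \<Rightarrow> (real \<times> real) set" where
  "torus_dom L = {0..<L} \<times> {0..<L}"

definition D_eps :: "(real \<Rightarrow> real^3) \<Rightarrow> real \<Rightarrow> real \<Rightarrow> (real \<times> real) set" where
  "D_eps g L \<epsilon> = {(s1, s2) \<in> torus_dom L. norm (g s1 - g s2) > \<epsilon>}"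

definition rhoN :: "(real \<Rightarrow> real^3) \<Rightarrow> real \<times> real \<Rightarrow> real" where
  "rhoN g p = vector_derivative g (at (fst p)) \<bullet> vector_derivative g (at (snd p))"

definition rhoW :: "(real \<Rightarrow> real^3) \<Rightarrow> real \<times> real \<Rightarrow> real" where
  "rhoW g p = (let r = g (snd p) - g (fst p); rhat = (1 / norm r) *\<^sub>R r in
      (rhat \<bullet> vector_derivative g (at (fst p))) * (rhat \<bullet> vector_derivative g (at (snd p))))"

definition Hreg :: "real \<Rightarrow> (real \<Rightarrow> real^3) \<Rightarrow> real \<Rightarrow> (real \<times> real \<Rightarrow> real) \<Rightarrow> real \<Rightarrow> real" where
  "Hreg mu0 g L rho \<epsilon> =
     mu0 / (4 * pi) * (LINT p : D_eps g L \<epsilon> | lborel. rho p / norm (g (fst p) - g (snd p)))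
     + mu0 * L / (2 * pi) * ln \<epsilon>"

definition Fint_integrand :: "(real \<Rightarrow> real^3) \<Rightarrow> (real \<times> real \<Rightarrow> real) \<Rightarrow> complex \<Rightarrow> real \<times> real \<Rightarrow> complex" where
  "Fint_integrand g rho z p = complex_of_real (norm (g (fst p) - g (snd p))) powr z * complex_of_real (rho p)"

definition Fint :: "real \<Rightarrow> (real \<Rightarrow> real^3) \<Rightarrow> real \<Rightarrow> (real \<times> real \<Rightarrow> real) \<Rightarrow> complex \<Rightarrow> complex" where
  "Fint mu0 g L rho z =
     complex_of_real (mu0 / (4 * pi)) * (LINT p : torus_dom L | lborel. Fint_integrand g rho z p)"

definition neg_odd_ints :: "complex set" where
  "neg_odd_ints = {- of_nat (2 * k + 1) | k. True}"

definition good_continuation ::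
  "(complex \<Rightarrow> complex) \<Rightarrow> (complex \<Rightarrow> complex) \<Rightarrow> complex \<Rightarrow> complex \<Rightarrow> bool" where
  "good_continuation F G c A \<longleftrightarrow>
     G holomorphic_on (UNIV - neg_odd_ints) \<and>
     (\<forall>z. Re z > -1 \<longrightarrow> G z = F z) \<and>
     (\<forall>n\<in>neg_odd_ints. \<exists>l. ((\<lambda>z. (z - n) * G z) \<longlongrightarrow> l) (at n)) \<and>
     residue G (-1) = c \<and>
     ((\<lambda>z. G z - c / (z + 1)) \<longlongrightarrow> A) (at (-1))"

end

theory Submission
  imports Defs
begin

text \<open>
  In the coordinates (s, u) with second point s + u, the integrand is |u|^z h(s, u, z), where h is smooth in u for
  |u| < L and entire in z, because |\<gamma>(s + u) - \<gamma>(s)| / |u| extends to a smooth positive function. Only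
  the even part e = h(s, u, z) + h(s, -u, z) contributes, on 0 < u < L/2. Integrating u^z e by parts and
  writing e' = u g with g again even and smooth replaces z by z + 2 at the price of a factor 1 / (z + 1); iterating
  continues F past one odd pole at a time, and uniqueness of continuation glues the pieces.

  Near z = -1 one compares with the integral of 2 u^z, which is explicit; the remainder converges to the integral of
  e(s, u, -1) / u - 2 / u. The cut-off integrals have the same finite part: replacing the condition
  |\<gamma>(s + u) - \<gamma>(s)| > \<epsilon> by u > \<epsilon> changes the integral of 1 / u by O(\<epsilon>), since the chord is u + O(u^2).

  Finally (\<rho>_N - \<rho>_W) / |r| is the u-derivative of the cosine of the angle between the chord and the tangent at s,
  which jumps from -1 to 1 at u = 0; so its integral over one period is -2.
\<close>

section \<open>Integration on rectangles and on the torus\<close>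

text \<open>The chord vanishes at u = 0 and again at |u| = L. Hence kernels live on |u| < L, while a
  period is covered by u and -u with 0 < u < L/2, strictly inside this interval, where compactness
  bounds everything uniformly in s. Since s is only integrated over, continuity in s suffices. The
  exponent z also sits inside h, so every construction has to preserve holomorphy in z together with
  smoothness in u.

  That both regularizations agree comes down to one constant. Over s in [0, L) and 0 < u < L/2, the
  integral of 2 u^z is 2 L (L/2)^(z+1) / (z + 1), with residue 2 L and finite part 2 L ln (L/2) at
  -1; the integral of 2 / u over u > \<epsilon> is 2 L ln (L/2) - 2 L ln \<epsilon>. Either way the
  number left is \<open>defect\<close> + 2 L ln (L/2). The factor 2 counts the two signs of u, and
  mu0 / (4 pi) times 2 L is the prescribed coefficient.

  In the comparison of the two densities the logarithms cancel, so only the two values of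
  \<open>defect\<close> have to be compared.\<close>

lemma holomorphic_integral_dominated:
  fixes f :: "complex \<Rightarrow> 'a \<Rightarrow> complex"
  assumes S: "open S"
    and hol: "\<And>x. x \<in> space M \<Longrightarrow> (\<lambda>z. f z x) holomorphic_on S"
    and meas: "\<And>z. z \<in> S \<Longrightarrow> f z \<in> borel_measurable M"
    and dom: "\<And>z0. z0 \<in> S \<Longrightarrow> \<exists>d>0. \<exists>B. cball z0 d \<subseteq> S \<and> integrable M B \<and>
                 (\<forall>z\<in>cball z0 d. \<forall>x\<in>space M. norm (f z x) \<le> B x)"
  shows "(\<lambda>z. integral\<^sup>L M (f z)) holomorphic_on S"
proof -
  have "(\<lambda>z. integral\<^sup>L M (f z)) field_differentiable at z0" if z0: "z0 \<in> S" for z0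
  proof -
    obtain d B where d: "d > 0" "cball z0 d \<subseteq> S" and B: "integrable M B"
      and bd: "\<And>z x. z \<in> cball z0 d \<Longrightarrow> x \<in> space M \<Longrightarrow> norm (f z x) \<le> B x"
      using dom[OF z0] by blast
    have int: "integrable M (f z)" if "z \<in> cball z0 d" for z
    proof (rule Bochner_Integration.integrable_bound[OF B])
      show "f z \<in> borel_measurable M" using meas d that by blast
      show "AE x in M. norm (f z x) \<le> norm (B x)"
        using bd[OF that] by (intro AE_I2) (smt (verit, best) norm_ge_zero real_norm_def)
    qed
    define f' where "f' x = deriv (\<lambda>z. f z x) z0" for x
    have der: "((\<lambda>z. f z x) has_field_derivative f' x) (at z0)" if "x \<in> space M" for x
      unfolding f'_def using hol[OF that] S z0 by (rule holomorphic_derivI)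
    \<comment> \<open>Only f itself is dominated. Cauchy's inequality on discs of radius d/2 about
      points of \<open>cball z0 (d/2)\<close>, all inside \<open>cball z0 d\<close>, bounds the
      derivative by 2 B / d, and this dominates the difference quotients.\<close>
    have lip: "norm (f z x - f z0 x) \<le> (2 * B x / d) * norm (z - z0)"
      if z: "z \<in> cball z0 (d/2)" and x: "x \<in> space M" for z x
    proof (rule field_differentiable_bound[of "cball z0 (d/2)" "\<lambda>z. f z x" "deriv (\<lambda>z. f z x)"])
      fix w assume w: "w \<in> cball z0 (d/2)"
      have sub: "cball w (d/2) \<subseteq> cball z0 d"
      proof
        fix y assume "y \<in> cball w (d/2)"
        then show "y \<in> cball z0 d" using w dist_triangle[of z0 y w] by auto
      qed
      have wS: "w \<in> S" using w d by auto
      show "((\<lambda>z. f z x) has_field_derivative deriv (\<lambda>z. f z x) w) (at w within cball z0 (d/2))"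
        using hol[OF x] S wS by (metis holomorphic_derivI has_field_derivative_at_within)
      have h: "(\<lambda>z. f z x) holomorphic_on cball w (d/2)"
        using hol[OF x] sub d by (meson holomorphic_on_subset)
      have "norm ((deriv ^^ 1) (\<lambda>z. f z x) w) \<le> fact 1 * B x / (d/2) ^ 1"
      proof (rule Cauchy_inequality)
        show "(\<lambda>z. f z x) holomorphic_on ball w (d/2)"
          using h by (meson ball_subset_cball holomorphic_on_subset)
        show "continuous_on (cball w (d/2)) (\<lambda>z. f z x)"
          using h by (rule holomorphic_on_imp_continuous_on)
        show "0 < d/2" using d by simp
        fix y assume "norm (w - y) = d/2"
        then have "y \<in> cball z0 d" using sub by (auto simp: dist_norm)
        then show "norm (f y x) \<le> B x" using bd x by blast
      qed
      then show "norm (deriv (\<lambda>z. f z x) w) \<le> 2 * B x / d" using d by (simp add: field_simps)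
    qed (use z d in auto)
    have "((\<lambda>z. (integral\<^sup>L M (f z) - integral\<^sup>L M (f z0)) / (z - z0)) \<longlongrightarrow> integral\<^sup>L M f') (at z0)"
      unfolding tendsto_at_iff_sequentially comp_def
    proof (intro allI impI)
      fix X :: "nat \<Rightarrow> complex" assume X: "\<forall>i. X i \<in> UNIV - {z0}" "X \<longlonglongrightarrow> z0"
      have "eventually (\<lambda>i. X i \<in> ball z0 (d/2)) sequentially"
        using X(2) d by (metis half_gt_zero centre_in_ball open_ball topological_tendstoD)
      then obtain N where N: "\<And>i. i \<ge> N \<Longrightarrow> X i \<in> ball z0 (d/2)"
        by (auto simp: eventually_sequentially)
      \<comment> \<open>Dropping N terms puts the whole sequence in the small disc, so the bound
        holds at every index, as dominated convergence demands.\<close>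
      define Y where "Y i = X (i + N)" for i
      have Y: "Y i \<in> cball z0 (d/2)" "Y i \<in> cball z0 d" "Y i \<noteq> z0" for i
        using N[of "i+N"] X(1) d by (auto simp: Y_def)
      have Ylim: "Y \<longlonglongrightarrow> z0" unfolding Y_def using X(2) by (rule LIMSEQ_ignore_initial_segment)
      have lim: "(\<lambda>i. (f (Y i) x - f z0 x) / (Y i - z0)) \<longlonglongrightarrow> f' x" if "x \<in> space M" for x
      proof -
        have "((\<lambda>z. (f z x - f z0 x) / (z - z0)) \<longlongrightarrow> f' x) (at z0)"
          using der[OF that] by (simp add: has_field_derivative_iff)
        then show ?thesis
          using Y Ylim unfolding tendsto_at_iff_sequentially comp_def by blast
      qed
      have ms: "(\<lambda>x. (f (Y i) x - f z0 x) / (Y i - z0)) \<in> borel_measurable M" for i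
        using meas[OF z0] meas[OF subsetD[OF d(2) Y(2)], of i] by measurable
      have "(\<lambda>i. \<integral>x. (f (Y i) x - f z0 x) / (Y i - z0) \<partial>M) \<longlonglongrightarrow> integral\<^sup>L M f'"
      proof (rule integral_dominated_convergence[where w="\<lambda>x. 2 * B x / d"])
        show "f' \<in> borel_measurable M"
          using ms lim by (rule borel_measurable_LIMSEQ_metric)
        show "integrable M (\<lambda>x. 2 * B x / d)" using B by auto
        show "AE x in M. (\<lambda>i. (f (Y i) x - f z0 x) / (Y i - z0)) \<longlonglongrightarrow> f' x"
          using lim by (auto intro: AE_I2)
        show "AE x in M. norm ((f (Y i) x - f z0 x) / (Y i - z0)) \<le> 2 * B x / d" for i
        proof (rule AE_I2)
          fix x assume "x \<in> space M"
          from lip[OF Y(1) this, of i] show "norm ((f (Y i) x - f z0 x) / (Y i - z0)) \<le> 2 * B x / d"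
            using Y(3)[of i] by (simp add: norm_divide pos_divide_le_eq)
        qed
      qed (rule ms)
      moreover have "(\<integral>x. (f (Y i) x - f z0 x) / (Y i - z0) \<partial>M) =
          (integral\<^sup>L M (f (Y i)) - integral\<^sup>L M (f z0)) / (Y i - z0)" for i
        using int[OF Y(2)] int[of z0] d by (simp add: Bochner_Integration.integral_diff)
      ultimately have "(\<lambda>i. (integral\<^sup>L M (f (Y i)) - integral\<^sup>L M (f z0)) / (Y i - z0)) \<longlonglongrightarrow> integral\<^sup>L M f'"
        by (simp only:)
      then show "(\<lambda>i. (integral\<^sup>L M (f (X i)) - integral\<^sup>L M (f z0)) / (X i - z0)) \<longlonglongrightarrow> integral\<^sup>L M f'"
        unfolding Y_def by (rule LIMSEQ_offset)
    qed
    then show ?thesis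
      unfolding field_differentiable_def has_field_derivative_iff by blast
  qed
  then show ?thesis
    using S by (simp add: holomorphic_on_open field_differentiable_def)
qed

section \<open>Tonelli on rectangles, and folding the torus onto half a period of offsets\<close>

lemma rectangle_sets_lborel [measurable, simp]:
  fixes A B :: "real set"
  assumes "A \<in> sets borel" "B \<in> sets borel"
  shows "A \<times> B \<in> sets (borel :: (real \<times> real) measure)"
  unfolding borel_prod[symmetric] using assms by auto

text \<open>The factor c is 1 for points ahead of s and -1 for points behind it; both halves of a
  period use this form.\<close>

lemma borel_measurable_shear:
  fixes f :: "real \<times> real \<Rightarrow> 'b :: topological_space"
  assumes "f \<in> borel_measurable borel"
  shows "(\<lambda>p. f (fst p, fst p + c * snd p)) \<in> borel_measurable borel"
  by (rule measurable_compose[OF borel_measurable_continuous_onI assms]) (intro continuous_intros)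

lemma nn_integral_lborel_Times:
  fixes f :: "real \<times> real \<Rightarrow> ennreal"
  assumes [measurable]: "f \<in> borel_measurable borel" "A \<in> sets borel" "B \<in> sets borel"
  shows "(\<integral>\<^sup>+p\<in>A \<times> B. f p \<partial>lborel) = (\<integral>\<^sup>+s\<in>A. (\<integral>\<^sup>+u\<in>B. f (s, u) \<partial>lborel) \<partial>lborel)"
proof -
  have m: "(\<lambda>p. f p * indicator (A \<times> B) p) \<in> borel_measurable (lborel \<Otimes>\<^sub>M lborel)"
    unfolding lborel_prod by measurable
  have "(\<integral>\<^sup>+p\<in>A \<times> B. f p \<partial>lborel) = (\<integral>\<^sup>+s. (\<integral>\<^sup>+u. f (s, u) * indicator (A \<times> B) (s, u) \<partial>lborel) \<partial>lborel)"
    by (subst lborel.nn_integral_fst[OF m]) (simp add: lborel_prod)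
  also have "\<dots> = (\<integral>\<^sup>+s\<in>A. (\<integral>\<^sup>+u\<in>B. f (s, u) \<partial>lborel) \<partial>lborel)"
    by (intro nn_integral_cong) (auto simp: indicator_times split: split_indicator)
  finally show ?thesis .
qed

lemma set_integral_lborel_Times:
  fixes f :: "real \<times> real \<Rightarrow> 'b :: {banach, second_countable_topology}"
  assumes f: "set_integrable lborel (A \<times> B) f"
  shows "(LINT p:A \<times> B|lborel. f p) = (LINT s:A|lborel. LINT u:B|lborel. f (s, u))"
proof -
  have f': "integrable (lborel \<Otimes>\<^sub>M lborel) (\<lambda>p. indicator (A \<times> B) p *\<^sub>R f p)"
    using f by (simp add: set_integrable_def lborel_prod)
  have eq: "indicator (A \<times> B) (s, u) *\<^sub>R f (s, u) = indicator A s *\<^sub>R (indicator B u *\<^sub>R f (s, u))" for s u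
    by (auto split: split_indicator)
  show "(LINT p:A \<times> B|lborel. f p) = (LINT s:A|lborel. LINT u:B|lborel. f (s, u))"
    using lborel_pair.integral_fst'[OF f']
    unfolding set_lebesgue_integral_def lborel_prod eq by (simp del: scaleR_scaleR)
qed

text \<open>Periodicity moves [0, s) to [2a, s + 2a), which gives the window [s, s + 2a), cut at s +
  a. On the second half t = s + 2a - u, and one period brings this back to s - u. For nonnegative f
  no integrability has to be tracked; the signed versions are derived from this one.\<close>

lemma nn_integral_period_shift:
  fixes f :: "real \<Rightarrow> ennreal"
  assumes [measurable]: "f \<in> borel_measurable borel"
    and per: "\<And>t. f (t + 2 * a) = f t" and s: "0 \<le> s" "s < 2 * a"
  shows "(\<integral>\<^sup>+t\<in>{0..<2*a}. f t \<partial>lborel) =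
    (\<integral>\<^sup>+u\<in>{0<..<a}. f (s + u) \<partial>lborel) + (\<integral>\<^sup>+u\<in>{0<..<a}. f (s - u) \<partial>lborel)"
proof -
  have a: "a > 0" using s by simp
  have "(\<integral>\<^sup>+t\<in>{0..<2*a}. f t \<partial>lborel) = (\<integral>\<^sup>+t\<in>{0..<s} \<union> {s..<2*a}. f t \<partial>lborel)"
    using s by (simp add: ivl_disj_un)
  also have "\<dots> = (\<integral>\<^sup>+t\<in>{0..<s}. f t \<partial>lborel) + (\<integral>\<^sup>+t\<in>{s..<2*a}. f t \<partial>lborel)"
    by (rule nn_integral_disjoint_pair) auto
  also have "(\<integral>\<^sup>+t\<in>{0..<s}. f t \<partial>lborel) = (\<integral>\<^sup>+t\<in>{2*a..<s+2*a}. f t \<partial>lborel)"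
    using per
    by (subst (2) nn_integral_real_affine[where c=1 and t="2*a"])
       (auto intro!: nn_integral_cong split: split_indicator simp: add.commute)
  also have "\<dots> + (\<integral>\<^sup>+t\<in>{s..<2*a}. f t \<partial>lborel) = (\<integral>\<^sup>+t\<in>{2*a..<s+2*a} \<union> {s..<2*a}. f t \<partial>lborel)"
    by (rule nn_integral_disjoint_pair[symmetric]) auto
  also have "{2*a..<s+2*a} \<union> {s..<2*a} = {s..<s+a} \<union> {s+a..<s+2*a}"
    using s by auto
  also have "(\<integral>\<^sup>+t\<in>{s..<s+a} \<union> {s+a..<s+2*a}. f t \<partial>lborel) =
      (\<integral>\<^sup>+t\<in>{s..<s+a}. f t \<partial>lborel) + (\<integral>\<^sup>+t\<in>{s+a..<s+2*a}. f t \<partial>lborel)"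
    by (rule nn_integral_disjoint_pair) auto
  also have "(\<integral>\<^sup>+t\<in>{s..<s+a}. f t \<partial>lborel) = (\<integral>\<^sup>+u\<in>{0<..<a}. f (s + u) \<partial>lborel)"
  proof (subst nn_integral_real_affine[where c=1 and t=s])
    \<comment> \<open>The open interval omits u = 0, where the later integrands are singular; one
      point is a null set.\<close>
    have "AE u in lborel. u \<noteq> (0::real)" by (rule AE_lborel_singleton)
    then have "AE u in lborel. f (s + u) * indicator {s..<s+a} (s + u) = f (s + u) * indicator {0<..<a} u"
      by eventually_elim (auto split: split_indicator)
    then show "ennreal \<bar>1\<bar> * (\<integral>\<^sup>+u. f (s + 1 * u) * indicator {s..<s+a} (s + 1 * u) \<partial>lborel) =
      (\<integral>\<^sup>+u\<in>{0<..<a}. f (s + u) \<partial>lborel)"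
      by (simp add: nn_integral_cong_AE)
  qed auto
  also have "(\<integral>\<^sup>+t\<in>{s+a..<s+2*a}. f t \<partial>lborel) = (\<integral>\<^sup>+u\<in>{0<..<a}. f (s - u) \<partial>lborel)"
  proof (subst nn_integral_real_affine[where c="-1" and t="s+2*a"])
    have pp: "f (s + 2*a - u) = f (s - u)" for u
      using per[of "s - u"] by (simp add: algebra_simps)
    have "AE u in lborel. u \<noteq> (a::real)" by (rule AE_lborel_singleton)
    then have "AE u in lborel. f (s + 2*a - u) * indicator {s+a..<s+2*a} (s + 2*a - u) = f (s - u) * indicator {0<..<a} u"
      by eventually_elim (use pp in \<open>auto split: split_indicator\<close>)
    then show "ennreal \<bar>-1\<bar> * (\<integral>\<^sup>+u. f (s + 2*a + -1 * u) * indicator {s+a..<s+2*a} (s + 2*a + -1 * u) \<partial>lborel) =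
      (\<integral>\<^sup>+u\<in>{0<..<a}. f (s - u) \<partial>lborel)"
      by (simp add: nn_integral_cong_AE)
  qed auto
  finally show ?thesis .
qed

lemma nn_integral_torus_shift:
  fixes f :: "real \<times> real \<Rightarrow> ennreal"
  assumes [measurable]: "f \<in> borel_measurable borel"
    and per: "\<And>s t. f (s, t + 2 * a) = f (s, t)"
  shows "(\<integral>\<^sup>+p\<in>{0..<2*a} \<times> {0..<2*a}. f p \<partial>lborel) =
    (\<integral>\<^sup>+p\<in>{0..<2*a} \<times> {0<..<a}. f (fst p, fst p + snd p) \<partial>lborel) +
    (\<integral>\<^sup>+p\<in>{0..<2*a} \<times> {0<..<a}. f (fst p, fst p - snd p) \<partial>lborel)"
proof -
  have [measurable]: "(\<lambda>p. f (fst p, fst p + snd p)) \<in> borel_measurable borel"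
    "(\<lambda>p. f (fst p, fst p - snd p)) \<in> borel_measurable borel"
    using borel_measurable_shear[OF assms(1), of 1] borel_measurable_shear[OF assms(1), of "-1"] by simp_all
  have [measurable]: "(\<lambda>u. f (s, u)) \<in> borel_measurable borel" for s
    by (rule measurable_compose[OF borel_measurable_continuous_onI assms(1)]) (intro continuous_intros)
  have m: "(\<lambda>s. \<integral>\<^sup>+u\<in>{0<..<a}. g (s, u) \<partial>lborel) \<in> borel_measurable borel"
    if [measurable]: "g \<in> borel_measurable borel" for g :: "real \<times> real \<Rightarrow> ennreal"
  proof -
    have "(\<lambda>p. g p * indicator (UNIV \<times> {0<..<a}) p) \<in> borel_measurable (lborel \<Otimes>\<^sub>M lborel)"
      unfolding lborel_prod by measurable
    from lborel.borel_measurable_nn_integral_fst[OF this] show ?thesis by (simp add: indicator_times)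
  qed
  have "(\<integral>\<^sup>+p\<in>{0..<2*a} \<times> {0..<2*a}. f p \<partial>lborel) =
     (\<integral>\<^sup>+s\<in>{0..<2*a}. (\<integral>\<^sup>+t\<in>{0..<2*a}. f (s, t) \<partial>lborel) \<partial>lborel)"
    by (rule nn_integral_lborel_Times) auto
  also have "\<dots> = (\<integral>\<^sup>+s\<in>{0..<2*a}. ((\<integral>\<^sup>+u\<in>{0<..<a}. f (s, s + u) \<partial>lborel) + (\<integral>\<^sup>+u\<in>{0<..<a}. f (s, s - u) \<partial>lborel)) \<partial>lborel)"
    by (intro nn_integral_cong) (auto split: split_indicator simp: per intro!: nn_integral_period_shift)
  also have "\<dots> = (\<integral>\<^sup>+s\<in>{0..<2*a}. (\<integral>\<^sup>+u\<in>{0<..<a}. f (s, s + u) \<partial>lborel) \<partial>lborel) +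
      (\<integral>\<^sup>+s\<in>{0..<2*a}. (\<integral>\<^sup>+u\<in>{0<..<a}. f (s, s - u) \<partial>lborel) \<partial>lborel)"
    using m[of "\<lambda>p. f (fst p, fst p + snd p)"] m[of "\<lambda>p. f (fst p, fst p - snd p)"]
    by (intro nn_set_integral_add) auto
  also have "(\<integral>\<^sup>+s\<in>{0..<2*a}. (\<integral>\<^sup>+u\<in>{0<..<a}. f (s, s + u) \<partial>lborel) \<partial>lborel) =
      (\<integral>\<^sup>+p\<in>{0..<2*a} \<times> {0<..<a}. f (fst p, fst p + snd p) \<partial>lborel)"
    by (subst nn_integral_lborel_Times) auto
  also have "(\<integral>\<^sup>+s\<in>{0..<2*a}. (\<integral>\<^sup>+u\<in>{0<..<a}. f (s, s - u) \<partial>lborel) \<partial>lborel) =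
      (\<integral>\<^sup>+p\<in>{0..<2*a} \<times> {0<..<a}. f (fst p, fst p - snd p) \<partial>lborel)"
    by (subst nn_integral_lborel_Times) auto
  finally show ?thesis .
qed

text \<open>\<open>ennreal\<close> truncates negative values to 0, so the two terms are the positive
  and the negative part. The folding identity is applied to each, and finiteness lets
  \<open>enn2real\<close> distribute over the sums.\<close>

lemma set_integral_eq_enn2real_diff:
  fixes g :: "'a \<Rightarrow> real"
  assumes "set_integrable M A g"
  shows "(LINT x:A|M. g x) = enn2real (\<integral>\<^sup>+x\<in>A. ennreal (g x) \<partial>M) - enn2real (\<integral>\<^sup>+x\<in>A. ennreal (- g x) \<partial>M)"
    and "(\<integral>\<^sup>+x\<in>A. ennreal (g x) \<partial>M) < \<infinity>" and "(\<integral>\<^sup>+x\<in>A. ennreal (- g x) \<partial>M) < \<infinity>"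
proof -
  have i: "integrable M (\<lambda>x. indicator A x *\<^sub>R g x)" using assms by (simp add: set_integrable_def)
  have eq: "(\<integral>\<^sup>+x\<in>A. ennreal (g x) \<partial>M) = (\<integral>\<^sup>+x. ennreal (indicator A x *\<^sub>R g x) \<partial>M)"
    "(\<integral>\<^sup>+x\<in>A. ennreal (- g x) \<partial>M) = (\<integral>\<^sup>+x. ennreal (- (indicator A x *\<^sub>R g x)) \<partial>M)"
    by (auto intro!: nn_integral_cong split: split_indicator)
  show "(LINT x:A|M. g x) = enn2real (\<integral>\<^sup>+x\<in>A. ennreal (g x) \<partial>M) - enn2real (\<integral>\<^sup>+x\<in>A. ennreal (- g x) \<partial>M)"
    unfolding eq set_lebesgue_integral_def by (rule real_lebesgue_integral_def[OF i])
  show "(\<integral>\<^sup>+x\<in>A. ennreal (g x) \<partial>M) < \<infinity>" "(\<integral>\<^sup>+x\<in>A. ennreal (- g x) \<partial>M) < \<infinity>"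
    unfolding eq using i by (auto simp: real_integrable_def top.not_eq_extremum)
qed

lemma nn_integral_norm_set_integrable_iff:
  fixes f :: "'a \<Rightarrow> 'b :: {banach, second_countable_topology}"
  assumes "set_borel_measurable M A f"
  shows "set_integrable M A f \<longleftrightarrow> (\<integral>\<^sup>+x\<in>A. ennreal (norm (f x)) \<partial>M) < \<infinity>"
proof -
  have "(\<integral>\<^sup>+x. ennreal (norm (indicator A x *\<^sub>R f x)) \<partial>M) = (\<integral>\<^sup>+x\<in>A. ennreal (norm (f x)) \<partial>M)"
    by (auto intro!: nn_integral_cong split: split_indicator)
  then show ?thesis
    using assms by (simp add: set_integrable_def set_borel_measurable_def integrable_iff_bounded)
qed

lemma nn_integral_norm_set_integrable:
  fixes f :: "'a \<Rightarrow> 'b :: {banach, second_countable_topology}"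
  assumes "set_integrable M A f"
  shows "(\<integral>\<^sup>+x\<in>A. ennreal (norm (f x)) \<partial>M) < \<infinity>"
  using assms nn_integral_norm_set_integrable_iff[of M A f]
  by (auto simp: set_integrable_def set_borel_measurable_def)

lemma set_integrable_torus_shift:
  fixes f :: "real \<times> real \<Rightarrow> 'b :: {banach, second_countable_topology}"
  assumes f [measurable]: "f \<in> borel_measurable borel"
    and per: "\<And>s t. f (s, t + 2 * a) = f (s, t)"
    and i1: "set_integrable lborel ({0..<2*a} \<times> {0<..<a}) (\<lambda>p. f (fst p, fst p + snd p))"
    and i2: "set_integrable lborel ({0..<2*a} \<times> {0<..<a}) (\<lambda>p. f (fst p, fst p - snd p))"
  shows "set_integrable lborel ({0..<2*a} \<times> {0..<2*a}) f"
proof -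
  have "(\<integral>\<^sup>+p\<in>{0..<2*a} \<times> {0..<2*a}. ennreal (norm (f p)) \<partial>lborel) < \<infinity>"
    using nn_integral_norm_set_integrable[OF i1] nn_integral_norm_set_integrable[OF i2]
    by (subst nn_integral_torus_shift) (auto simp: per)
  then show ?thesis
    by (subst nn_integral_norm_set_integrable_iff) (auto simp: set_borel_measurable_def)
qed

lemma set_integral_torus_shift_real:
  fixes f :: "real \<times> real \<Rightarrow> real"
  assumes f [measurable]: "f \<in> borel_measurable borel"
    and per: "\<And>s t. f (s, t + 2 * a) = f (s, t)"
    and i1: "set_integrable lborel ({0..<2*a} \<times> {0<..<a}) (\<lambda>p. f (fst p, fst p + snd p))"
    and i2: "set_integrable lborel ({0..<2*a} \<times> {0<..<a}) (\<lambda>p. f (fst p, fst p - snd p))"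
  shows "(LINT p:{0..<2*a} \<times> {0..<2*a}|lborel. f p) =
    (LINT p:{0..<2*a} \<times> {0<..<a}|lborel. f (fst p, fst p + snd p)) +
    (LINT p:{0..<2*a} \<times> {0<..<a}|lborel. f (fst p, fst p - snd p))"
proof -
  have m: "(\<lambda>p. ennreal (f p)) \<in> borel_measurable borel" "(\<lambda>p. ennreal (- f p)) \<in> borel_measurable borel"
    by measurable
  note s1 = set_integral_eq_enn2real_diff[OF i1]
  note s2 = set_integral_eq_enn2real_diff[OF i2]
  show ?thesis
    unfolding set_integral_eq_enn2real_diff(1)[OF set_integrable_torus_shift[OF assms]] s1(1) s2(1)
      nn_integral_torus_shift[OF m(1) arg_cong[OF per, of ennreal]]
      nn_integral_torus_shift[OF m(2) arg_cong[OF per, of "\<lambda>x. ennreal (- x)"]]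
    using s1(2,3) s2(2,3) by (simp add: enn2real_plus)
qed

lemma set_integral_torus_shift_complex:
  fixes f :: "real \<times> real \<Rightarrow> complex"
  assumes f [measurable]: "f \<in> borel_measurable borel"
    and per: "\<And>s t. f (s, t + 2 * a) = f (s, t)"
    and i1: "set_integrable lborel ({0..<2*a} \<times> {0<..<a}) (\<lambda>p. f (fst p, fst p + snd p))"
    and i2: "set_integrable lborel ({0..<2*a} \<times> {0<..<a}) (\<lambda>p. f (fst p, fst p - snd p))"
  shows "(LINT p:{0..<2*a} \<times> {0..<2*a}|lborel. f p) =
    (LINT p:{0..<2*a} \<times> {0<..<a}|lborel. f (fst p, fst p + snd p)) +
    (LINT p:{0..<2*a} \<times> {0<..<a}|lborel. f (fst p, fst p - snd p))"
proof -
  have Re: "set_integrable M A (\<lambda>x. Re (g x))" "(LINT x:A|M. Re (g x)) = Re (LINT x:A|M. g x)"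
    and Im: "set_integrable M A (\<lambda>x. Im (g x))" "(LINT x:A|M. Im (g x)) = Im (LINT x:A|M. g x)"
    if "set_integrable M A g" for M :: "(real \<times> real) measure" and A g
  proof -
    have i: "integrable M (\<lambda>x. indicator A x *\<^sub>R g x)" using that by (simp add: set_integrable_def)
    show "set_integrable M A (\<lambda>x. Re (g x))" "set_integrable M A (\<lambda>x. Im (g x))"
      "(LINT x:A|M. Re (g x)) = Re (LINT x:A|M. g x)" "(LINT x:A|M. Im (g x)) = Im (LINT x:A|M. g x)"
      using integrable_Re[OF i] integrable_Im[OF i] integral_Re[OF i] integral_Im[OF i]
      by (simp_all add: set_integrable_def set_lebesgue_integral_def)
  qed
  note i = set_integrable_torus_shift[OF assms]
  show ?thesis
  proof (rule complex_eqI)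
    show "Re (LINT p:{0..<2*a} \<times> {0..<2*a}|lborel. f p) = Re ((LINT p:{0..<2*a} \<times> {0<..<a}|lborel. f (fst p, fst p + snd p)) +
        (LINT p:{0..<2*a} \<times> {0<..<a}|lborel. f (fst p, fst p - snd p)))"
      using set_integral_torus_shift_real[of "\<lambda>p. Re (f p)" a] Re[OF i] Re[OF i1] Re[OF i2] per by simp
    show "Im (LINT p:{0..<2*a} \<times> {0..<2*a}|lborel. f p) = Im ((LINT p:{0..<2*a} \<times> {0<..<a}|lborel. f (fst p, fst p + snd p)) +
        (LINT p:{0..<2*a} \<times> {0<..<a}|lborel. f (fst p, fst p - snd p)))"
      using set_integral_torus_shift_real[of "\<lambda>p. Im (f p)" a] Im[OF i] Im[OF i1] Im[OF i2] per by simp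
  qed
qed

section \<open>Domination by powers of the offset\<close>

lemma set_integrable_powr_Ioo:
  fixes x a :: real
  assumes "x > -1"
  shows "set_integrable lborel {0<..<a} (\<lambda>u. u powr x)"
proof (cases "a > 0")
  case True
  have "(\<lambda>u. u powr x) absolutely_integrable_on {0..a}"
    using assms True by (intro nonnegative_absolutely_integrable_1 integrable_on_powr_from_0) auto
  then have "set_integrable lborel {0..a} (\<lambda>u. u powr x)"
    unfolding set_integrable_def by (subst (asm) integrable_completion) auto
  then show ?thesis by (rule set_integrable_subset) auto
qed auto

lemma set_integrable_Ioo_powr_bound:
  fixes g :: "real \<Rightarrow> 'b :: {banach, second_countable_topology}"
  assumes "x > -1" "continuous_on {0<..<a} g" "\<And>u. 0 < u \<Longrightarrow> u < a \<Longrightarrow> norm (g u) \<le> C * u powr x"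
  shows "set_integrable lborel {0<..<a} g"
proof (rule set_integrable_bound)
  show "set_integrable lborel {0<..<a} (\<lambda>u. C * u powr x)"
    using set_integrable_powr_Ioo[OF assms(1)] by simp
  show "set_borel_measurable lborel {0<..<a} g"
    using borel_measurable_continuous_on_indicator[OF _ assms(2)] by (simp add: set_borel_measurable_def)
  show "AE u in lborel. u \<in> {0<..<a} \<longrightarrow> norm (g u) \<le> norm (C * u powr x)"
    using assms(3) by (intro AE_I2 impI) (fastforce intro: order_trans[OF _ abs_ge_self])
qed

lemma set_integrable_rect_snd_powr:
  fixes x a l :: real
  assumes "x > -1"
  shows "set_integrable lborel ({0..<l} \<times> {0<..<a}) (\<lambda>p. snd p powr x)"
proof -
  have m: "(\<lambda>p :: real \<times> real. snd p powr x) \<in> borel_measurable borel"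
    unfolding borel_prod[symmetric] by measurable
  have "(\<integral>\<^sup>+p\<in>{0..<l} \<times> {0<..<a}. ennreal (norm (snd p powr x)) \<partial>lborel) =
     (\<integral>\<^sup>+s\<in>{0..<l}. (\<integral>\<^sup>+u\<in>{0<..<a}. ennreal (norm (u powr x)) \<partial>lborel) \<partial>lborel)"
    using m by (subst nn_integral_lborel_Times) auto
  also have "\<dots> = (\<integral>\<^sup>+u\<in>{0<..<a}. ennreal (norm (u powr x)) \<partial>lborel) * emeasure lborel {0..<l}"
    by (rule nn_integral_cmult_indicator) auto
  also have "\<dots> < \<infinity>"
    using set_integrable_powr_Ioo[OF assms, of a]
      nn_integral_norm_set_integrable[OF set_integrable_powr_Ioo[OF assms, of a]]
    by (cases "l \<ge> 0") (auto simp: ennreal_mult_less_top)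
  finally show ?thesis
    using m by (subst nn_integral_norm_set_integrable_iff) (auto simp: set_borel_measurable_def)
qed

text \<open>The standard form of domination: x = Re w for u^w times a bounded kernel, x = 0 for
  bounded integrands such as \<kappa> - 1 / u.\<close>

lemma set_integrable_rect_powr_bound:
  fixes g :: "real \<times> real \<Rightarrow> 'b :: {banach, second_countable_topology}"
  assumes "x > -1" "set_borel_measurable lborel ({0..<l} \<times> {0<..<a}) g"
    "\<And>s u. 0 \<le> s \<Longrightarrow> s < l \<Longrightarrow> 0 < u \<Longrightarrow> u < a \<Longrightarrow> norm (g (s, u)) \<le> C * u powr x"
  shows "set_integrable lborel ({0..<l} \<times> {0<..<a}) g"
proof (rule set_integrable_bound)
  show "set_integrable lborel ({0..<l} \<times> {0<..<a}) (\<lambda>p. C * snd p powr x)"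
    using set_integrable_rect_snd_powr[OF assms(1)] by simp
  show "AE p in lborel. p \<in> {0..<l} \<times> {0<..<a} \<longrightarrow> norm (g p) \<le> norm (C * snd p powr x)"
    using assms(3) by (intro AE_I2 impI) (fastforce intro: order_trans[OF _ abs_ge_self])
qed fact

lemma set_borel_measurable_rect_continuous:
  fixes g :: "real \<times> real \<Rightarrow> 'b :: {banach, second_countable_topology}"
  assumes "continuous_on ({0..<l} \<times> {0<..<a}) g"
  shows "set_borel_measurable lborel ({0..<l} \<times> {0<..<a}) g"
  using borel_measurable_continuous_on_indicator[OF _ assms] by (simp add: set_borel_measurable_def)

section \<open>Cut-off integrals of 1 / u\<close>

lemma set_integral_rect_inverse_cutoff:
  fixes a b l :: real
  assumes "0 < b" "b < a" "0 < l"
  shows "set_integrable lborel ({0..<l} \<times> {0<..<a}) (\<lambda>p. if b < snd p then 1 / snd p else 0)"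
    and "(LINT p:{0..<l} \<times> {0<..<a}|lborel. if b < snd p then 1 / snd p else 0) = l * (ln a - ln b)"
proof -
  have m: "(\<lambda>p :: real \<times> real. if b < snd p then 1 / snd p else 0) \<in> borel_measurable borel"
    unfolding borel_prod[symmetric] by measurable
  show i: "set_integrable lborel ({0..<l} \<times> {0<..<a}) (\<lambda>p. if b < snd p then 1 / snd p else 0)"
  proof (rule set_integrable_rect_powr_bound[where x=0 and C="1/b"])
    show "set_borel_measurable lborel ({0..<l} \<times> {0<..<a}) (\<lambda>p. if b < snd p then 1 / snd p else 0)"
      using m by (auto simp: set_borel_measurable_def)
  qed (use assms in \<open>auto simp: field_simps\<close>)
  have "(LINT u:{0<..<a}|lborel. if b < u then 1 / u else 0) = (LINT u:{b..a}|lborel. 1 / u)"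
    unfolding set_lebesgue_integral_def
  proof (rule integral_cong_AE)
    have "AE u in lborel. u \<noteq> b" "AE u in lborel. u \<noteq> a" by (rule AE_lborel_singleton)+
    then show "AE u in lborel. indicator {0<..<a} u *\<^sub>R (if b < u then 1 / u else 0) = indicator {b..a} u *\<^sub>R (1 / u)"
      by eventually_elim (use assms in \<open>auto split: split_indicator\<close>)
  qed auto
  also have "\<dots> = integral {b..a} (\<lambda>u. 1 / u)"
    using assms by (intro set_borel_integral_eq_integral(2) borel_integrable_atLeastAtMost')
      (auto intro!: continuous_intros)
  also have "((\<lambda>u. 1 / u) has_integral (ln a - ln b)) {b..a}"
    using assms by (intro fundamental_theorem_of_calculus)
      (auto intro!: derivative_eq_intros simp: has_real_derivative_iff_has_vector_derivative[symmetric])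
  then have "integral {b..a} (\<lambda>u. 1 / u) = ln a - ln b" by (rule integral_unique)
  finally show "(LINT p:{0..<l} \<times> {0<..<a}|lborel. if b < snd p then 1 / snd p else 0) = l * (ln a - ln b)"
    using assms unfolding set_integral_lborel_Times[OF i] snd_conv by (simp add: set_lebesgue_integral_def)
qed

text \<open>R stands for the chord length. As R \<le> u, the region R > \<epsilon> lies in u >
  \<epsilon>, which gives the upper bound l ln a. Conversely, R \<le> \<epsilon> forces u \<le>
  \<epsilon> / c by the linear bound, and then u \<le> \<epsilon> + K (\<epsilon> / c)^2 by the
  quadratic one. So the region contains u > b with b = \<epsilon> (1 + K' \<epsilon>) and K' = K /
  c^2, and the loss l ln (1 + K' \<epsilon>) tends to 0.\<close>

lemma set_integral_cutoff_limit:
  fixes R :: "real \<times> real \<Rightarrow> real"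
  assumes R [measurable]: "R \<in> borel_measurable borel" and "0 < a" "0 < l" "0 < c" "0 \<le> K"
    and lower: "\<And>s u. 0 \<le> s \<Longrightarrow> s < l \<Longrightarrow> 0 < u \<Longrightarrow> u < a \<Longrightarrow> c * u \<le> R (s, u)"
    and upper: "\<And>s u. 0 \<le> s \<Longrightarrow> s < l \<Longrightarrow> 0 < u \<Longrightarrow> u < a \<Longrightarrow> R (s, u) \<le> u"
    and quad: "\<And>s u. 0 \<le> s \<Longrightarrow> s < l \<Longrightarrow> 0 < u \<Longrightarrow> u < a \<Longrightarrow> u - K * u\<^sup>2 \<le> R (s, u)"
  shows "\<And>\<epsilon>. 0 < \<epsilon> \<Longrightarrow> \<epsilon> < a \<Longrightarrow> set_integrable lborel ({0..<l} \<times> {0<..<a}) (\<lambda>p. if \<epsilon> < R p then 1 / snd p else 0)"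
    and "((\<lambda>\<epsilon>. (LINT p:{0..<l} \<times> {0<..<a}|lborel. if \<epsilon> < R p then 1 / snd p else 0) + l * ln \<epsilon>)
      \<longlongrightarrow> l * ln a) (at_right 0)"
proof -
  define P where "P = {0..<l} \<times> {0<..<a}"
  define K' where "K' = K / c\<^sup>2"
  have K': "K' \<ge> 0" using assms by (auto simp: K'_def)
  have [measurable]: "P \<in> sets lborel" by (simp add: P_def)
  have m: "(\<lambda>p :: real \<times> real. if \<epsilon> < R p then 1 / snd p else 0) \<in> borel_measurable borel" for \<epsilon>
    using R unfolding borel_prod[symmetric] by measurable
  show i: "set_integrable lborel ({0..<l} \<times> {0<..<a}) (\<lambda>p. if \<epsilon> < R p then 1 / snd p else 0)"
    if "0 < \<epsilon>" "\<epsilon> < a" for \<epsilon>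
  proof (rule set_integrable_bound[OF set_integral_rect_inverse_cutoff(1)[OF that \<open>0 < l\<close>]])
    show "set_borel_measurable lborel ({0..<l} \<times> {0<..<a}) (\<lambda>p. if \<epsilon> < R p then 1 / snd p else 0)"
      using m by (auto simp: set_borel_measurable_def)
  qed (use upper in fastforce)
  show "((\<lambda>\<epsilon>. (LINT p:{0..<l} \<times> {0<..<a}|lborel. if \<epsilon> < R p then 1 / snd p else 0) + l * ln \<epsilon>)
      \<longlongrightarrow> l * ln a) (at_right 0)"
  proof (rule tendsto_sandwich)
    have "((\<lambda>\<epsilon>. l * ln a - l * ln (1 + K' * \<epsilon>)) \<longlongrightarrow> l * ln a - l * ln (1 + K' * 0)) (at_right 0)"
      by (intro tendsto_intros) auto
    then show "((\<lambda>\<epsilon>. l * ln a - l * ln (1 + K' * \<epsilon>)) \<longlongrightarrow> l * ln a) (at_right 0)" by simp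
    show "((\<lambda>\<epsilon>::real. l * ln a) \<longlongrightarrow> l * ln a) (at_right 0)" by simp
    have "((\<lambda>\<epsilon>. \<epsilon> * (1 + K' * \<epsilon>)) \<longlongrightarrow> 0 * (1 + K' * 0)) (at_right 0)"
      by (intro tendsto_intros)
    then have ev: "eventually (\<lambda>\<epsilon>. \<epsilon> * (1 + K' * \<epsilon>) < a) (at_right 0)"
      using order_tendstoD(2)[of _ 0 "at_right 0" a] \<open>0 < a\<close> by simp
    show "eventually (\<lambda>\<epsilon>. l * ln a - l * ln (1 + K' * \<epsilon>) \<le>
        (LINT p:{0..<l} \<times> {0<..<a}|lborel. if \<epsilon> < R p then 1 / snd p else 0) + l * ln \<epsilon>) (at_right 0)"
      using ev eventually_at_right_less[of 0]
    proof eventually_elim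
      case (elim \<epsilon>)
      define b where "b = \<epsilon> * (1 + K' * \<epsilon>)"
      have pos: "1 + K' * \<epsilon> > 0" using K' elim by (simp add: add_pos_nonneg)
      have b: "0 < b" "b < a" "\<epsilon> \<le> b" "ln b = ln \<epsilon> + ln (1 + K' * \<epsilon>)"
        using elim K' pos by (auto simp: b_def ln_mult mult_pos_pos)
      have e: "\<epsilon> < a" using b by simp
      have "(LINT p:P|lborel. if b < snd p then 1 / snd p else 0) \<le> (LINT p:P|lborel. if \<epsilon> < R p then 1 / snd p else 0)"
      proof (rule set_integral_mono)
        fix p assume "p \<in> P"
        then obtain s u where p: "p = (s, u)" "0 \<le> s" "s < l" "0 < u" "u < a" by (auto simp: P_def)
        have "\<epsilon> < R (s, u)" if "b < u"
        proof (rule ccontr)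
          assume *: "\<not> \<epsilon> < R (s, u)"
          have "c * u \<le> \<epsilon>" using lower[of s u] p * by simp
          then have "u \<le> \<epsilon> / c" using \<open>0 < c\<close> by (simp add: field_simps)
          then have "u\<^sup>2 \<le> (\<epsilon> / c)\<^sup>2" using p by (intro power_mono) auto
          then have "K * u\<^sup>2 \<le> K * (\<epsilon> / c)\<^sup>2" using \<open>0 \<le> K\<close> by (rule mult_left_mono)
          then have "u \<le> \<epsilon> + K * (\<epsilon> / c)\<^sup>2" using quad[of s u] p * by simp
          also have "\<dots> = b" by (simp add: b_def K'_def power2_eq_square algebra_simps)
          finally show False using that by simp
        qed
        then show "(if b < snd p then 1 / snd p else 0) \<le> (if \<epsilon> < R p then 1 / snd p else 0)"
          using p by auto
      qed (use i[OF elim(2) e] set_integral_rect_inverse_cutoff(1)[OF b(1,2) \<open>0 < l\<close>] in \<open>simp_all add: P_def\<close>)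
      then show ?case
        using set_integral_rect_inverse_cutoff(2)[OF b(1,2) \<open>0 < l\<close>] b(4)
        by (simp add: P_def algebra_simps)
    qed
    show "eventually (\<lambda>\<epsilon>. (LINT p:{0..<l} \<times> {0<..<a}|lborel. if \<epsilon> < R p then 1 / snd p else 0) + l * ln \<epsilon> \<le> l * ln a) (at_right 0)"
      using eventually_at_right_real[OF \<open>0 < a\<close>]
    proof eventually_elim
      case (elim \<epsilon>)
      then have e: "0 < \<epsilon>" "\<epsilon> < a" by auto
      have "(LINT p:P|lborel. if \<epsilon> < R p then 1 / snd p else 0) \<le> (LINT p:P|lborel. if \<epsilon> < snd p then 1 / snd p else 0)"
        using i[OF e] set_integral_rect_inverse_cutoff(1)[OF e \<open>0 < l\<close>] upper
        by (intro set_integral_mono) (fastforce simp: P_def)+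
      then show ?case
        using set_integral_rect_inverse_cutoff(2)[OF e \<open>0 < l\<close>]
        by (simp add: P_def algebra_simps)
    qed
  qed
qed

section \<open>Kernels smooth in the offset and entire in the exponent\<close>

text \<open>A kernel f s u z has base point s, arc length offset u and exponent z.\<close>

definition regular_kernel :: "real \<Rightarrow> (real \<Rightarrow> real \<Rightarrow> complex \<Rightarrow> complex) \<Rightarrow> bool" where
  "regular_kernel r f \<longleftrightarrow>
     continuous_on (UNIV \<times> {-r<..<r} \<times> UNIV) (\<lambda>p. f (fst p) (fst (snd p)) (snd (snd p))) \<and>
     (\<forall>s u. \<bar>u\<bar> < r \<longrightarrow> f s u holomorphic_on UNIV)"

lemma regular_kernel_continuous_on:
  assumes f: "regular_kernel r f" and "continuous_on A \<alpha>" "continuous_on A \<beta>" "continuous_on A \<zeta>"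
    and \<beta>: "\<And>x. x \<in> A \<Longrightarrow> \<bar>\<beta> x\<bar> < r"
  shows "continuous_on A (\<lambda>x. f (\<alpha> x) (\<beta> x) (\<zeta> x))"
proof -
  have "continuous_on A (\<lambda>x. (\<alpha> x, \<beta> x, \<zeta> x))"
    by (intro continuous_intros assms)
  moreover have "(\<lambda>x. (\<alpha> x, \<beta> x, \<zeta> x)) ` A \<subseteq> UNIV \<times> {-r<..<r} \<times> UNIV"
    using \<beta> by (auto simp: abs_less_iff minus_less_iff)
  ultimately show ?thesis
    using continuous_on_compose2[of "UNIV \<times> {-r<..<r} \<times> UNIV" "\<lambda>p. f (fst p) (fst (snd p)) (snd (snd p))"
        A "\<lambda>x. (\<alpha> x, \<beta> x, \<zeta> x)"] f
    by (simp add: regular_kernel_def)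
qed

text \<open>Only the offset u is differentiated; s stays a continuous parameter and z an entire one
  at every order. Recursion on the order, with the derivative again a kernel, lets the closure
  properties be proved by induction over n for all kernels at once.\<close>

primrec Ck_kernel :: "real \<Rightarrow> nat \<Rightarrow> (real \<Rightarrow> real \<Rightarrow> complex \<Rightarrow> complex) \<Rightarrow> bool" where
  "Ck_kernel r 0 f \<longleftrightarrow> regular_kernel r f"
| "Ck_kernel r (Suc n) f \<longleftrightarrow> regular_kernel r f \<and>
     (\<exists>f'. Ck_kernel r n f' \<and>
        (\<forall>s u z. \<bar>u\<bar> < r \<longrightarrow> ((\<lambda>v. f s v z) has_vector_derivative f' s u z) (at u)))"

lemma Ck_kernel_regular: "Ck_kernel r n f \<Longrightarrow> regular_kernel r f"
  by (cases n) auto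

lemma Ck_kernel_SucD: "Ck_kernel r (Suc n) f \<Longrightarrow> Ck_kernel r n f"
  by (induction n arbitrary: f) auto

lemma Ck_kernel_SucI:
  assumes "regular_kernel r f" "Ck_kernel r n f'"
    "\<And>s u z. \<bar>u\<bar> < r \<Longrightarrow> ((\<lambda>v. f s v z) has_vector_derivative f' s u z) (at u)"
  shows "Ck_kernel r (Suc n) f"
  using assms by auto

text \<open>Derivatives of products, exponentials and inverses contain f next to f', so f is handed
  over as well at the lower order n, at which the induction hypothesis speaks.\<close>

lemma Ck_kernel_SucE:
  assumes "Ck_kernel r (Suc n) f"
  obtains f' where "regular_kernel r f" "Ck_kernel r n f" "Ck_kernel r n f'"
    "\<And>s u z. \<bar>u\<bar> < r \<Longrightarrow> ((\<lambda>v. f s v z) has_vector_derivative f' s u z) (at u)"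
  using assms Ck_kernel_SucD[OF assms] by auto

section \<open>Closure of kernels under algebra, analytic functions, reflection and
  translation\<close>

lemma regular_kernel_compose:
  assumes f: "regular_kernel r f" and G: "G holomorphic_on T" "open T"
    and T: "\<And>s u z. \<bar>u\<bar> < r \<Longrightarrow> f s u z \<in> T"
  shows "regular_kernel r (\<lambda>s u z. G (f s u z))"
  unfolding regular_kernel_def
proof (intro conjI allI impI)
  have "continuous_on T G" using G by (simp add: holomorphic_on_imp_continuous_on)
  then show "continuous_on (UNIV \<times> {-r<..<r} \<times> UNIV) (\<lambda>p. G (f (fst p) (fst (snd p)) (snd (snd p))))"
    by (rule continuous_on_compose2) (auto intro!: T continuous_intros regular_kernel_continuous_on[OF f])
  fix s u assume "\<bar>u\<bar> < r"
  then have "G \<circ> f s u holomorphic_on UNIV"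
    using f G T by (intro holomorphic_on_compose_gen[of _ _ G T]) (auto simp: regular_kernel_def)
  then show "(\<lambda>z. G (f s u z)) holomorphic_on UNIV" by (simp add: o_def)
qed

lemma regular_kernel_add:
  "regular_kernel r f \<Longrightarrow> regular_kernel r g \<Longrightarrow> regular_kernel r (\<lambda>s u z. f s u z + g s u z)"
  unfolding regular_kernel_def by (auto intro!: continuous_intros holomorphic_intros)

lemma regular_kernel_mult:
  "regular_kernel r f \<Longrightarrow> regular_kernel r g \<Longrightarrow> regular_kernel r (\<lambda>s u z. f s u z * g s u z)"
  unfolding regular_kernel_def by (auto intro!: continuous_intros holomorphic_intros)

lemma Ck_kernel_fst:
  assumes "continuous_on UNIV \<phi>" shows "Ck_kernel r n (\<lambda>s u z. \<phi> s)"
proof -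
  have reg: "regular_kernel r (\<lambda>s u z. \<phi> s)" if "continuous_on UNIV \<phi>" for \<phi>
    unfolding regular_kernel_def
    using that by (auto intro!: continuous_on_compose2[OF that] continuous_intros)
  show ?thesis
    using assms
  proof (induction n arbitrary: \<phi>)
    case (Suc n)
    show ?case
      by (rule Ck_kernel_SucI[OF reg[OF Suc.prems] Suc.IH[of "\<lambda>_. 0"]]) auto
  qed (use reg in auto)
qed

lemma Ck_kernel_param: "Ck_kernel r n (\<lambda>s u z. z)"
proof -
  have reg: "regular_kernel r (\<lambda>s u z. z)"
    unfolding regular_kernel_def by (auto intro!: continuous_intros holomorphic_intros)
  show ?thesis
  proof (cases n)
    case (Suc m)
    show ?thesis unfolding Suc
      by (rule Ck_kernel_SucI[OF reg Ck_kernel_fst[of "\<lambda>_. 0"]]) auto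
  qed (use reg in auto)
qed

lemma Ck_kernel_add:
  "Ck_kernel r n f \<Longrightarrow> Ck_kernel r n g \<Longrightarrow> Ck_kernel r n (\<lambda>s u z. f s u z + g s u z)"
proof (induction n arbitrary: f g)
  case 0
  then show ?case by (simp add: regular_kernel_add)
next
  case (Suc n)
  obtain f' where f: "regular_kernel r f" "Ck_kernel r n f" "Ck_kernel r n f'"
    "\<And>s u z. \<bar>u\<bar> < r \<Longrightarrow> ((\<lambda>v. f s v z) has_vector_derivative f' s u z) (at u)"
    using Suc.prems(1) by (rule Ck_kernel_SucE) blast
  obtain g' where g: "regular_kernel r g" "Ck_kernel r n g" "Ck_kernel r n g'"
    "\<And>s u z. \<bar>u\<bar> < r \<Longrightarrow> ((\<lambda>v. g s v z) has_vector_derivative g' s u z) (at u)"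
    using Suc.prems(2) by (rule Ck_kernel_SucE) blast
  show ?case
    by (rule Ck_kernel_SucI[OF regular_kernel_add[OF f(1) g(1)] Suc.IH[OF f(3) g(3)]])
       (auto intro!: has_vector_derivative_add f g)
qed

lemma Ck_kernel_mult:
  "Ck_kernel r n f \<Longrightarrow> Ck_kernel r n g \<Longrightarrow> Ck_kernel r n (\<lambda>s u z. f s u z * g s u z)"
proof (induction n arbitrary: f g)
  case 0
  then show ?case by (simp add: regular_kernel_mult)
next
  case (Suc n)
  obtain f' where f: "regular_kernel r f" "Ck_kernel r n f" "Ck_kernel r n f'"
    "\<And>s u z. \<bar>u\<bar> < r \<Longrightarrow> ((\<lambda>v. f s v z) has_vector_derivative f' s u z) (at u)"
    using Suc.prems(1) by (rule Ck_kernel_SucE) blast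
  obtain g' where g: "regular_kernel r g" "Ck_kernel r n g" "Ck_kernel r n g'"
    "\<And>s u z. \<bar>u\<bar> < r \<Longrightarrow> ((\<lambda>v. g s v z) has_vector_derivative g' s u z) (at u)"
    using Suc.prems(2) by (rule Ck_kernel_SucE) blast
  show ?case
    by (rule Ck_kernel_SucI[OF regular_kernel_mult[OF f(1) g(1)]
          Ck_kernel_add[OF Suc.IH[OF f(2) g(3)] Suc.IH[OF f(3) g(2)]]])
       (auto intro!: has_vector_derivative_mult f g)
qed

lemma Ck_kernel_sum:
  assumes "\<And>i. i \<in> I \<Longrightarrow> Ck_kernel r n (f i)"
  shows "Ck_kernel r n (\<lambda>s u z. \<Sum>i\<in>I. f i s u z)"
  using assms
proof (induction I rule: infinite_finite_induct)
  case (insert i I)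
  then show ?case using Ck_kernel_add[of r n "f i" "\<lambda>s u z. \<Sum>i\<in>I. f i s u z"] by simp
qed (use Ck_kernel_fst[of "\<lambda>_. 0"] in auto)

lemma Ck_kernel_uminus:
  assumes "Ck_kernel r n f" shows "Ck_kernel r n (\<lambda>s u z. - f s u z)"
  using Ck_kernel_mult[OF Ck_kernel_fst[of "\<lambda>_. -1"] assms] by simp

lemma Ck_kernel_exp: "Ck_kernel r n f \<Longrightarrow> Ck_kernel r n (\<lambda>s u z. exp (f s u z))"
proof (induction n arbitrary: f)
  case 0
  then show ?case using regular_kernel_compose[of r f exp UNIV] by (simp add: holomorphic_on_exp)
next
  case (Suc n)
  obtain f' where f: "regular_kernel r f" "Ck_kernel r n f" "Ck_kernel r n f'"
    "\<And>s u z. \<bar>u\<bar> < r \<Longrightarrow> ((\<lambda>v. f s v z) has_vector_derivative f' s u z) (at u)"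
    using Suc.prems by (rule Ck_kernel_SucE) blast
  show ?case
  proof (rule Ck_kernel_SucI[OF _ Ck_kernel_mult[OF f(3) Suc.IH[OF f(2)]]])
    show "regular_kernel r (\<lambda>s u z. exp (f s u z))"
      using f(1) regular_kernel_compose[of r f exp UNIV] by (simp add: holomorphic_on_exp)
    show "((\<lambda>v. exp (f s v z)) has_vector_derivative f' s u z * exp (f s u z)) (at u)" if "\<bar>u\<bar> < r" for s u z
      using field_vector_diff_chain_at[OF f(4)[OF that] DERIV_exp] by (simp add: o_def)
  qed
qed

lemma holomorphic_on_inverse_punctured: "(inverse :: complex \<Rightarrow> complex) holomorphic_on - {0}"
  by (rule holomorphic_on_inverse[OF holomorphic_on_ident]) auto

lemma Ck_kernel_inverse:
  "Ck_kernel r n f \<Longrightarrow> (\<And>s u z. \<bar>u\<bar> < r \<Longrightarrow> f s u z \<noteq> 0) \<Longrightarrow> Ck_kernel r n (\<lambda>s u z. inverse (f s u z))"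
proof (induction n arbitrary: f)
  case 0
  then show ?case using regular_kernel_compose[of r f inverse "- {0}"] by (simp add: holomorphic_on_inverse_punctured open_Compl)
next
  case (Suc n)
  obtain f' where f: "regular_kernel r f" "Ck_kernel r n f" "Ck_kernel r n f'"
    "\<And>s u z. \<bar>u\<bar> < r \<Longrightarrow> ((\<lambda>v. f s v z) has_vector_derivative f' s u z) (at u)"
    using Suc.prems(1) by (rule Ck_kernel_SucE) blast
  note inv = Suc.IH[OF f(2) Suc.prems(2)]
  show ?case
  proof (rule Ck_kernel_SucI[OF _ Ck_kernel_mult[OF f(3) Ck_kernel_uminus[OF Ck_kernel_mult[OF inv inv]]]])
    show "regular_kernel r (\<lambda>s u z. inverse (f s u z))"
      using f(1) Suc.prems(2) regular_kernel_compose[of r f inverse "- {0}"]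
      by (simp add: holomorphic_on_inverse_punctured open_Compl)
    show "((\<lambda>v. inverse (f s v z)) has_vector_derivative f' s u z * - (inverse (f s u z) * inverse (f s u z))) (at u)"
      if "\<bar>u\<bar> < r" for s u z
      using field_vector_diff_chain_at[OF f(4)[OF that] DERIV_inverse[OF Suc.prems(2)[OF that]]]
      by (simp add: o_def power2_eq_square)
  qed
qed

text \<open>A case distinction replaces induction: the derivative f' / f is already covered by
  products and inverses. The values must avoid the branch cut of \<open>Ln\<close>.\<close>

lemma Ck_kernel_Ln:
  assumes "Ck_kernel r n f" and T: "\<And>s u z. \<bar>u\<bar> < r \<Longrightarrow> f s u z \<notin> \<real>\<^sub>\<le>\<^sub>0"
  shows "Ck_kernel r n (\<lambda>s u z. Ln (f s u z))"
proof -
  have reg: "regular_kernel r (\<lambda>s u z. Ln (f s u z))"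
    using regular_kernel_compose[OF Ck_kernel_regular[OF assms(1)], of Ln "- \<real>\<^sub>\<le>\<^sub>0"] T
    by (simp add: holomorphic_on_Ln open_Compl)
  show ?thesis
  proof (cases n)
    case (Suc m)
    obtain f' where f: "regular_kernel r f" "Ck_kernel r m f" "Ck_kernel r m f'"
      "\<And>s u z. \<bar>u\<bar> < r \<Longrightarrow> ((\<lambda>v. f s v z) has_vector_derivative f' s u z) (at u)"
      using assms(1)[unfolded Suc] by (rule Ck_kernel_SucE) blast
    have inv: "Ck_kernel r m (\<lambda>s u z. inverse (f s u z))"
      by (intro Ck_kernel_inverse f(2)) (metis T nonpos_Reals_zero_I)
    show ?thesis
      unfolding Suc
    proof (rule Ck_kernel_SucI[OF reg Ck_kernel_mult[OF f(3) inv]])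
      show "((\<lambda>v. Ln (f s v z)) has_vector_derivative f' s u z * inverse (f s u z)) (at u)"
        if "\<bar>u\<bar> < r" for s u z
        using field_vector_diff_chain_at[OF f(4)[OF that] has_field_derivative_Ln[OF T[OF that]]]
        by (simp add: o_def)
    qed
  qed (use reg in simp)
qed

lemma regular_kernel_reflect:
  assumes "regular_kernel r f" shows "regular_kernel r (\<lambda>s u z. f s (- u) z)"
  unfolding regular_kernel_def
proof (intro conjI allI impI)
  show "continuous_on (UNIV \<times> {-r<..<r} \<times> UNIV) (\<lambda>p. f (fst p) (- fst (snd p)) (snd (snd p)))"
    by (auto intro!: continuous_intros regular_kernel_continuous_on[OF assms])
qed (use assms in \<open>auto simp: regular_kernel_def\<close>)

lemma has_vector_derivative_reflect:
  assumes "(f has_vector_derivative f') (at (- x))"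
  shows "((\<lambda>v. f (- v)) has_vector_derivative - f') (at (x::real))"
  using vector_diff_chain_at[of uminus "-1" x f f'] assms
    has_vector_derivative_minus[OF has_vector_derivative_id, of "at x"]
  by (simp add: o_def id_def)

lemma Ck_kernel_reflect: "Ck_kernel r n f \<Longrightarrow> Ck_kernel r n (\<lambda>s u z. f s (- u) z)"
proof (induction n arbitrary: f)
  case 0
  then show ?case by (simp add: regular_kernel_reflect)
next
  case (Suc n)
  obtain f' where f: "regular_kernel r f" "Ck_kernel r n f" "Ck_kernel r n f'"
    "\<And>s u z. \<bar>u\<bar> < r \<Longrightarrow> ((\<lambda>v. f s v z) has_vector_derivative f' s u z) (at u)"
    using Suc.prems by (rule Ck_kernel_SucE) blast
  show ?case
    by (rule Ck_kernel_SucI[OF regular_kernel_reflect[OF f(1)] Ck_kernel_uminus[OF Suc.IH[OF f(3)]]])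
       (auto intro!: has_vector_derivative_reflect f)
qed

text \<open>The family D of all derivatives is closed under differentiation in u, so the induction
  over the order runs with k free.\<close>

lemma Ck_kernel_translate:
  fixes D :: "nat \<Rightarrow> real \<Rightarrow> complex"
  assumes "\<And>k t. (D k has_vector_derivative D (Suc k) t) (at t)"
  shows "Ck_kernel r n (\<lambda>s u z. D k (s + u))"
proof (induction n arbitrary: k)
  have reg: "regular_kernel r (\<lambda>s u z. D k (s + u))" for k
  proof -
    have "continuous_on UNIV (D k)"
      using assms by (intro continuous_at_imp_continuous_on) (auto intro: has_vector_derivative_continuous)
    then show ?thesis
      unfolding regular_kernel_def by (auto intro!: continuous_on_compose2[of UNIV "D k"] continuous_intros)
  qed
  case 0
  then show ?case by (simp add: reg)
  case (Suc n)
  show ?case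
  proof (rule Ck_kernel_SucI[OF reg Suc.IH[of "Suc k"]])
    fix s u
    have "((\<lambda>v. s + v) has_vector_derivative 0 + 1) (at u)"
      by (intro has_vector_derivative_add has_vector_derivative_const has_vector_derivative_id)
    then show "((\<lambda>v. D k (s + v)) has_vector_derivative D (Suc k) (s + u)) (at u)"
      using vector_diff_chain_at[of "\<lambda>v. s + v" 1 u "D k" "D (Suc k) (s + u)"] assms by (simp add: o_def)
  qed
qed

section \<open>Averages over the segment from 0 to u\<close>

lemma holomorphic_set_integral_compact:
  fixes F :: "complex \<Rightarrow> real \<Rightarrow> complex"
  assumes cont: "continuous_on (UNIV \<times> {a..b}) (\<lambda>p. F (fst p) (snd p))"
    and hol: "\<And>t. t \<in> {a..b} \<Longrightarrow> (\<lambda>z. F z t) holomorphic_on UNIV"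
    and A: "A \<in> sets borel" "A \<subseteq> {a..b}"
  shows "(\<lambda>z. LINT t:A|lborel. F z t) holomorphic_on UNIV"
  unfolding set_lebesgue_integral_def
proof (rule holomorphic_integral_dominated)
  show "(\<lambda>z. indicat_real A t *\<^sub>R F z t) holomorphic_on UNIV" for t
    using hol[of t] A by (cases "t \<in> A") auto
  have "continuous_on A (\<lambda>t. F (fst (z, t)) (snd (z, t)))" for z
    by (rule continuous_on_compose2[OF cont]) (use A in \<open>auto intro!: continuous_intros\<close>)
  then show "(\<lambda>t. indicat_real A t *\<^sub>R F z t) \<in> borel_measurable lborel" for z
    using borel_measurable_continuous_on_indicator[OF A(1), of "F z"] by simp
  fix z0
  \<comment> \<open>Joint continuity bounds F on the product of a disc and \<open>{a..b}\<close>,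
    and this constant is the dominating function. A general Borel subset A admits both [0, 1] and
    the half-open [0, l).\<close>
  have "compact ((\<lambda>p. F (fst p) (snd p)) ` (cball z0 1 \<times> {a..b}))"
    by (intro compact_continuous_image continuous_on_subset[OF cont] compact_Times) auto
  from compact_imp_bounded[OF this] obtain C
    where C: "\<And>z t. z \<in> cball z0 1 \<Longrightarrow> t \<in> {a..b} \<Longrightarrow> norm (F z t) \<le> C"
    unfolding bounded_iff ball_simps(9) by (metis SigmaI fst_conv snd_conv)
  show "\<exists>d>0. \<exists>B. cball z0 d \<subseteq> UNIV \<and> integrable lborel B \<and>
      (\<forall>z\<in>cball z0 d. \<forall>t\<in>space lborel. norm (indicat_real A t *\<^sub>R F z t) \<le> B t)"
  proof (intro exI[of _ 1] exI[of _ "\<lambda>t. indicat_real A t * C"] conjI ballI)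
    have "emeasure lborel A \<le> emeasure lborel {a..b}" using A by (intro emeasure_mono) auto
    also have "\<dots> < \<infinity>" using emeasure_lborel_cbox_finite[of a b] by simp
    finally show "integrable lborel (\<lambda>t. indicat_real A t * C)" using A by auto
  qed (use C A in \<open>auto split: split_indicator\<close>)
qed auto

text \<open>With m = 0 and f the u-derivative of F, this is Hadamard's quotient (F(u) - F(0)) / u,
  smooth across u = 0. The weight t^m makes the class closed under differentiation in u, each
  derivative bringing out a factor t.\<close>

definition kernel_average :: "nat \<Rightarrow> (real \<Rightarrow> real \<Rightarrow> complex \<Rightarrow> complex) \<Rightarrow> real \<Rightarrow> real \<Rightarrow> complex \<Rightarrow> complex" where
  "kernel_average m f s u z = integral {0..1} (\<lambda>t. of_real t ^ m * f s (t * u) z)"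

lemma abs_mult_less_unit:
  fixes t u r :: real
  assumes "0 \<le> t" "t \<le> 1" "\<bar>u\<bar> < r" shows "\<bar>t * u\<bar> < r"
proof -
  have "\<bar>t * u\<bar> \<le> \<bar>u\<bar>" using assms by (simp add: abs_mult mult_left_le_one_le)
  then show ?thesis using assms by simp
qed

lemma regular_kernel_average:
  assumes "regular_kernel r f"
  shows "regular_kernel r (kernel_average m f)"
proof -
  have *: "continuous_on ((UNIV \<times> {-r<..<r} \<times> UNIV) \<times> {0..1})
      (\<lambda>p. of_real (snd p) ^ m * f (fst (fst p)) (snd p * fst (snd (fst p))) (snd (snd (fst p))))"
    by (intro continuous_intros regular_kernel_continuous_on[OF assms] abs_mult_less_unit) auto
  show "regular_kernel r (kernel_average m f)"
    unfolding regular_kernel_def kernel_average_def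
  proof (intro conjI allI impI)
    have "continuous_on (UNIV \<times> {-r<..<r} \<times> UNIV)
        (\<lambda>p. integral (cbox 0 1) (\<lambda>t. of_real t ^ m * f (fst p) (t * fst (snd p)) (snd (snd p))))"
      by (rule integral_continuous_on_param) (use * in \<open>simp add: case_prod_unfold\<close>)
    then show "continuous_on (UNIV \<times> {-r<..<r} \<times> UNIV)
        (\<lambda>p. integral {0..1} (\<lambda>t. of_real t ^ m * f (fst p) (t * fst (snd p)) (snd (snd p))))"
      by simp
    fix s u :: real assume u: "\<bar>u\<bar> < r"
    have cz: "continuous_on (UNIV \<times> {0..1}) (\<lambda>p. of_real (snd p) ^ m * f s (snd p * u) (fst p))"
      using u by (intro continuous_intros regular_kernel_continuous_on[OF assms] abs_mult_less_unit) auto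
    have "(\<lambda>z. LINT t:{0..1}|lborel. of_real t ^ m * f s (t * u) z) holomorphic_on UNIV"
    proof (rule holomorphic_set_integral_compact[OF cz])
      show "(\<lambda>z. of_real t ^ m * f s (t * u) z) holomorphic_on UNIV" if "t \<in> {0..1}" for t
        using assms abs_mult_less_unit[of t u r] that u
        by (auto intro!: holomorphic_intros simp: regular_kernel_def)
    qed auto
    moreover have "(LINT t:{0..1}|lborel. of_real t ^ m * f s (t * u) z) =
        integral {0..1} (\<lambda>t. of_real t ^ m * f s (t * u) z)" for z
      using u by (intro set_borel_integral_eq_integral borel_integrable_atLeastAtMost' continuous_intros
          regular_kernel_continuous_on[OF assms] abs_mult_less_unit) auto
    ultimately show "(\<lambda>z. integral {0..1} (\<lambda>t. of_real t ^ m * f s (t * u) z)) holomorphic_on UNIV"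
      by simp
  qed
qed

lemma Ck_kernel_average: "Ck_kernel r n f \<Longrightarrow> Ck_kernel r n (kernel_average m f)"
proof (induction n arbitrary: f m)
  case 0
  then show ?case by (simp add: regular_kernel_average)
next
  case (Suc n)
  obtain f' where f: "regular_kernel r f" "Ck_kernel r n f" "Ck_kernel r n f'"
    "\<And>s u z. \<bar>u\<bar> < r \<Longrightarrow> ((\<lambda>v. f s v z) has_vector_derivative f' s u z) (at u)"
    using Suc.prems by (rule Ck_kernel_SucE) blast
  show ?case
  proof (rule Ck_kernel_SucI[OF regular_kernel_average[OF f(1)] Suc.IH[OF f(3), of "Suc m"]])
    fix s u :: real and z assume u: "\<bar>u\<bar> < r"
    have "((\<lambda>v. integral (cbox 0 1) (\<lambda>t. of_real t ^ m * f s (t * v) z)) has_vector_derivative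
        integral (cbox 0 1) (\<lambda>t. of_real t ^ Suc m * f' s (t * u) z)) (at u within {-r<..<r})"
    proof (rule leibniz_rule_vector_derivative)
      fix v t :: real assume vt: "v \<in> {-r<..<r}" "t \<in> cbox 0 1"
      then have tv: "\<bar>t * v\<bar> < r" by (intro abs_mult_less_unit) auto
      have "((\<lambda>v. t * v) has_vector_derivative t) (at v)"
        by (auto intro!: derivative_eq_intros)
      from vector_diff_chain_at[OF this f(4)[OF tv, of s z]]
      have "((\<lambda>v. f s (t * v) z) has_vector_derivative t *\<^sub>R f' s (t * v) z) (at v)"
        by (simp add: o_def)
      from has_vector_derivative_mult_right[OF this, of "of_real t ^ m"]
      show "((\<lambda>v. of_real t ^ m * f s (t * v) z) has_vector_derivative of_real t ^ Suc m * f' s (t * v) z) (at v within {-r<..<r})"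
        by (auto simp: scaleR_conv_of_real ac_simps intro: has_vector_derivative_at_within)
    next
      fix v :: real assume v: "v \<in> {-r<..<r}"
      show "(\<lambda>t. of_real t ^ m * f s (t * v) z) integrable_on cbox 0 1"
        using v by (intro integrable_continuous continuous_intros
            regular_kernel_continuous_on[OF f(1)] abs_mult_less_unit) auto
    next
      show "continuous_on ({-r<..<r} \<times> cbox 0 1) (\<lambda>(v, t). of_real t ^ Suc m * f' s (t * v) z)"
        unfolding case_prod_unfold
        by (intro continuous_intros regular_kernel_continuous_on[OF Ck_kernel_regular[OF f(3)]] abs_mult_less_unit) auto
    qed (use u in auto)
    then show "((\<lambda>v. kernel_average m f s v z) has_vector_derivative kernel_average (Suc m) f' s u z) (at u)"
      using u by (simp add: kernel_average_def at_within_open[of u "{-r<..<r}"] abs_less_iff)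
  qed
qed

section \<open>Uniform bounds near the diagonal, and parity in the offset\<close>

lemma regular_kernel_bounded:
  assumes f: "regular_kernel r f" and "compact S" "compact Z" "a < r"
  obtains C where "C \<ge> 0" "\<And>s u z. s \<in> S \<Longrightarrow> \<bar>u\<bar> \<le> a \<Longrightarrow> z \<in> Z \<Longrightarrow> norm (f s u z) \<le> C"
proof -
  have "continuous_on (S \<times> {-a..a} \<times> Z) (\<lambda>p. f (fst p) (fst (snd p)) (snd (snd p)))"
    using assms by (intro regular_kernel_continuous_on[OF f] continuous_intros) auto
  then have "compact ((\<lambda>p. f (fst p) (fst (snd p)) (snd (snd p))) ` (S \<times> {-a..a} \<times> Z))"
    using assms by (intro compact_continuous_image compact_Times) auto
  from compact_imp_bounded[OF this] obtain C
    where C: "\<And>s u z. s \<in> S \<Longrightarrow> -a \<le> u \<Longrightarrow> u \<le> a \<Longrightarrow> z \<in> Z \<Longrightarrow> norm (f s u z) \<le> C"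
    unfolding bounded_iff ball_simps(9) by (metis SigmaI atLeastAtMost_iff fst_conv snd_conv)
  show ?thesis
  \<comment> \<open>C may be negative when the set is empty; the maximum secures the sign.\<close>
  proof (rule that[of "max C 0"])
    fix s u z assume "s \<in> S" "\<bar>u\<bar> \<le> a" "z \<in> Z"
    then show "norm (f s u z) \<le> max C 0" using C[of s u z] by (auto simp: abs_le_iff)
  qed auto
qed

text \<open>Mean value inequality with a compactness bound on the derivative. It makes (f(s, u, z) -
  f(s, 0, z)) / u bounded uniformly in s and z, which is what tames the singularity 1 / u.\<close>

lemma Ck_kernel_Lipschitz_at_0:
  assumes f: "Ck_kernel r (Suc n) f" and "compact S" "compact Z" "a < r"
  obtains C where "C \<ge> 0"
    "\<And>s u z. s \<in> S \<Longrightarrow> \<bar>u\<bar> \<le> a \<Longrightarrow> z \<in> Z \<Longrightarrow> norm (f s u z - f s 0 z) \<le> C * \<bar>u\<bar>"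
proof -
  obtain f' where f': "Ck_kernel r n f'"
    "\<And>s u z. \<bar>u\<bar> < r \<Longrightarrow> ((\<lambda>v. f s v z) has_vector_derivative f' s u z) (at u)"
    using f by (rule Ck_kernel_SucE) blast
  obtain C where C: "C \<ge> 0" "\<And>s u z. s \<in> S \<Longrightarrow> \<bar>u\<bar> \<le> a \<Longrightarrow> z \<in> Z \<Longrightarrow> norm (f' s u z) \<le> C"
    using regular_kernel_bounded[OF Ck_kernel_regular[OF f'(1)] assms(2-4)] by metis
  show ?thesis
  proof (rule that[OF C(1)])
    fix s u z assume *: "s \<in> S" "\<bar>u\<bar> \<le> a" "z \<in> Z"
    have "norm (f s u z - f s 0 z) \<le> C * norm (u - 0)"
    proof (rule differentiable_bound[of "{-a..a}" "\<lambda>v. f s v z" "\<lambda>v h. h *\<^sub>R f' s v z"])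
      fix v assume v: "v \<in> {-a..a}"
      then have "\<bar>v\<bar> < r" "\<bar>v\<bar> \<le> a" using assms by auto
      then show "((\<lambda>v. f s v z) has_derivative (\<lambda>h. h *\<^sub>R f' s v z)) (at v within {-a..a})"
        using f'(2)[of v s z] by (auto simp: has_vector_derivative_def intro: has_derivative_at_withinI)
      show "onorm (\<lambda>h. h *\<^sub>R f' s v z) \<le> C"
        using C(2)[OF *(1) \<open>\<bar>v\<bar> \<le> a\<close> *(3)] C(1)
        by (intro onorm_le) (simp add: mult.commute[of C] mult_left_mono)
    qed (use * in auto)
    then show "norm (f s u z - f s 0 z) \<le> C * \<bar>u\<bar>" by simp
  qed
qed

text \<open>One statement for both parities: with c = 1 an even function has an odd derivative, with
  c = -1 an odd one has an even derivative.\<close>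

lemma vector_derivative_reflect_eq:
  fixes f :: "real \<Rightarrow> 'a :: real_normed_vector"
  assumes d: "\<And>u. \<bar>u\<bar> < r \<Longrightarrow> (f has_vector_derivative f' u) (at u)"
    and ev: "\<And>u. \<bar>u\<bar> < r \<Longrightarrow> f (- u) = c *\<^sub>R f u" and u: "\<bar>u\<bar> < r"
  shows "f' (- u) = (- c) *\<^sub>R f' u"
proof -
  have 1: "((\<lambda>v. f (- v)) has_vector_derivative - f' (- u)) (at u)"
    using d[of "-u"] u by (intro has_vector_derivative_reflect) auto
  have "((\<lambda>v. c *\<^sub>R f v) has_vector_derivative c *\<^sub>R f' u) (at u)"
    using d[OF u] by (rule bounded_linear.has_vector_derivative[OF bounded_linear_scaleR_right])
  then have 2: "((\<lambda>v. f (- v)) has_vector_derivative c *\<^sub>R f' u) (at u)"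
    by (rule has_vector_derivative_transform_within_open[of _ _ _ "{-r<..<r}"])
       (use u ev in \<open>auto simp: abs_less_iff minus_less_iff\<close>)
  show ?thesis using vector_derivative_unique_at[OF 1 2] by (metis minus_minus scaleR_minus_left)
qed

text \<open>The derivative e' is odd, hence zero at u = 0, so it equals u times the average of e''
  over the segment from 0 to u. This average is even because e'' is. Two orders of differentiability
  are spent.\<close>

lemma even_kernel_derivative:
  assumes e: "Ck_kernel r (Suc (Suc n)) e"
    and ev: "\<And>s u z. \<bar>u\<bar> < r \<Longrightarrow> e s (- u) z = e s u z"
  obtains g where "Ck_kernel r n g" "\<And>s u z. \<bar>u\<bar> < r \<Longrightarrow> g s (- u) z = g s u z"
    "\<And>s u z. \<bar>u\<bar> < r \<Longrightarrow> ((\<lambda>v. e s v z) has_vector_derivative of_real u * g s u z) (at u)"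
proof -
  obtain e' where e': "Ck_kernel r (Suc n) e'"
    "\<And>s u z. \<bar>u\<bar> < r \<Longrightarrow> ((\<lambda>v. e s v z) has_vector_derivative e' s u z) (at u)"
    using e by (rule Ck_kernel_SucE) blast
  obtain e'' where e'': "Ck_kernel r n e''"
    "\<And>s u z. \<bar>u\<bar> < r \<Longrightarrow> ((\<lambda>v. e' s v z) has_vector_derivative e'' s u z) (at u)"
    using e'(1) by (rule Ck_kernel_SucE) blast
  have odd: "e' s (- u) z = (-1) *\<^sub>R e' s u z" if "\<bar>u\<bar> < r" for s u z
    using vector_derivative_reflect_eq[where f="\<lambda>v. e s v z" and f'="\<lambda>v. e' s v z" and c=1 and r=r] e'(2) ev that by auto
  have even: "e'' s (- u) z = e'' s u z" if "\<bar>u\<bar> < r" for s u z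
    using vector_derivative_reflect_eq[where f="\<lambda>v. e' s v z" and f'="\<lambda>v. e'' s v z" and c="-1" and r=r] e''(2) odd that by auto
  show ?thesis
  proof (rule that[of "kernel_average 0 e''"])
    show "Ck_kernel r n (kernel_average 0 e'')" using e''(1) by (rule Ck_kernel_average)
    show "kernel_average 0 e'' s (- u) z = kernel_average 0 e'' s u z" if "\<bar>u\<bar> < r" for s u z
      unfolding kernel_average_def
      using even abs_mult_less_unit[OF _ _ that] by (intro Henstock_Kurzweil_Integration.integral_cong) auto
    fix s u z assume u: "\<bar>u\<bar> < r"
    have "((\<lambda>t. u *\<^sub>R e'' s (t * u) z) has_integral (e' s (1 * u) z - e' s (0 * u) z)) {0..1}"
    proof (rule fundamental_theorem_of_calculus)
      fix t :: real assume t: "t \<in> {0..1}"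
      have "((\<lambda>t. t * u) has_vector_derivative u) (at t)"
        by (auto intro!: derivative_eq_intros)
      from vector_diff_chain_at[OF this e''(2)[OF abs_mult_less_unit[of t u r]]] t u
      show "((\<lambda>t. e' s (t * u) z) has_vector_derivative u *\<^sub>R e'' s (t * u) z) (at t within {0..1})"
        by (auto simp: o_def intro: has_vector_derivative_at_within)
    qed simp
    moreover have "e' s 0 z = 0" using odd[of 0 s z] u by auto
    ultimately have "integral {0..1} (\<lambda>t. u *\<^sub>R e'' s (t * u) z) = e' s u z" by (intro integral_unique) simp
    then have "e' s u z = of_real u * kernel_average 0 e'' s u z"
      by (simp add: kernel_average_def scaleR_conv_of_real)
    then show "((\<lambda>v. e s v z) has_vector_derivative of_real u * kernel_average 0 e'' s u z) (at u)"
      using e'(2)[OF u, of s z] by simp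
  qed
qed

section \<open>Meromorphic continuation\<close>

lemma cmod_of_real_powr: "0 < u \<Longrightarrow> cmod (of_real u powr w) = u powr Re w"
  by (simp add: norm_powr_real_powr)

lemma continuous_on_of_real_powr:
  "continuous_on A \<beta> \<Longrightarrow> (\<And>x. x \<in> A \<Longrightarrow> 0 < \<beta> x) \<Longrightarrow> continuous_on A (\<lambda>x. complex_of_real (\<beta> x) powr w)"
  by (intro continuous_on_powr_complex continuous_intros) (fastforce intro: less_imp_le)+

lemma set_integrable_powr_kernel:
  assumes f: "regular_kernel r f" and a: "a < r" and w: "Re w > -1"
  shows "set_integrable lborel ({0..<l} \<times> {0<..<a}) (\<lambda>p. of_real (snd p) powr w * f (fst p) (snd p) z)"
proof -
  obtain C where C: "\<And>s u z'. s \<in> {0..l} \<Longrightarrow> \<bar>u\<bar> \<le> a \<Longrightarrow> z' \<in> {z} \<Longrightarrow> norm (f s u z') \<le> C"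
    using regular_kernel_bounded[OF f _ _ a, of "{0..l}" "{z}"] by (metis compact_Icc compact_sing)
  show ?thesis
  proof (rule set_integrable_rect_powr_bound[OF w])
    show "set_borel_measurable lborel ({0..<l} \<times> {0<..<a}) (\<lambda>p. of_real (snd p) powr w * f (fst p) (snd p) z)"
      using a by (intro set_borel_measurable_rect_continuous continuous_intros continuous_on_of_real_powr
          regular_kernel_continuous_on[OF f]) auto
    fix s u assume "0 \<le> s" "s < l" "0 < u" "u < a"
    then show "norm (of_real (snd (s, u)) powr w * f (fst (s, u)) (snd (s, u)) z) \<le> C * u powr Re w"
      using C[of s u z] by (simp add: norm_mult cmod_of_real_powr mult.commute mult_right_mono)
  qed
qed

text \<open>Near z0 the modulus of u^(z+c) is at most u^(x-d) + u^(x+d) with x = Re z0 + c: the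
  first term serves u \<le> 1, the second u > 1. The shift c is kept apart from z because
  integration by parts moves the exponent while the kernel is still taken at z.\<close>

lemma holomorphic_powr_kernel_integral:
  assumes f: "regular_kernel r f" and a: "a < r"
  shows "(\<lambda>z. LINT p:{0..<l} \<times> {0<..<a}|lborel. of_real (snd p) powr (z + of_nat c) * f (fst p) (snd p) z)
    holomorphic_on {z. Re z > -1 - real c}"
  unfolding set_lebesgue_integral_def
proof (rule holomorphic_integral_dominated)
  show "open {z. Re z > -1 - real c}" by (rule open_halfspace_Re_gt)
  show "(\<lambda>z. indicat_real ({0..<l} \<times> {0<..<a}) p *\<^sub>R (of_real (snd p) powr (z + of_nat c) * f (fst p) (snd p) z))
      holomorphic_on {z. Re z > -1 - real c}" for p
  proof (cases "p \<in> {0..<l} \<times> {0<..<a}")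
    case True
    then have "f (fst p) (snd p) holomorphic_on UNIV"
      using f a by (auto simp: regular_kernel_def)
    then have "f (fst p) (snd p) holomorphic_on {z. Re z > -1 - real c}"
      by (rule holomorphic_on_subset) auto
    then show ?thesis using True by (auto intro!: holomorphic_intros)
  qed auto
  fix z0 assume "z0 \<in> {z. Re z > -1 - real c}"
  then have z0: "Re z0 + real c > -1" by simp
  show "(\<lambda>p. indicat_real ({0..<l} \<times> {0<..<a}) p *\<^sub>R (of_real (snd p) powr (z0 + of_nat c) * f (fst p) (snd p) z0))
      \<in> borel_measurable lborel"
    using set_integrable_powr_kernel[OF f a, of "z0 + of_nat c" l z0] z0 by (auto simp: set_integrable_def)
  \<comment> \<open>Half the distance from z0 to the line Re z = -1 - c, so the smallest exponent Re
    z0 + c - d still exceeds -1.\<close>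
  define d where "d = (Re z0 + real c + 1) / 2"
  have d: "d > 0" "Re z0 + real c - d > -1" using z0 by (auto simp: d_def field_simps)
  obtain C where C: "C \<ge> 0" "\<And>s u z. s \<in> {0..l} \<Longrightarrow> \<bar>u\<bar> \<le> a \<Longrightarrow> z \<in> cball z0 d \<Longrightarrow> norm (f s u z) \<le> C"
    using regular_kernel_bounded[OF f _ _ a, of "{0..l}" "cball z0 d"] by (metis compact_Icc compact_cball)
  define x where "x = Re z0 + real c"
  show "\<exists>d>0. \<exists>B. cball z0 d \<subseteq> {z. Re z > -1 - real c} \<and> integrable lborel B \<and>
    (\<forall>z\<in>cball z0 d. \<forall>p\<in>space lborel. norm (indicat_real ({0..<l} \<times> {0<..<a}) p *\<^sub>R
        (of_real (snd p) powr (z + of_nat c) * f (fst p) (snd p) z)) \<le> B p)"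
  proof (intro exI[of _ d] exI[of _ "\<lambda>p. indicat_real ({0..<l} \<times> {0<..<a}) p *\<^sub>R (C * (snd p powr (x - d) + snd p powr (x + d)))"] conjI ballI)
    have Re: "\<bar>Re z - Re z0\<bar> \<le> d" if "z \<in> cball z0 d" for z
      using that abs_Re_le_cmod[of "z - z0"] by (simp add: dist_norm norm_minus_commute)
    show "cball z0 d \<subseteq> {z. Re z > -1 - real c}"
      using Re d by (force simp: abs_le_iff)
    have "set_integrable lborel ({0..<l} \<times> {0<..<a}) (\<lambda>p. C * (snd p powr (x - d) + snd p powr (x + d)))"
      using d by (intro set_integrable_mult_right set_integral_add set_integrable_rect_snd_powr) (auto simp: x_def)
    then show "integrable lborel (\<lambda>p. indicat_real ({0..<l} \<times> {0<..<a}) p *\<^sub>R (C * (snd p powr (x - d) + snd p powr (x + d))))"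
      by (simp add: set_integrable_def)
    fix z p assume z: "z \<in> cball z0 d"
    show "norm (indicat_real ({0..<l} \<times> {0<..<a}) p *\<^sub>R (of_real (snd p) powr (z + of_nat c) * f (fst p) (snd p) z))
      \<le> indicat_real ({0..<l} \<times> {0<..<a}) p *\<^sub>R (C * (snd p powr (x - d) + snd p powr (x + d)))"
    proof (cases "p \<in> {0..<l} \<times> {0<..<a}")
      case True
      then obtain s u where p: "p = (s, u)" "0 \<le> s" "s < l" "0 < u" "u < a" by auto
      have y: "x - d \<le> Re z + real c" "Re z + real c \<le> x + d" using Re[OF z] by (auto simp: x_def)
      have "u powr (Re z + real c) \<le> u powr (x - d) + u powr (x + d)"
      proof (cases "u \<le> 1")
        case True
        then have "u powr (Re z + real c) \<le> u powr (x - d)" using y p by (intro powr_mono') auto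
        then show ?thesis by (smt (verit) powr_ge_zero)
      next
        case False
        then have "u powr (Re z + real c) \<le> u powr (x + d)" using y p by (intro powr_mono) auto
        then show ?thesis by (smt (verit) powr_ge_zero)
      qed
      then have "u powr (Re z + real c) * cmod (f s u z) \<le> (u powr (x - d) + u powr (x + d)) * C"
        using C(2)[of s u z] p z by (intro mult_mono) auto
      then show ?thesis using True p by (simp add: norm_mult cmod_of_real_powr mult.commute)
    qed simp
  qed (rule d(1))
qed

text \<open>For each s this is the fundamental theorem of calculus for u^(w+1) e(s, u, z) on [0, a].
  The exponent w and the parameter z are independent, which allows w = z + 2m with the kernel fixed
  at z.\<close>

lemma powr_kernel_by_parts:
  assumes e: "regular_kernel r e" and e': "regular_kernel r e'"
    and der: "\<And>s u z. \<bar>u\<bar> < r \<Longrightarrow> ((\<lambda>v. e s v z) has_vector_derivative e' s u z) (at u)"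
    and a: "0 < a" "a < r" and w: "Re w > -1"
  shows "(w + 1) * (LINT p:{0..<l} \<times> {0<..<a}|lborel. of_real (snd p) powr w * e (fst p) (snd p) z) +
      (LINT p:{0..<l} \<times> {0<..<a}|lborel. of_real (snd p) powr (w + 1) * e' (fst p) (snd p) z) =
    of_real a powr (w + 1) * (LINT s:{0..<l}|lborel. e s a z)"
proof -
  let ?P = "{0..<l} \<times> {0<..<a}"
  define h where "h p = (w + 1) * (of_real (snd p) powr w * e (fst p) (snd p) z) +
      of_real (snd p) powr (w + 1) * e' (fst p) (snd p) z" for p
  have i: "set_integrable lborel ?P (\<lambda>p. (w + 1) * (of_real (snd p) powr w * e (fst p) (snd p) z))"
    "set_integrable lborel ?P (\<lambda>p. of_real (snd p) powr (w + 1) * e' (fst p) (snd p) z)"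
    using w set_integrable_powr_kernel[OF e a(2) w] set_integrable_powr_kernel[OF e' a(2), of "w + 1"] by auto
  have ih: "set_integrable lborel ?P h"
    unfolding h_def by (rule set_integral_add(1)[OF i])
  have inner: "(LINT u:{0<..<a}|lborel. h (s, u)) = of_real a powr (w + 1) * e s a z" if s: "s \<in> {0..<l}" for s
  proof -
    obtain C where C: "C \<ge> 0" "\<And>s' u z'. s' \<in> {s} \<Longrightarrow> \<bar>u\<bar> \<le> a \<Longrightarrow> z' \<in> {z} \<Longrightarrow> norm (e s' u z') \<le> C"
      using regular_kernel_bounded[OF e _ _ a(2), of "{s}" "{z}"] by (metis compact_sing)
    obtain C' where C': "C' \<ge> 0" "\<And>s' u z'. s' \<in> {s} \<Longrightarrow> \<bar>u\<bar> \<le> a \<Longrightarrow> z' \<in> {z} \<Longrightarrow> norm (e' s' u z') \<le> C'"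
      using regular_kernel_bounded[OF e' _ _ a(2), of "{s}" "{z}"] by (metis compact_sing)
    have i1: "set_integrable lborel {0<..<a} (\<lambda>u. of_real u powr w * e s u z)"
    proof (rule set_integrable_Ioo_powr_bound[OF w])
      show "norm (of_real u powr w * e s u z) \<le> C * u powr Re w" if "0 < u" "u < a" for u
        using C(2)[of s u z] that by (simp add: norm_mult cmod_of_real_powr mult.commute mult_right_mono)
    qed (use a in \<open>auto intro!: continuous_intros continuous_on_of_real_powr regular_kernel_continuous_on[OF e]\<close>)
    have i2: "set_integrable lborel {0<..<a} (\<lambda>u. of_real u powr (w + 1) * e' s u z)"
    proof (rule set_integrable_Ioo_powr_bound)
      show "Re (w + 1) > -1" using w by simp
      show "norm (of_real u powr (w + 1) * e' s u z) \<le> C' * u powr Re (w + 1)" if "0 < u" "u < a" for u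
        using C'(2)[of s u z] that by (simp add: norm_mult cmod_of_real_powr mult.commute mult_right_mono)
    qed (use a in \<open>auto intro!: continuous_intros continuous_on_of_real_powr regular_kernel_continuous_on[OF e']\<close>)
    have "set_integrable lborel {0<..<a} (\<lambda>u. h (s, u))"
      unfolding h_def using i1 i2 by simp
    then have "(LINT u:{0<..<a}|lborel. h (s, u)) = integral {0<..<a} (\<lambda>u. h (s, u))"
      by (rule set_borel_integral_eq_integral)
    also have "\<dots> = integral {0..a} (\<lambda>u. h (s, u))"
      by (simp add: integral_open_interval_real)
    also have "((\<lambda>u. h (s, u)) has_integral (of_real a powr (w + 1) * e s a z - of_real 0 powr (w + 1) * e s 0 z)) {0..a}"
    \<comment> \<open>At 0 the power u^(w+1) may fail to be differentiable, but Re (w + 1) > 0 makes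
      it continuous with value 0. Hence the interior version, and no lower boundary term.\<close>
    proof (rule fundamental_theorem_of_calculus_interior)
      show "continuous_on {0..a} (\<lambda>u. of_real u powr (w + 1) * e s u z)"
        using a w by (intro continuous_intros continuous_on_powr_complex regular_kernel_continuous_on[OF e]) auto
      fix u assume u: "u \<in> {0<..<a}"
      have "((\<lambda>u. of_real u powr (w + 1)) has_vector_derivative (w + 1) * of_real u powr (w + 1 - 1)) (at u)"
        using u by (auto intro!: has_vector_derivative_real_field derivative_eq_intros)
      from has_vector_derivative_mult[OF this der[of u s z]]
      show "((\<lambda>u. of_real u powr (w + 1) * e s u z) has_vector_derivative h (s, u)) (at u)"
        using u a by (simp add: h_def algebra_simps)
    qed (use a in simp)
    then have "integral {0..a} (\<lambda>u. h (s, u)) = of_real a powr (w + 1) * e s a z"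
      by (simp add: integral_unique)
    finally show ?thesis .
  qed
  have "(LINT p:?P|lborel. h p) = (LINT s:{0..<l}|lborel. LINT u:{0<..<a}|lborel. h (s, u))"
    by (rule set_integral_lborel_Times[OF ih])
  also have "\<dots> = (LINT s:{0..<l}|lborel. of_real a powr (w + 1) * e s a z)"
    by (rule set_lebesgue_integral_cong) (auto simp: inner)
  finally show ?thesis
    using set_integral_add(2)[OF i] by (simp add: h_def)
qed

text \<open>Since e is even, its derivative is u times an even kernel: one integration by parts raises the exponent
  by 2, so only the odd points z = -1, -3, ... become poles.\<close>

lemma even_kernel_step:
  assumes "Ck_kernel r (Suc (Suc n)) e" and "\<And>s u z. \<bar>u\<bar> < r \<Longrightarrow> e s (- u) z = e s u z"
    and a: "0 < a" "a < r"
  obtains g where "Ck_kernel r n g" "\<And>s u z. \<bar>u\<bar> < r \<Longrightarrow> g s (- u) z = g s u z"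
    "\<And>w z. Re w > -1 \<Longrightarrow>
      (w + 1) * (LINT p:{0..<l} \<times> {0<..<a}|lborel. of_real (snd p) powr w * e (fst p) (snd p) z) =
      of_real a powr (w + 1) * (LINT s:{0..<l}|lborel. e s a z) -
      (LINT p:{0..<l} \<times> {0<..<a}|lborel. of_real (snd p) powr (w + 2) * g (fst p) (snd p) z)"
proof -
  obtain g where g: "Ck_kernel r n g" "\<And>s u z. \<bar>u\<bar> < r \<Longrightarrow> g s (- u) z = g s u z"
    "\<And>s u z. \<bar>u\<bar> < r \<Longrightarrow> ((\<lambda>v. e s v z) has_vector_derivative of_real u * g s u z) (at u)"
    by (rule even_kernel_derivative[OF assms(1,2)]) (assumption | rule that)+
  have reg: "regular_kernel r (\<lambda>s u z. of_real u * g s u z)"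
    using Ck_kernel_regular[OF g(1)] unfolding regular_kernel_def
    by (auto intro!: continuous_intros holomorphic_intros)
  show ?thesis
  proof (rule that[OF g(1,2)])
    fix w z assume w: "Re w > -1"
    have "(LINT p:{0..<l} \<times> {0<..<a}|lborel. of_real (snd p) powr (w + 1) * (of_real (snd p) * g (fst p) (snd p) z)) =
      (LINT p:{0..<l} \<times> {0<..<a}|lborel. of_real (snd p) powr (w + 2) * g (fst p) (snd p) z)"
    proof (rule set_lebesgue_integral_cong)
      have "complex_of_real u powr (w + 2) = of_real u powr (w + 1) * of_real u" if "u > 0" for u
        using powr_add[of "complex_of_real u" "w + 1" 1] that by (simp add: add.assoc)
      then show "\<forall>p. p \<in> {0..<l} \<times> {0<..<a} \<longrightarrow> of_real (snd p) powr (w + 1) * (of_real (snd p) * g (fst p) (snd p) z) =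
          of_real (snd p) powr (w + 2) * g (fst p) (snd p) z"
        by auto
    qed simp
    then show "(w + 1) * (LINT p:{0..<l} \<times> {0<..<a}|lborel. of_real (snd p) powr w * e (fst p) (snd p) z) =
      of_real a powr (w + 1) * (LINT s:{0..<l}|lborel. e s a z) -
      (LINT p:{0..<l} \<times> {0<..<a}|lborel. of_real (snd p) powr (w + 2) * g (fst p) (snd p) z)"
      using powr_kernel_by_parts[OF Ck_kernel_regular[OF assms(1)] reg g(3) a w, of l z]
      by (simp add: algebra_simps)
  qed auto
qed

text \<open>The boundary term sits at u = a, away from the singularity; its dependence on z is that
  of the kernel, hence entire.\<close>

lemma holomorphic_boundary_integral:
  assumes "regular_kernel r e" "0 < a" "a < r"
  shows "(\<lambda>z. LINT s:{0..<l}|lborel. e s a z) holomorphic_on UNIV"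
proof (rule holomorphic_set_integral_compact[of 0 l])
  show "continuous_on (UNIV \<times> {0..l}) (\<lambda>p. e (snd p) a (fst p))"
    using assms by (intro regular_kernel_continuous_on[OF assms(1)] continuous_intros) auto
  show "e s a holomorphic_on UNIV" for s
    using assms by (auto simp: regular_kernel_def)
qed auto

text \<open>Removing a closed countable set leaves a half plane open and connected; the identity
  theorem relies on both.\<close>

lemma closed_neg_odd_ints: "closed neg_odd_ints"
  unfolding neg_odd_ints_def by (rule closed_subset_Ints) auto

lemma countable_neg_odd_ints: "countable neg_odd_ints"
proof -
  have "neg_odd_ints = range (\<lambda>k. - of_nat (2 * k + 1))" by (auto simp: neg_odd_ints_def)
  then show ?thesis by (metis countableI_type countable_image)
qed

text \<open>Induction over the number n of integrations by parts, with the accumulated shift 2m left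
  free. A step passes from the exponent z + 2m to z + 2(m + 1), divides by z + 2m + 1 and spends two
  derivatives, whence the order 2n. Trading one unit of n for one of m leaves the half plane Re z >
  -1 - 2m - 2n unchanged.\<close>

lemma even_kernel_continuation:
  assumes "Ck_kernel r (2 * n) e" and "\<And>s u z. \<bar>u\<bar> < r \<Longrightarrow> e s (- u) z = e s u z"
    and a: "0 < a" "a < r"
  shows "\<exists>G. G holomorphic_on ({z. Re z > -1 - real (2 * m) - real (2 * n)} - neg_odd_ints) \<and>
    (\<forall>z. Re z > -1 - real (2 * m) \<longrightarrow>
      G z = (LINT p:{0..<l} \<times> {0<..<a}|lborel. of_real (snd p) powr (z + of_nat (2 * m)) * e (fst p) (snd p) z)) \<and>
    (\<forall>q\<in>neg_odd_ints. Re q > -1 - real (2 * m) - real (2 * n) \<longrightarrow> (\<exists>c. ((\<lambda>z. (z - q) * G z) \<longlongrightarrow> c) (at q)))"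
  using assms(1,2)
proof (induction n arbitrary: e m)
  case 0
  define J where "J z = (LINT p:{0..<l} \<times> {0<..<a}|lborel. of_real (snd p) powr (z + of_nat (2 * m)) * e (fst p) (snd p) z)" for z
  have hol: "J holomorphic_on {z. Re z > -1 - real (2 * m)}"
    unfolding J_def using 0 by (intro holomorphic_powr_kernel_integral[OF _ a(2)]) simp
  show ?case
  proof (intro exI[of _ J] conjI ballI allI impI)
    show "J holomorphic_on {z. Re z > -1 - real (2 * m) - real (2 * 0)} - neg_odd_ints"
      using hol by (rule holomorphic_on_subset) auto
    fix q assume "Re q > -1 - real (2 * m) - real (2 * 0)"
    then have "isCont J q"
      using holomorphic_on_imp_continuous_on[OF hol] open_halfspace_Re_gt[of "-1 - real (2 * m)"]
      by (simp add: continuous_on_eq_continuous_at)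
    \<comment> \<open>J is holomorphic at q, so this limit is 0: having a limit of (z - q) G(z)
      allows a removable singularity as well as a simple pole.\<close>
    then have "((\<lambda>z. (z - q) * J z) \<longlongrightarrow> (q - q) * J q) (at q)"
      by (intro tendsto_intros) (auto simp: isCont_def)
    then show "\<exists>c. ((\<lambda>z. (z - q) * J z) \<longlongrightarrow> c) (at q)" by blast
  qed (simp add: J_def)
next
  case (Suc n)
  have Ck: "Ck_kernel r (Suc (Suc (2 * n))) e" using Suc.prems(1) by simp
  obtain g where g: "Ck_kernel r (2 * n) g" "\<And>s u z. \<bar>u\<bar> < r \<Longrightarrow> g s (- u) z = g s u z"
    "\<And>w z. Re w > -1 \<Longrightarrow>
      (w + 1) * (LINT p:{0..<l} \<times> {0<..<a}|lborel. of_real (snd p) powr w * e (fst p) (snd p) z) =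
      of_real a powr (w + 1) * (LINT s:{0..<l}|lborel. e s a z) -
      (LINT p:{0..<l} \<times> {0<..<a}|lborel. of_real (snd p) powr (w + 2) * g (fst p) (snd p) z)"
    by (rule even_kernel_step[OF Ck Suc.prems(2) a, of l]) (assumption | rule that)+
  define Jg where "Jg z = (LINT p:{0..<l} \<times> {0<..<a}|lborel. of_real (snd p) powr (z + of_nat (2 * Suc m)) * g (fst p) (snd p) z)" for z
  obtain Gg where Gg: "Gg holomorphic_on ({z. Re z > -1 - real (2 * Suc m) - real (2 * n)} - neg_odd_ints)"
    "\<And>z. Re z > -1 - real (2 * Suc m) \<Longrightarrow> Gg z = Jg z"
    "\<And>q. q \<in> neg_odd_ints \<Longrightarrow> Re q > -1 - real (2 * Suc m) - real (2 * n) \<Longrightarrow> \<exists>c. ((\<lambda>z. (z - q) * Gg z) \<longlongrightarrow> c) (at q)"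
    using Suc.IH[OF g(1,2), of "Suc m"] unfolding Jg_def by blast
  have JgH: "Jg holomorphic_on {z. Re z > -1 - real (2 * Suc m)}"
    unfolding Jg_def using Ck_kernel_regular[OF g(1)] by (intro holomorphic_powr_kernel_integral[OF _ a(2)])
  \<comment> \<open>The zero of the factor w + 1 for w = z + 2m, that is, the one pole this step can
    create.\<close>
  define q0 where "q0 = - complex_of_nat (2 * m + 1)"
  have q0: "q0 \<in> neg_odd_ints" by (auto simp: q0_def neg_odd_ints_def)
  define N where "N z = of_real a powr (z - q0) * (LINT s:{0..<l}|lborel. e s a z)" for z
  have NH: "N holomorphic_on UNIV"
    unfolding N_def using holomorphic_boundary_integral[OF Ck_kernel_regular[OF Ck] a] a
    by (intro holomorphic_intros) auto
  have Ncont: "(N \<longlongrightarrow> N q) (at q)" for q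
    using holomorphic_on_imp_continuous_on[OF NH] by (simp add: continuous_on_eq_continuous_at isCont_def)
  have region: "-1 - real (2 * Suc m) - real (2 * n) = -1 - real (2 * m) - real (2 * Suc n)" by simp
  define G where "G z = (N z - Gg z) / (z - q0)" for z
  show ?case
  proof (intro exI[of _ G] conjI ballI allI impI)
    show "G holomorphic_on {z. Re z > -1 - real (2 * m) - real (2 * Suc n)} - neg_odd_ints"
      unfolding G_def using Gg(1) q0 holomorphic_on_subset[OF NH] unfolding region
      by (intro holomorphic_intros) auto
    fix z assume z: "Re z > -1 - real (2 * m)"
    have "z - q0 \<noteq> 0" using z by (auto simp: q0_def complex_eq_iff)
    moreover have "(z - q0) * (LINT p:{0..<l} \<times> {0<..<a}|lborel. of_real (snd p) powr (z + of_nat (2 * m)) * e (fst p) (snd p) z) = N z - Jg z"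
      using g(3)[of "z + of_nat (2 * m)" z] z by (simp add: N_def Jg_def q0_def algebra_simps)
    moreover have "Gg z = Jg z" using z by (intro Gg(2)) simp
    ultimately show "G z = (LINT p:{0..<l} \<times> {0<..<a}|lborel. of_real (snd p) powr (z + of_nat (2 * m)) * e (fst p) (snd p) z)"
      by (simp add: G_def field_simps)
  next
    fix q assume q: "q \<in> neg_odd_ints" "Re q > -1 - real (2 * m) - real (2 * Suc n)"
    show "\<exists>c. ((\<lambda>z. (z - q) * G z) \<longlongrightarrow> c) (at q)"
    proof (cases "q = q0")
      case True
      \<comment> \<open>At q0 the continuation \<open>Gg\<close> still coincides with the integral
        \<open>Jg\<close>, which converges for Re z > -3 - 2m. So the numerator is holomorphic at q0
        and the pole there is at most simple.\<close>
      have q0': "Re q0 > -1 - real (2 * Suc m)" by (simp add: q0_def)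
      have "isCont Jg q0"
        using holomorphic_on_imp_continuous_on[OF JgH] open_halfspace_Re_gt[of "-1 - real (2 * Suc m)"] q0'
        by (simp add: continuous_on_eq_continuous_at)
      then have "((\<lambda>z. N z - Jg z) \<longlongrightarrow> N q0 - Jg q0) (at q0)"
        by (intro tendsto_intros Ncont) (simp add: isCont_def)
      moreover have "eventually (\<lambda>z. z \<in> {z. Re z > -1 - real (2 * Suc m)}) (at q0)"
        using q0' open_halfspace_Re_gt[of "-1 - real (2 * Suc m)"] by (intro eventually_at_in_open') auto
      then have "eventually (\<lambda>z. N z - Jg z = (z - q0) * G z) (at q0)"
        using eventually_neq_at_within[of q0]
        by eventually_elim (auto simp: G_def Gg(2))
      ultimately have "((\<lambda>z. (z - q0) * G z) \<longlongrightarrow> N q0 - Jg q0) (at q0)"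
        by (rule Lim_transform_eventually)
      then show ?thesis using True by blast
    next
      case False
      obtain c where c: "((\<lambda>z. (z - q) * Gg z) \<longlongrightarrow> c) (at q)"
        using Gg(3)[OF q(1)] q(2) unfolding region by blast
      \<comment> \<open>Away from q0 the factor 1 / (z - q0) is regular and N is entire, so a simple
        pole of \<open>Gg\<close> at q stays simple.\<close>
      have "((\<lambda>z. ((z - q) * N z - (z - q) * Gg z) / (z - q0)) \<longlongrightarrow> ((q - q) * N q - c) / (q - q0)) (at q)"
        using False by (intro tendsto_intros c Ncont) auto
      then show ?thesis
        by (auto simp: G_def algebra_simps)
    qed
  qed
qed

section \<open>Uniqueness and gluing of continuations\<close>

lemma neg_odd_ints_Re: "q \<in> neg_odd_ints \<Longrightarrow> Re q \<le> -1"
  by (auto simp: neg_odd_ints_def)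

text \<open>Identity theorem, starting from the half plane Re z > -1, which contains no negative odd
  integer. The larger half plane is still connected after the removal of countably many
  points.\<close>

lemma holomorphic_eq_off_neg_odd_ints:
  assumes "f holomorphic_on ({z. Re z > c} - neg_odd_ints)" "g holomorphic_on ({z. Re z > c} - neg_odd_ints)"
    and "c \<le> -1" "\<And>z. Re z > -1 \<Longrightarrow> f z = g z" "Re z > c" "z \<notin> neg_odd_ints"
  shows "f z = g z"
proof (rule analytic_continuation_open[of "{z. Re z > -1}" "{z. Re z > c} - neg_odd_ints" f g])
  show "{z. Re z > -1} \<noteq> {}" by (auto intro!: exI[of _ 0])
  show "connected ({z. Re z > c} - neg_odd_ints)"
    by (intro connected_open_diff_countable countable_neg_odd_ints open_halfspace_Re_gt connected_halfspace_Re_gt) auto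
  show "open ({z. Re z > c} - neg_odd_ints)"
    by (intro open_Diff open_halfspace_Re_gt closed_neg_odd_ints)
  show "{z. Re z > -1} \<subseteq> {z. Re z > c} - neg_odd_ints"
    using assms(3) neg_odd_ints_Re by force
qed (use assms open_halfspace_Re_gt in auto)

lemma glue_continuations:
  assumes "\<And>n. \<exists>G. G holomorphic_on ({z. Re z > -1 - real (2 * n)} - neg_odd_ints) \<and>
    (\<forall>z. Re z > -1 \<longrightarrow> G z = F z) \<and>
    (\<forall>q\<in>neg_odd_ints. Re q > -1 - real (2 * n) \<longrightarrow> (\<exists>c. ((\<lambda>z. (z - q) * G z) \<longlongrightarrow> c) (at q)))"
  shows "\<exists>G. G holomorphic_on (UNIV - neg_odd_ints) \<and> (\<forall>z. Re z > -1 \<longrightarrow> G z = F z) \<and>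
    (\<forall>q\<in>neg_odd_ints. \<exists>c. ((\<lambda>z. (z - q) * G z) \<longlongrightarrow> c) (at q))"
proof -
  obtain G where G: "\<And>n. G n holomorphic_on ({z. Re z > -1 - real (2 * n)} - neg_odd_ints)"
    "\<And>n z. Re z > -1 \<Longrightarrow> G n z = F z"
    "\<And>n q. q \<in> neg_odd_ints \<Longrightarrow> Re q > -1 - real (2 * n) \<Longrightarrow> \<exists>c. ((\<lambda>z. (z - q) * G n z) \<longlongrightarrow> c) (at q)"
    using assms by metis
  have agree: "G m z = G n z"
    if "Re z > -1 - real (2 * m)" "m \<le> n" "z \<notin> neg_odd_ints" for m n z
  proof (rule holomorphic_eq_off_neg_odd_ints[of "G m" _ "G n"])
    show "G n holomorphic_on ({z. Re z > -1 - real (2 * m)} - neg_odd_ints)"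
      using G(1)[of n] by (rule holomorphic_on_subset) (use that in auto)
  qed (use that G in auto)
  \<comment> \<open>An index whose half plane contains z; by \<open>agree\<close>, any other such
    index gives the same value off the exceptional points.\<close>
  define N where "N z = nat \<lceil>\<bar>Re z\<bar>\<rceil>" for z
  have N: "Re z > -1 - real (2 * N z)" for z
  proof -
    have "\<bar>Re z\<bar> \<le> real (N z)" by (simp add: N_def real_nat_ceiling_ge)
    then show ?thesis by simp
  qed
  define H where "H z = G (N z) z" for z
  have HG: "H z = G n z" if "Re z > -1 - real (2 * n)" "z \<notin> neg_odd_ints" for n z
    unfolding H_def using agree[of n z "N z"] agree[of "N z" z n] that N[of z] by (metis nle_le)
  have reg: "open ({z. Re z > -1 - real (2 * n)} - neg_odd_ints)" for n
    by (intro open_Diff open_halfspace_Re_gt closed_neg_odd_ints)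
  show ?thesis
  proof (intro exI[of _ H] conjI allI impI ballI)
    have "H field_differentiable at z" if "z \<notin> neg_odd_ints" for z
    proof -
      have "G (N z) field_differentiable at z"
        by (rule holomorphic_on_imp_differentiable_at[OF G(1) reg]) (use N that in simp)
      then obtain D where "(G (N z) has_field_derivative D) (at z)"
        unfolding field_differentiable_def ..
      then have "(H has_field_derivative D) (at z)"
        by (rule has_field_derivative_transform_within_open[OF _ reg[of "N z"]]) (use N that HG in auto)
      then show ?thesis unfolding field_differentiable_def by blast
    qed
    then show "H holomorphic_on UNIV - neg_odd_ints"
      by (auto simp: holomorphic_on_def intro: field_differentiable_at_within)
    show "H z = F z" if "Re z > -1" for z
      using that G(2) by (simp add: H_def)
    fix q assume q: "q \<in> neg_odd_ints"
    obtain c where c: "((\<lambda>z. (z - q) * G (N q) z) \<longlongrightarrow> c) (at q)"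
      using G(3)[OF q N] by blast
    have "eventually (\<lambda>z. z \<in> {z. Re z > -1 - real (2 * N q)}) (at q)"
      using N open_halfspace_Re_gt by (intro eventually_at_in_open') auto
    \<comment> \<open>H and \<open>G (N q)\<close> are compared only off the exceptional set. Its
      points differ by integers, so a unit disc about q contains no other one.\<close>
    moreover have "eventually (\<lambda>z. z \<notin> neg_odd_ints) (at q)"
    proof -
      have "eventually (\<lambda>z. z \<in> ball q 1) (at q)"
        by (intro eventually_at_in_open') auto
      then show ?thesis
        using eventually_neq_at_within[of q]
      proof eventually_elim
        case (elim z)
        show ?case
        proof
          assume "z \<in> neg_odd_ints"
          with q have "z - q \<in> \<int>" by (auto simp: neg_odd_ints_def)
          then obtain k where k: "z - q = of_int k" by (elim Ints_cases)
          have "norm (z - q) < 1" using elim by (simp add: dist_norm norm_minus_commute)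
          then have "\<bar>real_of_int k\<bar> < 1" unfolding k norm_of_int .
          then have "k = 0" by linarith
          then show False using k elim by simp
        qed
      qed
    qed
    ultimately have "eventually (\<lambda>z. (z - q) * G (N q) z = (z - q) * H z) (at q)"
      by eventually_elim (simp add: HG)
    with c have "((\<lambda>z. (z - q) * H z) \<longlongrightarrow> c) (at q)"
      by (rule Lim_transform_eventually)
    then show "\<exists>c. ((\<lambda>z. (z - q) * H z) \<longlongrightarrow> c) (at q)" by blast
  qed
qed

section \<open>Residue and finite part at -1\<close>

lemma set_integral_rect_powr:
  assumes "0 < a" "0 \<le> l" "Re w > -1"
  shows "(w + 1) * (LINT p:{0..<l} \<times> {0<..<a}|lborel. complex_of_real (snd p) powr w) = of_real l * of_real a powr (w + 1)"
proof -
  \<comment> \<open>The comparison integral is integration by parts for the constant kernel 1 with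
    derivative 0; a + 1 is merely a radius larger than a.\<close>
  have reg: "regular_kernel (a + 1) (\<lambda>s u z. c)" for c
    by (auto simp: regular_kernel_def)
  show ?thesis
    using powr_kernel_by_parts[of "a + 1" "\<lambda>s u z. 1" "\<lambda>s u z. 0" a w l 0] reg assms
    by (simp add: set_integral_const scaleR_conv_of_real)
qed

text \<open>e - 2 is O(u), uniformly for s in [0, l] and z in the unit disc. So for x in [-1, 0] the
  integrand at z = x is at most C u^(x+1) \<le> C (1 + a), a bound independent of x, and dominated
  convergence applies.\<close>

lemma even_kernel_limit_at_minus_one:
  assumes Ck: "Ck_kernel r 2 e" and e0: "\<And>s z. s \<in> {0..l} \<Longrightarrow> e s 0 z = 2"
    and a: "0 < a" "a < r" and l: "0 < l"
    and X: "\<And>n. X n \<in> {-1<..0}" "X \<longlonglongrightarrow> (-1::real)"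
  shows "(\<lambda>n. LINT p:{0..<l} \<times> {0<..<a}|lborel. complex_of_real (snd p) powr of_real (X n) * (e (fst p) (snd p) (of_real (X n)) - 2))
    \<longlonglongrightarrow> (LINT p:{0..<l} \<times> {0<..<a}|lborel. (e (fst p) (snd p) (-1) - 2) / of_real (snd p))"
    (is "?I \<longlonglongrightarrow> ?B")
proof -
  let ?P = "{0..<l} \<times> {0<..<a}"
  have reg: "regular_kernel r e" using Ck by (rule Ck_kernel_regular)
  have Ck': "Ck_kernel r (Suc 1) e" using Ck by (simp add: numeral_2_eq_2)
  obtain C where C: "C \<ge> 0" "\<And>s u z. s \<in> {0..l} \<Longrightarrow> \<bar>u\<bar> \<le> a \<Longrightarrow> z \<in> cball 0 1 \<Longrightarrow> norm (e s u z - e s 0 z) \<le> C * \<bar>u\<bar>"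
    using Ck_kernel_Lipschitz_at_0[OF Ck' _ _ a(2), of "{0..l}" "cball 0 1"] by (metis compact_Icc compact_cball)
  have bd: "norm (complex_of_real u powr of_real x * (e s u (of_real x) - 2)) \<le> C * (1 + a)"
    if "s \<in> {0..<l}" "u \<in> {0<..<a}" "x \<in> {-1..0}" for s u x
  proof -
    have "norm (e s u (of_real x) - 2) \<le> C * u"
      using C(2)[of s u "of_real x"] e0[of s] that by (auto simp: abs_le_iff)
    then have "norm (complex_of_real u powr of_real x * (e s u (of_real x) - 2)) \<le> u powr x * (C * u)"
      using that by (simp add: norm_mult cmod_of_real_powr mult_left_mono)
    also have "\<dots> = C * (u powr (x + 1))" using that by (simp add: powr_add)
    also have "u powr (x + 1) \<le> 1 + a"
    proof (cases "u \<le> 1")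
      case True
      then have "u powr (x + 1) \<le> 1" using that by (intro powr_le1) auto
      then show ?thesis using a by simp
    next
      case False
      then have "u powr (x + 1) \<le> u powr 1" using that by (intro powr_mono) auto
      then show ?thesis using that by simp
    qed
    finally show ?thesis using C(1) by (simp add: mult_left_mono)
  qed
  have one: "complex_of_real u powr (-1) * c = c / of_real u" if "u > 0" for u c
    using that powr_minus[of "complex_of_real u" 1] by (simp add: field_simps)
  have cont: "continuous_on ?P (\<lambda>p. complex_of_real (snd p) powr w * (e (fst p) (snd p) z - 2))" for w z
    using a by (intro continuous_intros continuous_on_of_real_powr regular_kernel_continuous_on[OF reg]) auto
  show ?thesis
    unfolding set_lebesgue_integral_def
  proof (rule integral_dominated_convergence[where w="\<lambda>p. indicat_real ?P p *\<^sub>R (C * (1 + a))"])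
    have "set_integrable lborel ?P (\<lambda>p. C * (1 + a))"
      by (rule set_integrable_rect_powr_bound[where x=0 and C="C * (1 + a)"])
        (use C a in \<open>auto simp: set_borel_measurable_def\<close>)
    then show "integrable lborel (\<lambda>p. indicat_real ?P p *\<^sub>R (C * (1 + a)))"
      by (simp add: set_integrable_def)
    show "(\<lambda>p. indicat_real ?P p *\<^sub>R (complex_of_real (snd p) powr of_real (X n) * (e (fst p) (snd p) (of_real (X n)) - 2))) \<in> borel_measurable lborel" for n
      using set_borel_measurable_rect_continuous[OF cont] by (simp add: set_borel_measurable_def)
    have "continuous_on ?P (\<lambda>p. (e (fst p) (snd p) (-1) - 2) / complex_of_real (snd p))"
      using a by (intro continuous_intros regular_kernel_continuous_on[OF reg]) auto
    then show "(\<lambda>p. indicat_real ?P p *\<^sub>R ((e (fst p) (snd p) (-1) - 2) / complex_of_real (snd p))) \<in> borel_measurable lborel"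
      using set_borel_measurable_rect_continuous unfolding set_borel_measurable_def by blast
    show "AE p in lborel. norm (indicat_real ?P p *\<^sub>R (complex_of_real (snd p) powr of_real (X n) *
        (e (fst p) (snd p) (of_real (X n)) - 2))) \<le> indicat_real ?P p *\<^sub>R (C * (1 + a))" for n
      using bd[of _ _ "X n"] X(1)[of n] by (intro AE_I2) (auto split: split_indicator)
    have lim: "(\<lambda>n. complex_of_real u powr of_real (X n) * (e s u (of_real (X n)) - 2)) \<longlonglongrightarrow> (e s u (-1) - 2) / of_real u"
      if "u \<in> {0<..<a}" for s u
    proof -
      have "e s u holomorphic_on UNIV" using reg that a by (simp add: regular_kernel_def)
      then have "isCont (e s u) (-1)"
        using holomorphic_on_imp_continuous_on continuous_on_eq_continuous_at[of UNIV] by blast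
      moreover have Xc: "(\<lambda>n. complex_of_real (X n)) \<longlonglongrightarrow> -1"
        using tendsto_of_real[OF X(2), where 'a=complex] by simp
      ultimately have "(\<lambda>n. e s u (of_real (X n))) \<longlonglongrightarrow> e s u (-1)"
        by (rule isCont_tendsto_compose)
      moreover have "isCont (\<lambda>z. complex_of_real u powr z) (-1)"
        using that by (intro continuous_intros) auto
      then have "(\<lambda>n. complex_of_real u powr of_real (X n)) \<longlonglongrightarrow> complex_of_real u powr (-1)"
        using Xc by (rule isCont_tendsto_compose)
      ultimately have "(\<lambda>n. complex_of_real u powr of_real (X n) * (e s u (of_real (X n)) - 2)) \<longlonglongrightarrow> complex_of_real u powr (-1) * (e s u (-1) - 2)"
        by (intro tendsto_mult tendsto_diff tendsto_const)
      then show ?thesis using one[of u] that by simp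
    qed
    show "AE p in lborel. (\<lambda>n. indicat_real ?P p *\<^sub>R (complex_of_real (snd p) powr of_real (X n) *
        (e (fst p) (snd p) (of_real (X n)) - 2))) \<longlonglongrightarrow> indicat_real ?P p *\<^sub>R ((e (fst p) (snd p) (-1) - 2) / complex_of_real (snd p))"
    proof (rule AE_I2)
      fix p
      show "(\<lambda>n. indicat_real ?P p *\<^sub>R (complex_of_real (snd p) powr of_real (X n) *
        (e (fst p) (snd p) (of_real (X n)) - 2))) \<longlonglongrightarrow> indicat_real ?P p *\<^sub>R ((e (fst p) (snd p) (-1) - 2) / complex_of_real (snd p))"
        using lim[of "snd p" "fst p"] by (cases "p \<in> ?P") auto
    qed
  qed
qed

text \<open>One integration by parts makes z + 1 times the integral a function N holomorphic on Re z
  > -3; then N(-1) is the residue and N'(-1) the finite part. Writing e = 2 + (e - 2), the first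
  summand contributes 2 l a^(z+1) to N, with value 2 l and derivative 2 l ln a at -1. The second
  contributes z + 1 times an integral with a limit, and that limit goes into the derivative.\<close>

lemma even_kernel_pole:
  assumes Ck: "Ck_kernel r 2 e" and even: "\<And>s u z. \<bar>u\<bar> < r \<Longrightarrow> e s (- u) z = e s u z"
    and e0: "\<And>s z. s \<in> {0..l} \<Longrightarrow> e s 0 z = 2"
    and a: "0 < a" "a < r" and l: "0 < l"
  obtains N where "N holomorphic_on {z. Re z > -3}"
    "\<And>z. Re z > -1 \<Longrightarrow> (z + 1) * (LINT p:{0..<l} \<times> {0<..<a}|lborel. of_real (snd p) powr z * e (fst p) (snd p) z) = N z"
    "N (-1) = of_real (2 * l)"
    "(N has_field_derivative ((LINT p:{0..<l} \<times> {0<..<a}|lborel. (e (fst p) (snd p) (-1) - 2) / of_real (snd p)) +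
        of_real (2 * l * ln a))) (at (-1))"
proof -
  let ?P = "{0..<l} \<times> {0<..<a}"
  define B where "B = (LINT p:?P|lborel. (e (fst p) (snd p) (-1) - 2) / of_real (snd p))"
  have reg: "regular_kernel r e" using Ck by (rule Ck_kernel_regular)
  have Ck0: "Ck_kernel r (Suc (Suc 0)) e" using Ck by (simp add: numeral_2_eq_2)
  obtain g where g: "Ck_kernel r 0 g" "\<And>s u z. \<bar>u\<bar> < r \<Longrightarrow> g s (- u) z = g s u z"
    "\<And>w z. Re w > -1 \<Longrightarrow>
      (w + 1) * (LINT p:{0..<l} \<times> {0<..<a}|lborel. of_real (snd p) powr w * e (fst p) (snd p) z) =
      of_real a powr (w + 1) * (LINT s:{0..<l}|lborel. e s a z) -
      (LINT p:{0..<l} \<times> {0<..<a}|lborel. of_real (snd p) powr (w + 2) * g (fst p) (snd p) z)"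
    by (rule even_kernel_step[OF Ck0 even a, of l]) (assumption | rule that)+
  define N where "N z = of_real a powr (z + 1) * (LINT s:{0..<l}|lborel. e s a z) -
      (LINT p:{0..<l} \<times> {0<..<a}|lborel. of_real (snd p) powr (z + of_nat 2) * g (fst p) (snd p) z)" for z
  have NH: "N holomorphic_on {z. Re z > -3}"
    unfolding N_def
  proof (intro holomorphic_intros)
    show "(\<lambda>z. LINT s:{0..<l}|lborel. e s a z) holomorphic_on {z. Re z > -3}"
      using holomorphic_boundary_integral[OF reg a] by (rule holomorphic_on_subset) auto
    show "(\<lambda>z. LINT p:?P|lborel. of_real (snd p) powr (z + of_nat 2) * g (fst p) (snd p) z) holomorphic_on {z. Re z > -3}"
      using holomorphic_powr_kernel_integral[OF _ a(2), of g l 2] g(1) by simp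
  qed
  have NJ: "(z + 1) * (LINT p:?P|lborel. of_real (snd p) powr z * e (fst p) (snd p) z) = N z" if "Re z > -1" for z
    using g(3)[OF that, of z] by (simp add: N_def)
  have NB: "N z = (z + 1) * (LINT p:?P|lborel. of_real (snd p) powr z * (e (fst p) (snd p) z - 2)) + 2 * of_real l * of_real a powr (z + 1)"
    if z: "Re z > -1" for z
  proof -
    have i1: "set_integrable lborel ?P (\<lambda>p. of_real (snd p) powr z * e (fst p) (snd p) z)"
      by (rule set_integrable_powr_kernel[OF reg a(2) z])
    have "regular_kernel r (\<lambda>s u z. 1)" by (auto simp: regular_kernel_def)
    from set_integrable_powr_kernel[OF this a(2) z, of l]
    have i2: "set_integrable lborel ?P (\<lambda>p. of_real (snd p) powr z * 2)" by simp
    define I1 where "I1 = (LINT p:?P|lborel. of_real (snd p) powr z * (e (fst p) (snd p) z - 2))"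
    define I2 where "I2 = (LINT p:?P|lborel. complex_of_real (snd p) powr z)"
    have "I1 = (LINT p:?P|lborel. of_real (snd p) powr z * e (fst p) (snd p) z) - (LINT p:?P|lborel. of_real (snd p) powr z * 2)"
      unfolding I1_def right_diff_distrib by (rule set_integral_diff(2)[OF i1 i2])
    then have "(LINT p:?P|lborel. of_real (snd p) powr z * e (fst p) (snd p) z) = I1 + 2 * I2"
      by (simp add: I2_def)
    then have "N z = (z + 1) * I1 + 2 * ((z + 1) * I2)"
      unfolding NJ[OF z, symmetric] by (simp add: algebra_simps)
    then show ?thesis
      unfolding I1_def I2_def set_integral_rect_powr[OF a(1) less_imp_le[OF l] z] by simp
  qed
  \<comment> \<open>N is already known to be holomorphic at -1, so its value and derivative there can be read off
    along any sequence tending to -1 from the right, where the integral itself converges.\<close>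
  define X where "X n = -1 + 1 / real (Suc n)" for n
  have X: "\<And>n. X n \<in> {-1<..0}" by (simp add: X_def)
  have "(\<lambda>n. -1 + 1 / real (Suc n)) \<longlonglongrightarrow> -1 + 0"
    by (intro tendsto_intros LIMSEQ_Suc[OF lim_1_over_n])
  then have Xlim: "X \<longlonglongrightarrow> -1" by (simp add: X_def[abs_def])
  have Xc: "(\<lambda>n. complex_of_real (X n)) \<longlonglongrightarrow> -1"
    using tendsto_of_real[OF Xlim, where 'a=complex] by simp
  define I where "I n = (LINT p:?P|lborel. complex_of_real (snd p) powr of_real (X n) * (e (fst p) (snd p) (of_real (X n)) - 2))" for n
  have I: "I \<longlonglongrightarrow> B"
    unfolding I_def B_def by (rule even_kernel_limit_at_minus_one[OF Ck e0 a l X Xlim])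
  have NX: "N (of_real (X n)) = (of_real (X n) + 1) * I n + 2 * of_real l * of_real a powr (of_real (X n) + 1)" for n
    using NB[of "of_real (X n)"] X[of n] by (simp add: I_def)
  obtain N' where N': "(N has_field_derivative N') (at (-1))"
    using holomorphic_on_imp_differentiable_at[OF NH open_halfspace_Re_gt, of "-1"]
    by (auto simp: field_differentiable_def)
  have powd: "((\<lambda>z. complex_of_real a powr (z + 1)) has_field_derivative of_real (ln a)) (at (-1))"
    using has_field_derivative_powr_right[of "complex_of_real a" "-1 + 1"] a
    unfolding DERIV_shift by (simp add: Ln_of_real)
  have "(\<lambda>n. N (of_real (X n))) \<longlonglongrightarrow> N (-1)"
    using DERIV_isCont[OF N'] Xc by (rule isCont_tendsto_compose)
  moreover have "(\<lambda>n. N (of_real (X n))) \<longlonglongrightarrow> (-1 + 1) * B + 2 * of_real l * of_real a powr (-1 + 1)"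
    unfolding NX
    by (intro tendsto_intros Xc I isCont_tendsto_compose[OF DERIV_isCont[OF powd] Xc])
  ultimately have "N (-1) = (-1 + 1) * B + 2 * of_real l * of_real a powr (-1 + 1)"
    by (rule LIMSEQ_unique)
  then have N1: "N (-1) = of_real (2 * l)" using a by simp
  \<comment> \<open>Applied to N and to a^(z+1), this reduces the computation of N'(-1) to limits
    along the one sequence X.\<close>
  have quot: "(\<lambda>n. (f (of_real (X n)) - f (-1)) / (of_real (X n) - -1)) \<longlonglongrightarrow> f'"
    if "(f has_field_derivative f') (at (-1))" for f :: "complex \<Rightarrow> complex" and f'
  proof -
    have "((\<lambda>z. (f z - f (-1)) / (z - -1)) \<longlongrightarrow> f') (at (-1))"
      using that by (simp add: has_field_derivative_iff)
    moreover have "of_real (X n) \<noteq> (-1 :: complex)" for n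
      using X[of n] by (auto simp: complex_eq_iff)
    ultimately show ?thesis
      using Xc unfolding tendsto_at_iff_sequentially comp_def
      by (auto dest!: spec[of _ "\<lambda>n. complex_of_real (X n)"])
  qed
  have "(N (of_real (X n)) - N (-1)) / (of_real (X n) - -1) =
      I n + 2 * of_real l * ((of_real a powr (of_real (X n) + 1) - of_real a powr (-1 + 1)) / (of_real (X n) - -1))" for n
  proof -
    have "of_real (X n) + 1 \<noteq> (0 :: complex)" using X[of n] by (auto simp: complex_eq_iff)
    then show ?thesis using a by (simp add: NX N1 field_simps)
  qed
  moreover have "(\<lambda>n. I n + 2 * of_real l * ((of_real a powr (of_real (X n) + 1) - of_real a powr (-1 + 1)) / (of_real (X n) - -1)))
      \<longlonglongrightarrow> B + 2 * of_real l * of_real (ln a)"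
    by (intro tendsto_intros I quot[OF powd])
  ultimately have "(\<lambda>n. (N (of_real (X n)) - N (-1)) / (of_real (X n) - -1)) \<longlonglongrightarrow> B + 2 * of_real l * of_real (ln a)"
    by simp
  then have "N' = B + 2 * of_real l * of_real (ln a)"
    using quot[OF N'] by (rule LIMSEQ_unique[rotated])
  then have "(N has_field_derivative (B + of_real (2 * l * ln a))) (at (-1))"
    using N' by simp
  then show ?thesis
    using that[OF NH NJ N1] unfolding B_def by blast
qed

text \<open>Two descriptions are merged: the glued G, defined on the whole plane, and N(z) / (z +
  1), which is explicit near -1. They agree for Re z > -3 away from -1, so k G inherits the residue
  k N(-1) and the finite part k N'(-1).\<close>

lemma even_kernel_good_continuation:
  fixes k :: real
  assumes Ck: "\<And>n. Ck_kernel r n e" and even: "\<And>s u z. \<bar>u\<bar> < r \<Longrightarrow> e s (- u) z = e s u z"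
    and e0: "\<And>s z. s \<in> {0..l} \<Longrightarrow> e s 0 z = 2"
    and a: "0 < a" "a < r" and l: "0 < l"
    and F: "\<And>z. Re z > -1 \<Longrightarrow> F z = of_real k *
      (LINT p:{0..<l} \<times> {0<..<a}|lborel. of_real (snd p) powr z * e (fst p) (snd p) z)"
  shows "\<exists>G. good_continuation F G (of_real (k * (2 * l)))
    (of_real k * ((LINT p:{0..<l} \<times> {0<..<a}|lborel. (e (fst p) (snd p) (-1) - 2) / of_real (snd p)) +
        of_real (2 * l * ln a)))"
proof -
  define J where "J z = (LINT p:{0..<l} \<times> {0<..<a}|lborel. of_real (snd p) powr z * e (fst p) (snd p) z)" for z
  define A where "A = (LINT p:{0..<l} \<times> {0<..<a}|lborel. (e (fst p) (snd p) (-1) - 2) / of_real (snd p)) +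
        of_real (2 * l * ln a)"
  obtain N where N: "N holomorphic_on {z. Re z > -3}" "\<And>z. Re z > -1 \<Longrightarrow> (z + 1) * J z = N z"
    "N (-1) = of_real (2 * l)" "(N has_field_derivative A) (at (-1))"
    by (rule even_kernel_pole[OF Ck even e0 a l, folded J_def A_def]) (assumption | rule that)+
  obtain G where G: "G holomorphic_on (UNIV - neg_odd_ints)" "\<And>z. Re z > -1 \<Longrightarrow> G z = J z"
    "\<And>q. q \<in> neg_odd_ints \<Longrightarrow> \<exists>c. ((\<lambda>z. (z - q) * G z) \<longlongrightarrow> c) (at q)"
  proof -
    have "\<exists>G. G holomorphic_on ({z. Re z > -1 - real (2 * n)} - neg_odd_ints) \<and> (\<forall>z. Re z > -1 \<longrightarrow> G z = J z) \<and>
      (\<forall>q\<in>neg_odd_ints. Re q > -1 - real (2 * n) \<longrightarrow> (\<exists>c. ((\<lambda>z. (z - q) * G z) \<longlongrightarrow> c) (at q)))" for n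
      using even_kernel_continuation[OF Ck even a, where m=0 and l=l and n=n] by (simp add: J_def)
    from glue_continuations[OF this] show ?thesis using that by blast
  qed
  have m1: "-1 \<in> neg_odd_ints" by (auto simp: neg_odd_ints_def intro!: exI[of _ 0])
  \<comment> \<open>The next candidate pole, -3, lies on the boundary of the half plane where N is
    holomorphic.\<close>
  have only: "z = -1" if "Re z > -3" "z \<in> neg_odd_ints" for z
    using that by (auto simp: neg_odd_ints_def)
  have GN: "G z = N z / (z + 1)" if "Re z > -3" "z \<noteq> -1" for z
  proof (rule holomorphic_eq_off_neg_odd_ints[of G "-3" "\<lambda>z. N z / (z + 1)"])
    show "G holomorphic_on {z. Re z > -3} - neg_odd_ints"
      using G(1) by (rule holomorphic_on_subset) auto
    have "z + 1 \<noteq> 0" if "z \<notin> neg_odd_ints" for z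
      using that m1 by (metis add_eq_0_iff2)
    then show "(\<lambda>z. N z / (z + 1)) holomorphic_on {z. Re z > -3} - neg_odd_ints"
      using holomorphic_on_subset[OF N(1)] by (intro holomorphic_intros) auto
    show "G z = N z / (z + 1)" if "Re z > -1" for z
    proof -
      have "z + 1 \<noteq> 0" using that by (auto simp: complex_eq_iff)
      then show ?thesis using G(2)[OF that] N(2)[OF that] by (simp add: field_simps)
    qed
  qed (use that only in auto)
  have ev: "eventually (\<lambda>z. G z = N z / (z + 1)) (at (-1))"
  proof -
    have "eventually (\<lambda>z. z \<in> {z. Re z > -3}) (at (-1))"
      using open_halfspace_Re_gt by (intro eventually_at_in_open') auto
    then show ?thesis
      using eventually_neq_at_within[of "-1"] by eventually_elim (auto simp: GN)
  qed
  show ?thesis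
    unfolding good_continuation_def A_def[symmetric]
  proof (intro exI[of _ "\<lambda>z. of_real k * G z"] conjI ballI allI impI)
    show "(\<lambda>z. of_real k * G z) holomorphic_on UNIV - neg_odd_ints"
      using G(1) by (intro holomorphic_intros)
    show "of_real k * G z = F z" if "Re z > -1" for z
      using F[OF that] G(2)[OF that] by (simp add: J_def)
    show "\<exists>c. ((\<lambda>z. (z - q) * (of_real k * G z)) \<longlongrightarrow> c) (at q)" if q: "q \<in> neg_odd_ints" for q
    proof -
      obtain c where "((\<lambda>z. (z - q) * G z) \<longlongrightarrow> c) (at q)" using G(3)[OF q] by blast
      then have "((\<lambda>z. of_real k * ((z - q) * G z)) \<longlongrightarrow> of_real k * c) (at q)" by (intro tendsto_intros)
      then show ?thesis by (auto simp: algebra_simps)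
    qed
    show "residue (\<lambda>z. of_real k * G z) (-1) = of_real (k * (2 * l))"
    proof (rule residue_simple'[OF open_halfspace_Re_gt[of "-3"]])
      show "(\<lambda>z. of_real k * G z) holomorphic_on {z. Re z > -3} - {-1}"
        using only by (intro holomorphic_intros holomorphic_on_subset[OF G(1)]) auto
      have "((\<lambda>z. of_real k * N z) \<longlongrightarrow> of_real k * N (-1)) (at (-1))"
        using DERIV_isCont[OF N(4)] by (intro tendsto_intros) (simp add: isCont_def)
      moreover have "eventually (\<lambda>z. of_real k * N z = of_real k * G z * (z - -1)) (at (-1))"
        using ev eventually_neq_at_within[of "-1"]
      proof eventually_elim
        case (elim z)
        then have "z + 1 \<noteq> 0" by (simp add: add_eq_0_iff2)
        then show ?case using elim by simp
      qed
      ultimately have "((\<lambda>z. of_real k * G z * (z - -1)) \<longlongrightarrow> of_real k * N (-1)) (at (-1))"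
        by (rule Lim_transform_eventually)
      then show "((\<lambda>z. of_real k * G z * (z - -1)) \<longlongrightarrow> of_real (k * (2 * l))) (at (-1))"
        by (simp add: N(3))
    qed simp
    have "((\<lambda>z. (N z - N (-1)) / (z - -1)) \<longlongrightarrow> A) (at (-1))"
      using N(4) by (simp add: has_field_derivative_iff)
    then have "((\<lambda>z. of_real k * ((N z - N (-1)) / (z - -1))) \<longlongrightarrow> of_real k * A) (at (-1))"
      by (intro tendsto_intros)
    moreover have "eventually (\<lambda>z. of_real k * ((N z - N (-1)) / (z - -1)) =
        of_real k * G z - of_real (k * (2 * l)) / (z + 1)) (at (-1))"
      using ev by eventually_elim (simp add: N(3) diff_divide_distrib right_diff_distrib)
    ultimately show "((\<lambda>z. of_real k * G z - of_real (k * (2 * l)) / (z + 1)) \<longlongrightarrow> of_real k * A) (at (-1))"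
      by (rule Lim_transform_eventually)
  qed
qed

section \<open>The kernels of a closed curve\<close>

locale arclength_curve =
  fixes \<gamma> :: "real \<Rightarrow> real^3" and L :: real
  assumes curve: "arclength_simple_closed_curve \<gamma> L"
begin

definition tangent :: "real \<Rightarrow> real^3" where
  "tangent s = vector_derivative \<gamma> (at s)"

lemma L_pos: "L > 0" and period: "\<gamma> (s + L) = \<gamma> s" and norm_tangent: "norm (tangent s) = 1"
  and inj: "inj_on \<gamma> {0..<L}" and smooth: "smooth_curve \<gamma>"
  using curve by (auto simp: arclength_simple_closed_curve_def tangent_def)

lemma has_tangent: "(\<gamma> has_vector_derivative tangent s) (at s)"
proof -
  obtain D where "D 0 = \<gamma>" "\<And>k t. (D k has_vector_derivative D (Suc k) t) (at t)"
    using smooth by (auto simp: smooth_curve_def)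
  then show ?thesis
    unfolding tangent_def by (metis vector_derivative_works differentiableI_vector)
qed

text \<open>Kernels are complex-valued, so vectors enter by components. Uniqueness of derivatives
  identifies the member D 1 of the given family with \<open>tangent\<close>.\<close>

lemma tangent_kernel: "Ck_kernel r n (\<lambda>s u z. complex_of_real (tangent (s + u) $ i))"
proof -
  obtain D where D: "D 0 = \<gamma>" "\<And>k t. (D k has_vector_derivative D (Suc k) t) (at t)"
    using smooth by (auto simp: smooth_curve_def)
  have D1: "D 1 = tangent"
    using D(2)[of 0] has_tangent unfolding D(1) by (intro ext) (metis One_nat_def vector_derivative_unique_at)
  have bl: "bounded_linear (\<lambda>v :: real^3. complex_of_real (v $ i))"
    by (intro bounded_linear_compose[OF bounded_linear_of_real] bounded_linear_vec_nth)
  have "Ck_kernel r n (\<lambda>s u z. complex_of_real (D 1 (s + u) $ i))"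
    by (rule Ck_kernel_translate[of "\<lambda>k t. complex_of_real (D k t $ i)"])
       (rule bounded_linear.has_vector_derivative[OF bl D(2)])
  then show ?thesis unfolding D1 .
qed

lemma continuous_curve: "continuous_on A \<gamma>"
  using has_tangent by (intro continuous_at_imp_continuous_on) (auto intro: has_vector_derivative_continuous)

lemma continuous_tangent: "continuous_on A tangent"
proof -
  have "continuous_on A (\<lambda>s. tangent s $ i)" for i
  proof -
    have "continuous_on A (\<lambda>s. complex_of_real (tangent (s + 0) $ i))"
      by (rule regular_kernel_continuous_on[OF Ck_kernel_regular[OF tangent_kernel[of 1 0]]])
         (auto intro!: continuous_intros)
    from continuous_on_Re[OF this] show ?thesis by simp
  qed
  then have "continuous_on A (\<lambda>s. \<chi> i. tangent s $ i)" by (rule continuous_on_vec_lambda)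
  then show ?thesis by simp
qed

lemma tangent_kernel_fst: "Ck_kernel r n (\<lambda>s u z. complex_of_real (tangent s $ i))"
  by (rule Ck_kernel_fst) (intro continuous_intros continuous_tangent)

lemma tangent_period: "tangent (s + L) = tangent s"
proof -
  have "((\<lambda>t. t + L) has_vector_derivative 1) (at s)"
    by (auto intro!: derivative_eq_intros)
  from vector_diff_chain_at[OF this has_tangent[of "s + L"]]
  have "(\<gamma> has_vector_derivative tangent (s + L)) (at s)"
    by (simp add: o_def period)
  then show ?thesis using has_tangent vector_derivative_unique_at by blast
qed

sublocale periodic: periodic_fun_simple \<gamma> L
  by unfold_locales (rule period)

text \<open>Both parameters are reduced to [0, L) by whole periods, where injectivity makes them
  equal. So u is a multiple of L, and |u| < L leaves only 0.\<close>

lemma chord_neq: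
  assumes "u \<noteq> 0" "\<bar>u\<bar> < L" shows "\<gamma> (s + u) \<noteq> \<gamma> s"
proof
  assume eq: "\<gamma> (s + u) = \<gamma> s"
  define w where "w x = x - of_int \<lfloor>x / L\<rfloor> * L" for x
  have w: "w x \<in> {0..<L}" for x
  proof -
    show ?thesis
      using floor_divide_lower[OF L_pos, of x] floor_divide_upper[OF L_pos, of x] by (simp add: w_def algebra_simps)
  qed
  have "\<gamma> (w x) = \<gamma> x" for x
    unfolding w_def by (rule periodic.minus_of_int)
  then have "w (s + u) = w s"
    using inj_onD[OF inj, of "w (s + u)" "w s"] w eq by simp
  then have u: "u = of_int (\<lfloor>(s + u) / L\<rfloor> - \<lfloor>s / L\<rfloor>) * L"
    by (simp add: w_def algebra_simps)
  then have "\<bar>of_int (\<lfloor>(s + u) / L\<rfloor> - \<lfloor>s / L\<rfloor>)\<bar> * L < 1 * L"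
    using assms(2) L_pos by (metis abs_mult abs_of_pos mult_1)
  then have "\<bar>real_of_int (\<lfloor>(s + u) / L\<rfloor> - \<lfloor>s / L\<rfloor>)\<bar> < 1"
    using L_pos by (simp only: mult_less_cancel_right_pos)
  then have "\<lfloor>(s + u) / L\<rfloor> - \<lfloor>s / L\<rfloor> = 0" by linarith
  then show False using u assms(1) by simp
qed

lemma chord_le: "norm (\<gamma> (s + u) - \<gamma> s) \<le> \<bar>u\<bar>"
proof -
  have "norm (\<gamma> (s + u) - \<gamma> s) \<le> 1 * norm ((s + u) - s)"
  proof (rule differentiable_bound[of UNIV \<gamma> "\<lambda>v h. h *\<^sub>R tangent v"])
    show "(\<gamma> has_derivative (\<lambda>h. h *\<^sub>R tangent v)) (at v within UNIV)" for v
      using has_tangent[of v] by (simp add: has_vector_derivative_def)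
    show "onorm (\<lambda>h. h *\<^sub>R tangent v) \<le> 1" for v
      by (intro onorm_le) (simp add: norm_tangent)
  qed auto
  then show ?thesis by simp
qed

text \<open>Components of the difference quotient of the curve, extended smoothly to u = 0.\<close>

definition chord :: "3 \<Rightarrow> real \<Rightarrow> real \<Rightarrow> complex \<Rightarrow> complex" where
  "chord i = kernel_average 0 (\<lambda>s u z. complex_of_real (tangent (s + u) $ i))"

lemma chord_kernel: "Ck_kernel r n (chord i)"
  unfolding chord_def by (intro Ck_kernel_average tangent_kernel)

lemma chord_0: "chord i s 0 z = of_real (tangent s $ i)"
  by (simp add: chord_def kernel_average_def)

lemma chord_mult: "of_real u * chord i s u z = of_real ((\<gamma> (s + u) - \<gamma> s) $ i)"
proof -
  have bl: "bounded_linear (\<lambda>v :: real^3. complex_of_real (v $ i))"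
    by (intro bounded_linear_compose[OF bounded_linear_of_real] bounded_linear_vec_nth)
  have "((\<lambda>t. u *\<^sub>R complex_of_real (tangent (s + t * u) $ i)) has_integral
      (complex_of_real (\<gamma> (s + 1 * u) $ i) - complex_of_real (\<gamma> (s + 0 * u) $ i))) {0..1}"
  proof (rule fundamental_theorem_of_calculus)
    fix t :: real
    have "((\<lambda>t. s + t * u) has_vector_derivative u) (at t)"
      by (auto intro!: derivative_eq_intros)
    from bounded_linear.has_vector_derivative[OF bl vector_diff_chain_at[OF this has_tangent]]
    show "((\<lambda>t. complex_of_real (\<gamma> (s + t * u) $ i)) has_vector_derivative
        u *\<^sub>R complex_of_real (tangent (s + t * u) $ i)) (at t within {0..1})"
      by (auto simp: o_def scaleR_conv_of_real[where 'a=complex] intro: has_vector_derivative_at_within)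
  qed simp
  from integral_unique[OF this] show ?thesis
    by (simp add: chord_def kernel_average_def scaleR_conv_of_real)
qed

section \<open>The ratio of chord to arc and its complex powers\<close>

definition ratio :: "real \<Rightarrow> real \<Rightarrow> real" where
  "ratio s u = (if u = 0 then 1 else norm (\<gamma> (s + u) - \<gamma> s) / \<bar>u\<bar>)"

lemma ratio_pos: "\<bar>u\<bar> < L \<Longrightarrow> ratio s u > 0"
  using chord_neq[of u s] by (simp add: ratio_def)

lemma ratio_le_1: "ratio s u \<le> 1"
  using chord_le[of s u] by (simp add: ratio_def)

lemma norm_chord: "norm (\<gamma> (s + u) - \<gamma> s) = \<bar>u\<bar> * ratio s u"
  by (simp add: ratio_def)

lemma of_real_inner_vec: "complex_of_real (x \<bullet> y) = (\<Sum>i\<in>UNIV. of_real (x $ i) * of_real (y $ i))" for x y :: "real^3"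
  by (simp add: inner_vec_def)

text \<open>The ratio contains a norm, but its square is a polynomial in the smooth components
  \<open>chord i\<close>, also at u = 0, where it is the squared length 1 of the tangent. Smoothness
  of the later kernels is therefore obtained from the square.\<close>

lemma chord_square: "(\<Sum>i\<in>UNIV. chord i s u z * chord i s u z) = of_real ((ratio s u)\<^sup>2)"
proof (cases "u = 0")
  case True
  then show ?thesis
    using norm_tangent[of s] by (simp add: chord_0 ratio_def flip: of_real_inner_vec power2_norm_eq_inner)
next
  case False
  have "(of_real u)\<^sup>2 * (\<Sum>i\<in>UNIV. chord i s u z * chord i s u z) =
      (\<Sum>i\<in>UNIV. (of_real u * chord i s u z) * (of_real u * chord i s u z))"
    by (simp add: sum_distrib_left power2_eq_square ac_simps)
  also have "\<dots> = of_real ((norm (\<gamma> (s + u) - \<gamma> s))\<^sup>2)"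
    unfolding chord_mult power2_norm_eq_inner of_real_inner_vec ..
  also have "\<dots> = (of_real u)\<^sup>2 * of_real ((ratio s u)\<^sup>2)"
    unfolding norm_chord by (simp add: power_mult_distrib flip: of_real_power)
  finally show ?thesis using False by simp
qed

lemma square_ratio_kernel: "Ck_kernel r n (\<lambda>s u z. of_real ((ratio s u)\<^sup>2))"
proof -
  have "Ck_kernel r n (\<lambda>s u z. \<Sum>i\<in>UNIV. chord i s u z * chord i s u z)"
    by (intro Ck_kernel_sum Ck_kernel_mult chord_kernel)
  then show ?thesis unfolding chord_square .
qed

text \<open>Half the logarithm of the squared ratio avoids a square root. For |u| < L the square is
  positive, so \<open>Ln\<close> stays off its branch cut and the power is a smooth kernel, entire
  in z.\<close>

definition ratio_powr :: "real \<Rightarrow> real \<Rightarrow> complex \<Rightarrow> complex" where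
  "ratio_powr s u z = exp (z * (1 / 2) * Ln (of_real ((ratio s u)\<^sup>2)))"

lemma ratio_powr_kernel: "Ck_kernel L n ratio_powr"
proof -
  have "Ck_kernel L n (\<lambda>s u z. exp (z * (1 / 2) * Ln (of_real ((ratio s u)\<^sup>2))))"
  proof (intro Ck_kernel_exp Ck_kernel_mult Ck_kernel_param Ck_kernel_fst Ck_kernel_Ln square_ratio_kernel continuous_intros)
    show "complex_of_real ((ratio s u)\<^sup>2) \<notin> \<real>\<^sub>\<le>\<^sub>0" if "\<bar>u\<bar> < L" for s u
      using ratio_pos[OF that, of s] by (simp only: nonpos_Reals_of_real_iff) simp
  qed
  then show ?thesis unfolding ratio_powr_def[abs_def] .
qed

lemma ratio_powr_0: "ratio_powr s 0 z = 1"
  by (simp add: ratio_powr_def ratio_def)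

lemma ratio_powr_eq: "\<bar>u\<bar> < L \<Longrightarrow> ratio_powr s u z = of_real (ratio s u) powr z"
  using ratio_pos[of u s]
  by (simp add: ratio_powr_def powr_def Ln_of_real ln_realpow flip: of_real_power)

lemma chord_powr:
  assumes "u \<noteq> 0" "\<bar>u\<bar> < L"
  shows "complex_of_real (norm (\<gamma> s - \<gamma> (s + u))) powr z = of_real \<bar>u\<bar> powr z * ratio_powr s u z"
proof -
  have "norm (\<gamma> s - \<gamma> (s + u)) = \<bar>u\<bar> * ratio s u"
    using norm_chord[of s u] by (simp add: norm_minus_commute)
  then show ?thesis
    using ratio_pos[OF assms(2), of s] assms
    by (simp add: ratio_powr_eq powr_times_real)
qed

definition hN :: "real \<Rightarrow> real \<Rightarrow> complex \<Rightarrow> complex" where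
  "hN s u z = ratio_powr s u z * (\<Sum>i\<in>UNIV. of_real (tangent s $ i) * of_real (tangent (s + u) $ i))"

text \<open>Each scalar product with the chord vector carries a factor u. Together they cancel the
  u^2 in the squared chord length, and the inverse squared ratio remains.\<close>

definition hW :: "real \<Rightarrow> real \<Rightarrow> complex \<Rightarrow> complex" where
  "hW s u z = ratio_powr s u z * inverse (of_real ((ratio s u)\<^sup>2)) *
     ((\<Sum>i\<in>UNIV. chord i s u z * of_real (tangent s $ i)) * (\<Sum>i\<in>UNIV. chord i s u z * of_real (tangent (s + u) $ i)))"

lemma hN_kernel: "Ck_kernel L n hN"
proof -
  have "Ck_kernel L n (\<lambda>s u z. ratio_powr s u z * (\<Sum>i\<in>UNIV. of_real (tangent s $ i) * of_real (tangent (s + u) $ i)))"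
    by (intro Ck_kernel_mult ratio_powr_kernel Ck_kernel_sum tangent_kernel tangent_kernel_fst)
  then show ?thesis unfolding hN_def[abs_def] .
qed

lemma inverse_square_ratio_kernel: "Ck_kernel L n (\<lambda>s u z. inverse (of_real ((ratio s u)\<^sup>2)))"
proof (intro Ck_kernel_inverse square_ratio_kernel)
  show "complex_of_real ((ratio s u)\<^sup>2) \<noteq> 0" if "\<bar>u\<bar> < L" for s u
    using ratio_pos[OF that, of s] by simp
qed

lemma hW_kernel: "Ck_kernel L n hW"
proof -
  have "Ck_kernel L n (\<lambda>s u z. ratio_powr s u z * inverse (of_real ((ratio s u)\<^sup>2)) *
     ((\<Sum>i\<in>UNIV. chord i s u z * of_real (tangent s $ i)) * (\<Sum>i\<in>UNIV. chord i s u z * of_real (tangent (s + u) $ i))))"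
    by (intro Ck_kernel_mult ratio_powr_kernel Ck_kernel_sum inverse_square_ratio_kernel
        tangent_kernel tangent_kernel_fst chord_kernel)
  then show ?thesis unfolding hW_def[abs_def] .
qed

lemma tangent_inner_self: "(\<Sum>i\<in>UNIV. complex_of_real (tangent s $ i) * of_real (tangent s $ i)) = 1"
  using norm_tangent[of s] by (simp flip: of_real_inner_vec power2_norm_eq_inner)

lemma hN_0: "hN s 0 z = 1"
  by (simp add: hN_def ratio_powr_0 tangent_inner_self)

lemma hW_0: "hW s 0 z = 1"
  by (simp add: hW_def ratio_powr_0 tangent_inner_self chord_0 ratio_def)

lemma rhoN_eq: "rhoN \<gamma> (s, t) = tangent s \<bullet> tangent t"
  by (simp add: rhoN_def tangent_def)

lemma rhoW_eq: "rhoW \<gamma> (s, t) = ((\<gamma> t - \<gamma> s) \<bullet> tangent s) * ((\<gamma> t - \<gamma> s) \<bullet> tangent t) / (norm (\<gamma> t - \<gamma> s))\<^sup>2"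
  by (simp add: rhoW_def tangent_def Let_def power2_eq_square)

lemma Fint_integrand_N:
  assumes "u \<noteq> 0" "\<bar>u\<bar> < L"
  shows "Fint_integrand \<gamma> (rhoN \<gamma>) z (s, s + u) = of_real \<bar>u\<bar> powr z * hN s u z"
  unfolding Fint_integrand_def fst_conv snd_conv chord_powr[OF assms] rhoN_eq of_real_inner_vec hN_def by simp

lemma chord_inner: "of_real u * (\<Sum>i\<in>UNIV. chord i s u z * of_real (v $ i)) = of_real ((\<gamma> (s + u) - \<gamma> s) \<bullet> v)"
proof -
  have "of_real u * (\<Sum>i\<in>UNIV. chord i s u z * of_real (v $ i)) = (\<Sum>i\<in>UNIV. (of_real u * chord i s u z) * of_real (v $ i))"
    by (simp add: sum_distrib_left ac_simps)
  then show ?thesis unfolding chord_mult of_real_inner_vec .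
qed

lemma Fint_integrand_W:
  assumes "u \<noteq> 0" "\<bar>u\<bar> < L"
  shows "Fint_integrand \<gamma> (rhoW \<gamma>) z (s, s + u) = of_real \<bar>u\<bar> powr z * hW s u z"
proof -
  define S1 where "S1 = (\<Sum>i\<in>UNIV. chord i s u z * of_real (tangent s $ i))"
  define S2 where "S2 = (\<Sum>i\<in>UNIV. chord i s u z * of_real (tangent (s + u) $ i))"
  have "complex_of_real (rhoW \<gamma> (s, s + u)) = (of_real u * S1) * (of_real u * S2) / (of_real \<bar>u\<bar> * of_real (ratio s u))\<^sup>2"
    unfolding rhoW_eq S1_def S2_def chord_inner norm_chord by simp
  also have "\<dots> = inverse (of_real ((ratio s u)\<^sup>2)) * (S1 * S2)"
    using assms ratio_pos[OF assms(2), of s]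
    by (simp add: field_simps power2_eq_square flip: of_real_mult)
  finally show ?thesis
    unfolding Fint_integrand_def fst_conv snd_conv chord_powr[OF assms] hW_def S1_def S2_def by simp
qed

end

section \<open>Cut-off limits and continuation for a density\<close>

context arclength_curve
begin

text \<open>Boundedness of the kernel 1 / ratio^2 gives c, and the Lipschitz bound of ratio^2 at u =
  0 gives K. As the ratio is at most 1, it dominates its square, which transfers both lower bounds
  to the ratio itself. Both kernels are constant in z and are evaluated at z = 0.\<close>

lemma ratio_bounds:
  obtains c K where "0 < c" "0 \<le> K"
    "\<And>s u. s \<in> {0..L} \<Longrightarrow> \<bar>u\<bar> \<le> L / 2 \<Longrightarrow> c \<le> ratio s u"
    "\<And>s u. s \<in> {0..L} \<Longrightarrow> \<bar>u\<bar> \<le> L / 2 \<Longrightarrow> 1 - K * \<bar>u\<bar> \<le> ratio s u"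
proof -
  have a: "L / 2 < L" using L_pos by simp
  obtain C where C: "0 \<le> C" "\<And>s u (z :: complex). s \<in> {0..L} \<Longrightarrow> \<bar>u\<bar> \<le> L / 2 \<Longrightarrow> z \<in> {0} \<Longrightarrow>
      norm (inverse (complex_of_real ((ratio s u)\<^sup>2))) \<le> C"
    by (rule regular_kernel_bounded[OF Ck_kernel_regular[OF inverse_square_ratio_kernel[of 0]]
          compact_Icc[of 0 L] compact_sing[of 0] a]) (assumption | rule that)+
  obtain K where K: "0 \<le> K" "\<And>s u (z :: complex). s \<in> {0..L} \<Longrightarrow> \<bar>u\<bar> \<le> L / 2 \<Longrightarrow> z \<in> {0} \<Longrightarrow>
      norm (complex_of_real ((ratio s u)\<^sup>2) - complex_of_real ((ratio s 0)\<^sup>2)) \<le> K * \<bar>u\<bar>"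
    by (rule Ck_kernel_Lipschitz_at_0[OF square_ratio_kernel[of L "Suc 0"]
          compact_Icc[of 0 L] compact_sing[of 0] a]) (assumption | rule that)+
  have sq: "(ratio s u)\<^sup>2 \<le> ratio s u" if "\<bar>u\<bar> \<le> L / 2" for s u
    using ratio_le_1[of s u] ratio_pos[of u s] that a by (simp add: power2_eq_square)
  show ?thesis
  \<comment> \<open>C is only known to be nonnegative; C + 1 keeps the denominator positive.\<close>
  proof (rule that[of "1 / (C + 1)" K])
    fix s u assume s: "s \<in> {0..L}" and u: "\<bar>u\<bar> \<le> L / 2"
    have pos: "ratio s u > 0" using ratio_pos u a by simp
    have "norm (inverse (complex_of_real ((ratio s u)\<^sup>2))) = 1 / (ratio s u)\<^sup>2"
      by (simp add: norm_divide norm_power inverse_eq_divide)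
    then have "1 / (ratio s u)\<^sup>2 \<le> C" using C(2)[OF s u, of 0] by simp
    then have "1 \<le> C * (ratio s u)\<^sup>2" using pos by (simp add: field_simps)
    also have "\<dots> \<le> (C + 1) * ratio s u" using sq[OF u, of s] C(1) pos by (intro mult_mono) auto
    finally show "1 / (C + 1) \<le> ratio s u" using C(1) by (simp add: field_simps)
    have "ratio s 0 = 1" by (simp add: ratio_def)
    then have "\<bar>(ratio s u)\<^sup>2 - 1\<bar> \<le> K * \<bar>u\<bar>"
      using K(2)[OF s u, of 0] unfolding of_real_diff[symmetric] norm_of_real by simp
    then show "1 - K * \<bar>u\<bar> \<le> ratio s u" using sq[OF u, of s] by simp
  qed (use C(1) K(1) in auto)
qed

lemma chord_norm_measurable: "(\<lambda>p. norm (\<gamma> (fst p) - \<gamma> (snd p))) \<in> borel_measurable borel"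
  by (intro borel_measurable_continuous_onI continuous_intros continuous_on_compose2[OF continuous_curve[of UNIV]]) auto

lemma chord_cutoff_limit:
  assumes c: "\<bar>c\<bar> = 1"
  shows "\<And>\<epsilon>. 0 < \<epsilon> \<Longrightarrow> \<epsilon> < L / 2 \<Longrightarrow> set_integrable lborel ({0..<L} \<times> {0<..<L/2})
      (\<lambda>p. if \<epsilon> < norm (\<gamma> (fst p) - \<gamma> (fst p + c * snd p)) then 1 / snd p else 0)"
    and "((\<lambda>\<epsilon>. (LINT p:{0..<L} \<times> {0<..<L/2}|lborel.
        if \<epsilon> < norm (\<gamma> (fst p) - \<gamma> (fst p + c * snd p)) then 1 / snd p else 0) + L * ln \<epsilon>)
      \<longlongrightarrow> L * ln (L / 2)) (at_right 0)"
proof -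
  define R where "R p = norm (\<gamma> (fst p) - \<gamma> (fst p + c * snd p))" for p
  obtain c0 K where *: "0 < c0" "0 \<le> K"
    "\<And>s u. s \<in> {0..L} \<Longrightarrow> \<bar>u\<bar> \<le> L / 2 \<Longrightarrow> c0 \<le> ratio s u"
    "\<And>s u. s \<in> {0..L} \<Longrightarrow> \<bar>u\<bar> \<le> L / 2 \<Longrightarrow> 1 - K * \<bar>u\<bar> \<le> ratio s u"
    using ratio_bounds by metis
  have R: "R (s, u) = u * ratio s (c * u)" if "0 < u" for s u
    using norm_chord[of s "c * u"] that c by (simp add: R_def norm_minus_commute abs_mult)
  have m: "R \<in> borel_measurable borel"
    using borel_measurable_shear[OF chord_norm_measurable, of c] by (simp add: R_def[abs_def])
  have cu: "\<bar>c * u\<bar> = u" if "0 < u" for u using c that by (simp add: abs_mult)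
  have 1: "c0 * u \<le> R (s, u)" if "0 \<le> s" "s < L" "0 < u" "u < L / 2" for s u
    using *(3)[of s "c * u"] that cu[of u] by (simp add: R mult.commute mult_left_mono)
  have 2: "R (s, u) \<le> u" if "0 < u" for s u
    using ratio_le_1[of s "c * u"] that by (simp add: R mult_left_le)
  have 3: "u - K * u\<^sup>2 \<le> R (s, u)" if "0 \<le> s" "s < L" "0 < u" "u < L / 2" for s u
  proof -
    have "u * (1 - K * u) \<le> u * ratio s (c * u)"
      using *(4)[of s "c * u"] that cu[of u] by (intro mult_left_mono) auto
    then show ?thesis using that by (simp add: R algebra_simps power2_eq_square)
  qed
  have "0 < L / 2" using L_pos by simp
  note lim = set_integral_cutoff_limit[OF m this L_pos *(1,2) 1 2 3, unfolded R_def]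
  show "\<And>\<epsilon>. 0 < \<epsilon> \<Longrightarrow> \<epsilon> < L / 2 \<Longrightarrow> set_integrable lborel ({0..<L} \<times> {0<..<L/2})
      (\<lambda>p. if \<epsilon> < norm (\<gamma> (fst p) - \<gamma> (fst p + c * snd p)) then 1 / snd p else 0)"
    by (rule lim(1))
  show "((\<lambda>\<epsilon>. (LINT p:{0..<L} \<times> {0<..<L/2}|lborel.
        if \<epsilon> < norm (\<gamma> (fst p) - \<gamma> (fst p + c * snd p)) then 1 / snd p else 0) + L * ln \<epsilon>)
      \<longlongrightarrow> L * ln (L / 2)) (at_right 0)"
    by (rule lim(2))
qed

text \<open>Written as exp (z ln x), with the value 0 at x = 0, the power of a nonnegative real is
  visibly Borel in x.\<close>

lemma chord_powr_measurable:
  "(\<lambda>p. complex_of_real (norm (\<gamma> (fst p) - \<gamma> (snd p))) powr z) \<in> borel_measurable borel"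
proof -
  have "(\<lambda>x::real. if x = 0 then 0 else exp (z * complex_of_real (ln x))) \<in> borel_measurable borel"
    by measurable
  from measurable_compose[OF chord_norm_measurable this]
  show ?thesis
    by (rule measurable_cong[THEN iffD1, rotated]) (auto simp: powr_def Ln_of_real)
qed

end

text \<open>What the limit arguments use of either density: a smooth kernel h with value 1 at u = 0.
  This value makes the leading singularity |u|^z the same for both, hence the same logarithm and the
  same residue.\<close>

locale curve_density = arclength_curve +
  fixes \<rho> :: "real \<times> real \<Rightarrow> real" and h :: "real \<Rightarrow> real \<Rightarrow> complex \<Rightarrow> complex"
  assumes h_kernel: "Ck_kernel L n h"
    and h_0: "h s 0 z = 1"
    and integrand: "u \<noteq> 0 \<Longrightarrow> \<bar>u\<bar> < L \<Longrightarrow> Fint_integrand \<gamma> \<rho> z (s, s + u) = of_real \<bar>u\<bar> powr z * h s u z"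
    and density_measurable: "\<rho> \<in> borel_measurable borel"
    and density_period: "\<rho> (s, t + L) = \<rho> (s, t)"
begin

abbreviation half_rect :: "(real \<times> real) set" where
  "half_rect \<equiv> {0..<L} \<times> {0<..<L/2}"

definition \<kappa> :: "real \<times> real \<Rightarrow> real" where
  "\<kappa> p = \<rho> p / norm (\<gamma> (fst p) - \<gamma> (snd p))"

text \<open>The finite part common to the cut-off limit and to the continuation.\<close>

definition defect :: real where
  "defect = (LINT p:half_rect|lborel. \<kappa> (fst p, fst p + 1 * snd p) - 1 / snd p) +
     (LINT p:half_rect|lborel. \<kappa> (fst p, fst p + (-1) * snd p) - 1 / snd p)"

lemma \<kappa>_measurable: "\<kappa> \<in> borel_measurable borel"
  using borel_measurable_divide[OF density_measurable chord_norm_measurable] by (simp add: \<kappa>_def[abs_def])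

lemma \<kappa>_eq:
  assumes "u \<noteq> 0" "\<bar>u\<bar> < L"
  shows "complex_of_real (\<kappa> (s, s + u)) = h s u (-1) / of_real \<bar>u\<bar>"
proof -
  have inv: "complex_of_real x powr (-1) = inverse (of_real x)" if "x > 0" for x
    using that powr_minus[of "complex_of_real x" 1] by simp
  have "norm (\<gamma> s - \<gamma> (s + u)) > 0" using chord_neq[OF assms, of s] by simp
  then show ?thesis
    using integrand[OF assms, of "-1" s] inv[of "\<bar>u\<bar>"] inv[of "norm (\<gamma> s - \<gamma> (s + u))"] assms
    by (simp add: Fint_integrand_def \<kappa>_def field_simps)
qed

text \<open>At z = -1 the kernel h is 1 + O(u), so subtracting 1 / |u| removes the whole singularity
  and leaves a bounded function.\<close>

lemma \<kappa>_defect_bound: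
  obtains C where "0 \<le> C"
    "\<And>s u. s \<in> {0..L} \<Longrightarrow> u \<noteq> 0 \<Longrightarrow> \<bar>u\<bar> \<le> L / 2 \<Longrightarrow> \<bar>\<kappa> (s, s + u) - 1 / \<bar>u\<bar>\<bar> \<le> C"
proof -
  have a: "L / 2 < L" using L_pos by simp
  obtain C where C: "0 \<le> C" "\<And>s u z. s \<in> {0..L} \<Longrightarrow> \<bar>u\<bar> \<le> L / 2 \<Longrightarrow> z \<in> {-1} \<Longrightarrow>
      norm (h s u z - h s 0 z) \<le> C * \<bar>u\<bar>"
    using Ck_kernel_Lipschitz_at_0[OF h_kernel[of "Suc 0"] _ _ a, of "{0..L}" "{-1}"]
    by (metis compact_Icc compact_sing)
  show ?thesis
  proof (rule that[OF C(1)])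
    fix s u assume su: "s \<in> {0..L}" "u \<noteq> 0" "\<bar>u\<bar> \<le> L / 2"
    have "\<bar>\<kappa> (s, s + u) - 1 / \<bar>u\<bar>\<bar> = norm (complex_of_real (\<kappa> (s, s + u) - 1 / \<bar>u\<bar>))" by (simp only: norm_of_real)
    also have "\<dots> = norm ((h s u (-1) - h s 0 (-1)) / of_real \<bar>u\<bar>)"
      using \<kappa>_eq[of u s] su a by (simp add: h_0 diff_divide_distrib)
    also have "\<dots> \<le> C" using C(2)[of s u "-1"] su by (simp add: norm_divide field_simps)
    finally show "\<bar>\<kappa> (s, s + u) - 1 / \<bar>u\<bar>\<bar> \<le> C" .
  qed
qed

lemma \<kappa>_defect_integrable:
  assumes c: "\<bar>c\<bar> = 1"
  shows "set_integrable lborel half_rect (\<lambda>p. \<kappa> (fst p, fst p + c * snd p) - 1 / snd p)"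
proof -
  obtain C where C: "0 \<le> C"
    "\<And>s u. s \<in> {0..L} \<Longrightarrow> u \<noteq> 0 \<Longrightarrow> \<bar>u\<bar> \<le> L / 2 \<Longrightarrow> \<bar>\<kappa> (s, s + u) - 1 / \<bar>u\<bar>\<bar> \<le> C"
    using \<kappa>_defect_bound by metis
  show ?thesis
  proof (rule set_integrable_rect_powr_bound[where x=0 and C=C])
    have "(\<lambda>p :: real \<times> real. 1 / snd p) \<in> borel_measurable borel"
      unfolding borel_prod[symmetric] by measurable
    with borel_measurable_shear[OF \<kappa>_measurable, of c]
    have "(\<lambda>p. \<kappa> (fst p, fst p + c * snd p) - 1 / snd p) \<in> borel_measurable borel"
      by (rule borel_measurable_diff)
    then show "set_borel_measurable lborel half_rect (\<lambda>p. \<kappa> (fst p, fst p + c * snd p) - 1 / snd p)"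
      by (simp add: set_borel_measurable_def)
    fix s u assume "0 \<le> s" "s < L" "0 < u" "u < L / 2"
    moreover from this have "\<bar>c * u\<bar> = u" "c * u \<noteq> 0" using c by (auto simp: abs_mult)
    ultimately show "norm (\<kappa> (fst (s, u), fst (s, u) + c * snd (s, u)) - 1 / snd (s, u)) \<le> C * u powr 0"
      using C(2)[of s "c * u"] by simp
  qed simp
qed

text \<open>Split \<kappa> into d = \<kappa> - 1 / u and 1 / u. For the integrable d the cut-off
  disappears in the limit by dominated convergence; all of the divergence is in 1 / u, where the
  cut-off by chord length has already been compared with the cut-off in u.\<close>

lemma \<kappa>_cutoff_limit:
  assumes c: "\<bar>c\<bar> = 1"
  defines "f \<equiv> \<lambda>\<epsilon> p. if \<epsilon> < norm (\<gamma> (fst p) - \<gamma> (fst p + c * snd p)) then \<kappa> (fst p, fst p + c * snd p) else 0"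
  shows "\<And>\<epsilon>. 0 < \<epsilon> \<Longrightarrow> \<epsilon> < L / 2 \<Longrightarrow> set_integrable lborel half_rect (f \<epsilon>)"
    and "((\<lambda>\<epsilon>. (LINT p:half_rect|lborel. f \<epsilon> p) + L * ln \<epsilon>) \<longlongrightarrow>
      (LINT p:half_rect|lborel. \<kappa> (fst p, fst p + c * snd p) - 1 / snd p) + L * ln (L / 2)) (at_right 0)"
proof -
  define R where "R p = norm (\<gamma> (fst p) - \<gamma> (fst p + c * snd p))" for p
  define d where "d p = \<kappa> (fst p, fst p + c * snd p) - 1 / snd p" for p
  have mR: "R \<in> borel_measurable borel"
    using borel_measurable_shear[OF chord_norm_measurable, of c] by (simp add: R_def[abs_def])
  have id: "set_integrable lborel half_rect d"
    unfolding d_def by (rule \<kappa>_defect_integrable[OF c])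
  have md: "(\<lambda>p. indicat_real half_rect p *\<^sub>R (if \<epsilon> < R p then d p else 0)) \<in> borel_measurable lborel" for \<epsilon>
  proof -
    have *: "(\<lambda>p. indicat_real half_rect p *\<^sub>R d p) \<in> borel_measurable borel"
      using id by (auto simp: set_integrable_def)
    have "{p. \<epsilon> < R p} \<in> sets borel" using mR by measurable
    from borel_measurable_scaleR[OF borel_measurable_indicator[OF this] *]
    have "(\<lambda>p. indicat_real {p. \<epsilon> < R p} p *\<^sub>R (indicat_real half_rect p *\<^sub>R d p)) \<in> borel_measurable borel" .
    moreover have "(\<lambda>p. indicat_real {p. \<epsilon> < R p} p *\<^sub>R (indicat_real half_rect p *\<^sub>R d p)) =
       (\<lambda>p. indicat_real half_rect p *\<^sub>R (if \<epsilon> < R p then d p else 0))"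
      by (auto split: split_indicator)
    ultimately show ?thesis by simp
  qed
  have i1: "set_integrable lborel half_rect (\<lambda>p. if \<epsilon> < R p then d p else 0)" for \<epsilon>
    by (rule set_integrable_bound[OF id]) (use md in \<open>auto simp: set_borel_measurable_def\<close>)
  have i2: "set_integrable lborel half_rect (\<lambda>p. if \<epsilon> < R p then 1 / snd p else 0)" if "0 < \<epsilon>" "\<epsilon> < L / 2" for \<epsilon>
    unfolding R_def by (rule chord_cutoff_limit(1)[OF c that])
  have f: "f \<epsilon> = (\<lambda>p. (if \<epsilon> < R p then d p else 0) + (if \<epsilon> < R p then 1 / snd p else 0))" for \<epsilon>
    by (auto simp: f_def R_def d_def)
  show "set_integrable lborel half_rect (f \<epsilon>)" if "0 < \<epsilon>" "\<epsilon> < L / 2" for \<epsilon>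
    unfolding f by (rule set_integral_add(1)[OF i1 i2[OF that]])
  have l1: "((\<lambda>\<epsilon>. LINT p:half_rect|lborel. if \<epsilon> < R p then d p else 0) \<longlongrightarrow> (LINT p:half_rect|lborel. d p)) (at_right 0)"
    unfolding tendsto_at_iff_sequentially comp_def set_lebesgue_integral_def
  proof (intro allI impI)
    fix X :: "nat \<Rightarrow> real" assume X: "\<forall>i. X i \<in> {0<..} - {0}" "X \<longlonglongrightarrow> 0"
    show "(\<lambda>n. LINT p|lborel. indicat_real half_rect p *\<^sub>R (if X n < R p then d p else 0)) \<longlonglongrightarrow>
        (LINT p|lborel. indicat_real half_rect p *\<^sub>R d p)"
    proof (rule integral_dominated_convergence[where w="\<lambda>p. norm (indicat_real half_rect p *\<^sub>R d p)"])
      show "integrable lborel (\<lambda>p. norm (indicat_real half_rect p *\<^sub>R d p))"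
        using id by (intro integrable_norm) (simp add: set_integrable_def)
      show "(\<lambda>p. indicat_real half_rect p *\<^sub>R d p) \<in> borel_measurable lborel"
        using id unfolding set_integrable_def by (rule borel_measurable_integrable)
      show "AE p in lborel. (\<lambda>n. indicat_real half_rect p *\<^sub>R (if X n < R p then d p else 0)) \<longlonglongrightarrow> indicat_real half_rect p *\<^sub>R d p"
      proof (rule AE_I2)
        fix p
        show "(\<lambda>n. indicat_real half_rect p *\<^sub>R (if X n < R p then d p else 0)) \<longlonglongrightarrow> indicat_real half_rect p *\<^sub>R d p"
        proof (cases "p \<in> half_rect")
          case True
          then have "c * snd p \<noteq> 0" "\<bar>c * snd p\<bar> < L" using c by (auto simp: abs_mult)
          \<comment> \<open>The curve is simple, so the chord at p is positive and the cut-off is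
            eventually inactive there.\<close>
          then have "R p > 0" using chord_neq[of "c * snd p" "fst p"] by (auto simp: R_def)
          then have "eventually (\<lambda>n. X n < R p) sequentially"
            using X(2) by (rule order_tendstoD(2)[rotated])
          then have "eventually (\<lambda>n. indicat_real half_rect p *\<^sub>R (if X n < R p then d p else 0) = indicat_real half_rect p *\<^sub>R d p) sequentially"
            by eventually_elim simp
          then show ?thesis by (rule tendsto_eventually)
        qed simp
      qed
    qed (use md in \<open>auto split: split_indicator\<close>)
  qed
  have l2: "((\<lambda>\<epsilon>. (LINT p:half_rect|lborel. if \<epsilon> < R p then 1 / snd p else 0) + L * ln \<epsilon>) \<longlongrightarrow> L * ln (L / 2)) (at_right 0)"
    unfolding R_def by (rule chord_cutoff_limit(2)[OF c])
  have "eventually (\<lambda>\<epsilon>. (LINT p:half_rect|lborel. if \<epsilon> < R p then d p else 0) +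
      ((LINT p:half_rect|lborel. if \<epsilon> < R p then 1 / snd p else 0) + L * ln \<epsilon>) =
      (LINT p:half_rect|lborel. f \<epsilon> p) + L * ln \<epsilon>) (at_right 0)"
  proof -
    have "0 < L / 2" using L_pos by simp
    from eventually_at_right_real[OF this] show ?thesis
    proof eventually_elim
      case (elim \<epsilon>)
      then have e: "0 < \<epsilon>" "\<epsilon> < L / 2" by auto
      show ?case unfolding f set_integral_add(2)[OF i1 i2[OF e]] by simp
    qed
  qed
  from Lim_transform_eventually[OF tendsto_add[OF l1 l2] this]
  show "((\<lambda>\<epsilon>. (LINT p:half_rect|lborel. f \<epsilon> p) + L * ln \<epsilon>) \<longlongrightarrow>
      (LINT p:half_rect|lborel. \<kappa> (fst p, fst p + c * snd p) - 1 / snd p) + L * ln (L / 2)) (at_right 0)"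
    by (simp add: d_def)
qed

text \<open>Each sign of the offset needs its own L ln \<epsilon>; the factor mu0 / (4 pi) turns
  their sum 2 L ln \<epsilon> into the prescribed counterterm.\<close>

lemma Hreg_limit:
  "(Hreg mu0 \<gamma> L \<rho> \<longlongrightarrow> mu0 / (4 * pi) * (defect + 2 * L * ln (L / 2))) (at_right 0)"
proof -
  define f where "f \<epsilon> p = (if \<epsilon> < norm (\<gamma> (fst p) - \<gamma> (snd p)) then \<kappa> p else 0)" for \<epsilon> p
  have m: "f \<epsilon> \<in> borel_measurable borel" for \<epsilon>
  proof -
    have [measurable]: "(\<lambda>p. norm (\<gamma> (fst p) - \<gamma> (snd p))) \<in> borel_measurable borel" "\<kappa> \<in> borel_measurable borel"
      using chord_norm_measurable \<kappa>_measurable by auto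
    show ?thesis unfolding f_def[abs_def] by measurable
  qed
  \<comment> \<open>The folding lemma with a = L / 2 expects the period in the form
    \<open>2 * (L / 2)\<close>.\<close>
  have per: "f \<epsilon> (s, t + 2 * (L / 2)) = f \<epsilon> (s, t)" for \<epsilon> s t
    by (simp add: f_def \<kappa>_def period density_period)
  define g where "g c \<epsilon> p = f \<epsilon> (fst p, fst p + c * snd p)" for c \<epsilon> p
  have gi: "set_integrable lborel half_rect (g c \<epsilon>)" if "\<bar>c\<bar> = 1" "0 < \<epsilon>" "\<epsilon> < L / 2" for c \<epsilon>
    using \<kappa>_cutoff_limit(1)[OF that] unfolding g_def f_def fst_conv snd_conv .
  have gl: "((\<lambda>\<epsilon>. (LINT p:half_rect|lborel. g c \<epsilon> p) + L * ln \<epsilon>) \<longlongrightarrow>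
      (LINT p:half_rect|lborel. \<kappa> (fst p, fst p + c * snd p) - 1 / snd p) + L * ln (L / 2)) (at_right 0)"
    if "\<bar>c\<bar> = 1" for c
    using \<kappa>_cutoff_limit(2)[OF that] unfolding g_def f_def fst_conv snd_conv .
  have g1: "f \<epsilon> (fst p, fst p + snd p) = g 1 \<epsilon> p" "f \<epsilon> (fst p, fst p - snd p) = g (-1) \<epsilon> p" for \<epsilon> p
    by (simp_all add: g_def)
  have eq: "(LINT p:D_eps \<gamma> L \<epsilon>|lborel. \<rho> p / norm (\<gamma> (fst p) - \<gamma> (snd p))) =
      (LINT p:half_rect|lborel. g 1 \<epsilon> p) + (LINT p:half_rect|lborel. g (-1) \<epsilon> p)"
    if "0 < \<epsilon>" "\<epsilon> < L / 2" for \<epsilon>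
  proof -
    have "(LINT p:D_eps \<gamma> L \<epsilon>|lborel. \<rho> p / norm (\<gamma> (fst p) - \<gamma> (snd p))) = (LINT p:torus_dom L|lborel. f \<epsilon> p)"
      unfolding set_lebesgue_integral_def
      by (intro Bochner_Integration.integral_cong) (auto simp: D_eps_def f_def \<kappa>_def split: split_indicator)
    also have "\<dots> = (LINT p:half_rect|lborel. g 1 \<epsilon> p) + (LINT p:half_rect|lborel. g (-1) \<epsilon> p)"
      using set_integral_torus_shift_real[OF m per, of \<epsilon>] gi[of 1, OF _ that] gi[of "-1", OF _ that]
      by (simp add: torus_dom_def g1)
    finally show ?thesis .
  qed
  have "((\<lambda>\<epsilon>. ((LINT p:half_rect|lborel. g 1 \<epsilon> p) + L * ln \<epsilon>) +
      ((LINT p:half_rect|lborel. g (-1) \<epsilon> p) + L * ln \<epsilon>)) \<longlongrightarrow>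
      ((LINT p:half_rect|lborel. \<kappa> (fst p, fst p + 1 * snd p) - 1 / snd p) + L * ln (L / 2)) +
      ((LINT p:half_rect|lborel. \<kappa> (fst p, fst p + (-1) * snd p) - 1 / snd p) + L * ln (L / 2))) (at_right 0)"
    by (intro tendsto_add[OF gl gl]) auto
  then have "((\<lambda>\<epsilon>. mu0 / (4 * pi) * (((LINT p:half_rect|lborel. g 1 \<epsilon> p) + L * ln \<epsilon>) +
      ((LINT p:half_rect|lborel. g (-1) \<epsilon> p) + L * ln \<epsilon>))) \<longlongrightarrow>
      mu0 / (4 * pi) * (((LINT p:half_rect|lborel. \<kappa> (fst p, fst p + 1 * snd p) - 1 / snd p) + L * ln (L / 2)) +
      ((LINT p:half_rect|lborel. \<kappa> (fst p, fst p + (-1) * snd p) - 1 / snd p) + L * ln (L / 2)))) (at_right 0)"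
    by (rule tendsto_mult_left)
  moreover have "eventually (\<lambda>\<epsilon>. mu0 / (4 * pi) * (((LINT p:half_rect|lborel. g 1 \<epsilon> p) + L * ln \<epsilon>) +
      ((LINT p:half_rect|lborel. g (-1) \<epsilon> p) + L * ln \<epsilon>)) = Hreg mu0 \<gamma> L \<rho> \<epsilon>) (at_right 0)"
  proof -
    have "0 < L / 2" using L_pos by simp
    from eventually_at_right_real[OF this] show ?thesis
    proof eventually_elim
      case (elim \<epsilon>)
      then have e: "0 < \<epsilon>" "\<epsilon> < L / 2" by auto
      show ?case unfolding Hreg_def eq[OF e] by (simp add: field_simps)
    qed
  qed
  ultimately have "(Hreg mu0 \<gamma> L \<rho> \<longlongrightarrow> mu0 / (4 * pi) * (((LINT p:half_rect|lborel. \<kappa> (fst p, fst p + 1 * snd p) - 1 / snd p) + L * ln (L / 2)) +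
      ((LINT p:half_rect|lborel. \<kappa> (fst p, fst p + (-1) * snd p) - 1 / snd p) + L * ln (L / 2)))) (at_right 0)"
    by (rule Lim_transform_eventually)
  then show ?thesis by (simp add: defect_def algebra_simps)
qed

definition even_part :: "real \<Rightarrow> real \<Rightarrow> complex \<Rightarrow> complex" where
  "even_part s u z = h s u z + h s (- u) z"

lemma even_part_kernel: "Ck_kernel L n even_part"
  using Ck_kernel_add[OF h_kernel Ck_kernel_reflect[OF h_kernel], of n] by (simp add: even_part_def[abs_def])

text \<open>Folding the torus brings in the offsets u and -u with the same weight u^z, so only the
  sum of the two values of h is left. Integrability follows from that of u^(Re z) near 0.\<close>

lemma Fint_integrand_integral:
  assumes z: "Re z > -1"
  shows "set_integrable lborel (torus_dom L) (Fint_integrand \<gamma> \<rho> z)"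
    and "(LINT p:torus_dom L|lborel. Fint_integrand \<gamma> \<rho> z p) =
      (LINT p:half_rect|lborel. of_real (snd p) powr z * even_part (fst p) (snd p) z)"
proof -
  define F where "F = Fint_integrand \<gamma> \<rho> z"
  have m: "F \<in> borel_measurable borel"
    unfolding F_def Fint_integrand_def[abs_def]
    by (intro borel_measurable_times chord_powr_measurable measurable_compose[OF density_measurable]
        borel_measurable_continuous_onI continuous_intros)
  have per: "F (s, t + 2 * (L / 2)) = F (s, t)" for s t
    by (simp add: F_def Fint_integrand_def period density_period)
  have a: "L / 2 < L" using L_pos by simp
  have F1: "F (fst p, fst p + snd p) = of_real (snd p) powr z * h (fst p) (snd p) z" if "p \<in> half_rect" for p
    using integrand[of "snd p" z "fst p"] that by (auto simp: F_def)
  have F2: "F (fst p, fst p - snd p) = of_real (snd p) powr z * h (fst p) (- snd p) z" if "p \<in> half_rect" for p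
    using integrand[of "- snd p" z "fst p"] that by (auto simp: F_def)
  have r: "regular_kernel L h" "regular_kernel L (\<lambda>s u z. h s (- u) z)"
    using Ck_kernel_regular[OF h_kernel[of 0]] by (auto intro: regular_kernel_reflect)
  have j: "set_integrable lborel half_rect (\<lambda>p. of_real (snd p) powr z * h (fst p) (snd p) z)"
    "set_integrable lborel half_rect (\<lambda>p. of_real (snd p) powr z * h (fst p) (- snd p) z)"
    using set_integrable_powr_kernel[OF r(1) a z] set_integrable_powr_kernel[OF r(2) a z] by auto
  have i: "set_integrable lborel half_rect (\<lambda>p. F (fst p, fst p + snd p))"
    "set_integrable lborel half_rect (\<lambda>p. F (fst p, fst p - snd p))"
    using j F1 F2 by (auto cong: set_integrable_cong)
  show "set_integrable lborel (torus_dom L) (Fint_integrand \<gamma> \<rho> z)"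
    using set_integrable_torus_shift[OF m per] i by (simp add: torus_dom_def F_def)
  have "(LINT p:torus_dom L|lborel. F p) = (LINT p:half_rect|lborel. F (fst p, fst p + snd p)) + (LINT p:half_rect|lborel. F (fst p, fst p - snd p))"
    using set_integral_torus_shift_complex[OF m per] i by (simp add: torus_dom_def)
  also have "\<dots> = (LINT p:half_rect|lborel. of_real (snd p) powr z * h (fst p) (snd p) z) +
      (LINT p:half_rect|lborel. of_real (snd p) powr z * h (fst p) (- snd p) z)"
    using F1 F2 by (intro arg_cong2[where f="(+)"] set_lebesgue_integral_cong) auto
  also have "\<dots> = (LINT p:half_rect|lborel. of_real (snd p) powr z * even_part (fst p) (snd p) z)"
    unfolding even_part_def distrib_left by (rule set_integral_add(2)[OF j, symmetric])
  finally show "(LINT p:torus_dom L|lborel. Fint_integrand \<gamma> \<rho> z p) =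
      (LINT p:half_rect|lborel. of_real (snd p) powr z * even_part (fst p) (snd p) z)"
    unfolding F_def .
qed

lemma Fint_holomorphic: "Fint mu0 \<gamma> L \<rho> holomorphic_on {z. Re z > -1}"
proof -
  have a: "L / 2 < L" using L_pos by simp
  have "(\<lambda>z. of_real (mu0 / (4 * pi)) * (LINT p:half_rect|lborel. of_real (snd p) powr (z + of_nat 0) * even_part (fst p) (snd p) z))
      holomorphic_on {z. Re z > -1}"
    using holomorphic_powr_kernel_integral[OF Ck_kernel_regular[OF even_part_kernel[of 0]] a, of L 0]
    by (intro holomorphic_intros) simp
  then show ?thesis
    by (rule holomorphic_transform) (simp add: Fint_def Fint_integrand_integral)
qed

text \<open>At z = -1 the even part divided by u is \<kappa>(s, s + u) + \<kappa>(s, s - u). The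
  complex finite part is therefore the real number \<open>defect\<close> that also governs
  \<open>Hreg\<close>, and the two limits coincide.\<close>

lemma Fint_good_continuation:
  "\<exists>G. good_continuation (Fint mu0 \<gamma> L \<rho>) G (of_real (mu0 * L / (2 * pi)))
     (of_real (mu0 / (4 * pi) * (defect + 2 * L * ln (L / 2))))"
proof -
  have a: "0 < L / 2" "L / 2 < L" using L_pos by auto
  have "of_real defect = (LINT p:half_rect|lborel. (even_part (fst p) (snd p) (-1) - 2) / of_real (snd p))"
  proof -
    have "defect = (LINT p:half_rect|lborel. (\<kappa> (fst p, fst p + 1 * snd p) - 1 / snd p) + (\<kappa> (fst p, fst p + (-1) * snd p) - 1 / snd p))"
      unfolding defect_def by (rule set_integral_add(2)[symmetric]; rule \<kappa>_defect_integrable) auto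
    then have "complex_of_real defect = (LINT p:half_rect|lborel.
        complex_of_real ((\<kappa> (fst p, fst p + 1 * snd p) - 1 / snd p) + (\<kappa> (fst p, fst p + (-1) * snd p) - 1 / snd p)))"
      by (simp only: set_integral_complex_of_real)
    also have "\<dots> = (LINT p:half_rect|lborel. (even_part (fst p) (snd p) (-1) - 2) / of_real (snd p))"
    proof (rule set_lebesgue_integral_cong)
      show "\<forall>p. p \<in> half_rect \<longrightarrow> complex_of_real ((\<kappa> (fst p, fst p + 1 * snd p) - 1 / snd p) + (\<kappa> (fst p, fst p + (-1) * snd p) - 1 / snd p)) =
          (even_part (fst p) (snd p) (-1) - 2) / of_real (snd p)"
      proof (intro allI impI)
        fix p assume p: "p \<in> half_rect"
        then show "complex_of_real ((\<kappa> (fst p, fst p + 1 * snd p) - 1 / snd p) + (\<kappa> (fst p, fst p + (-1) * snd p) - 1 / snd p)) =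
          (even_part (fst p) (snd p) (-1) - 2) / of_real (snd p)"
          using \<kappa>_eq[of "snd p" "fst p"] \<kappa>_eq[of "- snd p" "fst p"] by (auto simp: even_part_def field_simps)
      qed
    qed simp
    finally show ?thesis .
  qed
  moreover have "\<exists>G. good_continuation (Fint mu0 \<gamma> L \<rho>) G (of_real (mu0 / (4 * pi) * (2 * L)))
    (of_real (mu0 / (4 * pi)) * ((LINT p:half_rect|lborel. (even_part (fst p) (snd p) (-1) - 2) / of_real (snd p)) +
        of_real (2 * L * ln (L / 2))))"
  proof (rule even_kernel_good_continuation[OF even_part_kernel _ _ a L_pos])
    show "Fint mu0 \<gamma> L \<rho> z = of_real (mu0 / (4 * pi)) *
      (LINT p:half_rect|lborel. of_real (snd p) powr z * even_part (fst p) (snd p) z)" if "Re z > -1" for z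
      by (simp add: Fint_def Fint_integrand_integral[OF that])
  qed (auto simp: even_part_def h_0)
  ultimately show ?thesis by (simp add: field_simps)
qed

end

section \<open>Comparison of the Neumann and Weber densities\<close>

context arclength_curve
begin

lemma curve_density_N: "curve_density \<gamma> L (rhoN \<gamma>) hN"
proof
  have "(\<lambda>p. tangent (fst p) \<bullet> tangent (snd p)) \<in> borel_measurable borel"
    by (intro borel_measurable_continuous_onI continuous_intros continuous_on_compose2[OF continuous_tangent[of UNIV]]) auto
  then show "rhoN \<gamma> \<in> borel_measurable borel"
    by (simp add: rhoN_def[abs_def] tangent_def[symmetric])
qed (simp_all add: hN_kernel hN_0 Fint_integrand_N rhoN_eq tangent_period)

lemma curve_density_W: "curve_density \<gamma> L (rhoW \<gamma>) hW"
proof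
  have c: "continuous_on UNIV (\<lambda>p. \<gamma> (snd p) - \<gamma> (fst p))" "continuous_on UNIV (\<lambda>p. tangent (fst p))" "continuous_on UNIV (\<lambda>p. tangent (snd p))"
    by (intro continuous_intros continuous_on_compose2[OF continuous_tangent[of UNIV]]
        continuous_on_compose2[OF continuous_curve[of UNIV]]; simp)+
  have "(\<lambda>p. ((\<gamma> (snd p) - \<gamma> (fst p)) \<bullet> tangent (fst p)) * ((\<gamma> (snd p) - \<gamma> (fst p)) \<bullet> tangent (snd p)) /
      (norm (\<gamma> (snd p) - \<gamma> (fst p)))\<^sup>2) \<in> borel_measurable borel"
    by (intro borel_measurable_divide borel_measurable_continuous_onI continuous_intros c)
  moreover have "rhoW \<gamma> = (\<lambda>p. ((\<gamma> (snd p) - \<gamma> (fst p)) \<bullet> tangent (fst p)) * ((\<gamma> (snd p) - \<gamma> (fst p)) \<bullet> tangent (snd p)) /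
      (norm (\<gamma> (snd p) - \<gamma> (fst p)))\<^sup>2)"
    by (auto simp: rhoW_eq)
  ultimately show "rhoW \<gamma> \<in> borel_measurable borel" by simp
qed (simp_all add: hW_kernel hW_0 Fint_integrand_W rhoW_eq tangent_period period)

sublocale N: curve_density \<gamma> L "rhoN \<gamma>" hN by (rule curve_density_N)
sublocale W: curve_density \<gamma> L "rhoW \<gamma>" hW by (rule curve_density_W)

definition chord_cos :: "real \<Rightarrow> real \<Rightarrow> real" where
  "chord_cos s v = ((\<gamma> (s + v) - \<gamma> s) \<bullet> tangent s) / norm (\<gamma> (s + v) - \<gamma> s)"

text \<open>Along the second endpoint, the difference of the Neumann and Weber integrands is exact.\<close>

lemma chord_cos_derivative:
  assumes "v \<noteq> 0" "\<bar>v\<bar> < L"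
  shows "(chord_cos s has_real_derivative (N.\<kappa> (s, s + v) - W.\<kappa> (s, s + v))) (at v)"
proof -
  define r where "r v = \<gamma> (s + v) - \<gamma> s" for v
  define \<tau> where "\<tau> = tangent (s + v)"
  have "((\<lambda>v. s + v) has_vector_derivative 1) (at v)"
    by (auto intro!: derivative_eq_intros)
  from vector_diff_chain_at[OF this has_tangent]
  have "((\<lambda>v. \<gamma> (s + v)) has_vector_derivative \<tau>) (at v)" by (simp add: o_def \<tau>_def)
  then have r: "(r has_vector_derivative \<tau>) (at v)"
    unfolding r_def using has_vector_derivative_diff[OF _ has_vector_derivative_const] by fastforce
  have r': "(r has_derivative (\<lambda>h. h *\<^sub>R \<tau>)) (at v)"
    using r by (simp add: has_vector_derivative_def)
  have n: "norm (r v) > 0" using chord_neq[OF assms, of s] by (simp add: r_def)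
  have d1: "((\<lambda>v. r v \<bullet> tangent s) has_real_derivative (\<tau> \<bullet> tangent s)) (at v)"
    unfolding has_field_derivative_def
    by (rule has_derivative_eq_rhs[OF has_derivative_inner_left[OF r']]) (auto simp: mult.commute)
  have "((\<lambda>v. r v \<bullet> r v) has_real_derivative (2 * (r v \<bullet> \<tau>))) (at v)"
    unfolding has_field_derivative_def
    by (rule has_derivative_eq_rhs[OF has_derivative_inner[OF r' r']]) (auto simp: inner_commute)
  from DERIV_chain2[OF DERIV_real_sqrt this] n
  have d2: "((\<lambda>v. norm (r v)) has_real_derivative ((r v \<bullet> \<tau>) / norm (r v))) (at v)"
    by (simp add: norm_eq_sqrt_inner field_simps)
  have "((\<lambda>v. (r v \<bullet> tangent s) / norm (r v)) has_real_derivative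
      ((\<tau> \<bullet> tangent s) * norm (r v) - (r v \<bullet> tangent s) * ((r v \<bullet> \<tau>) / norm (r v))) / (norm (r v) * norm (r v))) (at v)"
    using n by (intro DERIV_divide d1 d2) auto
  moreover have "((\<tau> \<bullet> tangent s) * norm (r v) - (r v \<bullet> tangent s) * ((r v \<bullet> \<tau>) / norm (r v))) / (norm (r v) * norm (r v)) =
      N.\<kappa> (s, s + v) - W.\<kappa> (s, s + v)"
    using n unfolding N.\<kappa>_def W.\<kappa>_def rhoN_eq rhoW_eq fst_conv snd_conv
      norm_minus_commute[of "\<gamma> s"] r_def[symmetric] \<tau>_def[symmetric]
    by (simp add: field_simps power2_eq_square inner_commute)
  ultimately show ?thesis
    unfolding chord_cos_def[abs_def] r_def by simp
qed

text \<open>The chord cosine times the sign of u, written with the smooth kernels: it is continuous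
  across u = 0 with value 1, so the jump of the cosine is traded for a sign.\<close>

definition cos_kernel :: "real \<Rightarrow> real \<Rightarrow> complex \<Rightarrow> complex" where
  "cos_kernel s u z = ratio_powr s u (-1) * (\<Sum>i\<in>UNIV. chord i s u z * of_real (tangent s $ i))"

lemma cos_kernel_continuous: "continuous_on {-L<..<L} (\<lambda>u. cos_kernel s u z)"
  unfolding cos_kernel_def
  by (intro continuous_intros regular_kernel_continuous_on[OF Ck_kernel_regular[OF ratio_powr_kernel[of 0]]]
      regular_kernel_continuous_on[OF Ck_kernel_regular[OF chord_kernel[of L 0]]]) auto

lemma cos_kernel_0: "cos_kernel s 0 z = 1"
  by (simp add: cos_kernel_def ratio_powr_0 chord_0 tangent_inner_self)

lemma cos_kernel_eq:
  assumes "u \<noteq> 0" "\<bar>u\<bar> < L"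
  shows "cos_kernel s u z = of_real (sgn u * chord_cos s u)"
proof -
  define S where "S = (\<Sum>i\<in>UNIV. chord i s u z * of_real (tangent s $ i))"
  have pos: "ratio s u > 0" using ratio_pos[OF assms(2)] .
  have "ratio_powr s u (-1) = inverse (of_real (ratio s u))"
    using ratio_powr_eq[OF assms(2), of s "-1"] powr_minus[of "complex_of_real (ratio s u)" 1] pos by simp
  moreover have "complex_of_real (sgn u * chord_cos s u) = of_real (sgn u) * (of_real u * S) / (of_real \<bar>u\<bar> * of_real (ratio s u))"
    unfolding chord_cos_def norm_chord S_def chord_inner by simp
  moreover have "of_real (sgn u) * (of_real u * S) = of_real \<bar>u\<bar> * S"
    by (simp add: abs_if sgn_if)
  ultimately show ?thesis
    using assms by (simp add: cos_kernel_def S_def[symmetric] divide_inverse)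
qed

text \<open>The primitive \<Phi> is the chord cosine at -u minus that at u, extended continuously by
  -2 at u = 0. At u = L / 2 both offsets lead to the same point of the curve, so \<Phi> vanishes
  there and its increment is 2.\<close>

lemma integral_defect_difference:
  "(LINT u:{0<..<L/2}|lborel. (W.\<kappa> (s, s + u) - N.\<kappa> (s, s + u)) + (W.\<kappa> (s, s - u) - N.\<kappa> (s, s - u))) = 2"
  if s: "s \<in> {0..<L}"
proof -
  define f where "f u = (W.\<kappa> (s, s + u) - N.\<kappa> (s, s + u)) + (W.\<kappa> (s, s - u) - N.\<kappa> (s, s - u))" for u
  define \<Phi> where "\<Phi> u = - (cos_kernel s u 0 + cos_kernel s (- u) 0)" for u
  have a: "0 < L / 2" using L_pos by simp
  have "continuous_on {0..L/2} (\<lambda>u. cos_kernel s u 0)" "continuous_on {0..L/2} (\<lambda>u. cos_kernel s (- u) 0)"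
    using L_pos by (auto intro!: continuous_on_compose2[OF cos_kernel_continuous] continuous_intros)
  then have cont: "continuous_on {0..L/2} \<Phi>"
    unfolding \<Phi>_def by (intro continuous_intros)
  have eq: "\<Phi> u = of_real (chord_cos s (- u) - chord_cos s u)" if "0 < u" "u < L" for u
    using cos_kernel_eq[of u s 0] cos_kernel_eq[of "- u" s 0] that by (simp add: \<Phi>_def)
  have der: "(\<Phi> has_vector_derivative of_real (f u)) (at u)" if u: "u \<in> {0<..<L/2}" for u
  proof -
    have 1: "(chord_cos s has_real_derivative (N.\<kappa> (s, s + u) - W.\<kappa> (s, s + u))) (at u)"
      using u by (intro chord_cos_derivative) auto
    have "(chord_cos s has_real_derivative (N.\<kappa> (s, s + - u) - W.\<kappa> (s, s + - u))) (at (- u))"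
      using u by (intro chord_cos_derivative) auto
    then have 2: "((\<lambda>v. chord_cos s (- v)) has_real_derivative - (N.\<kappa> (s, s + - u) - W.\<kappa> (s, s + - u))) (at u)"
      by (simp add: DERIV_mirror)
    have "((\<lambda>v. chord_cos s (- v) - chord_cos s v) has_real_derivative f u) (at u)"
      using DERIV_diff[OF 2 1] by (simp add: f_def algebra_simps)
    then have "((\<lambda>v. chord_cos s (- v) - chord_cos s v) has_vector_derivative f u) (at u)"
      by (simp add: has_real_derivative_iff_has_vector_derivative)
    then have "((\<lambda>v. complex_of_real (chord_cos s (- v) - chord_cos s v)) has_vector_derivative of_real (f u)) (at u)"
      by (rule bounded_linear.has_vector_derivative[OF bounded_linear_of_real])
    then show ?thesis
      by (rule has_vector_derivative_transform_within_open[of _ _ _ "{0<..<L}"]) (use u in \<open>auto simp: eq\<close>)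
  qed
  have "chord_cos s (- (L / 2)) = chord_cos s (L / 2)"
    using period[of "s - L / 2"] by (simp add: chord_cos_def add.commute[of _ s])
  then have "\<Phi> (L / 2) - \<Phi> 0 = 2"
    using eq[of "L / 2"] L_pos by (simp add: \<Phi>_def[of 0] cos_kernel_0)
  then have "((\<lambda>u. complex_of_real (f u)) has_integral 2) {0..L/2}"
    using fundamental_theorem_of_calculus_interior[OF less_imp_le[OF a] cont der] by simp
  from has_integral_linear[OF this bounded_linear_Re]
  have hi: "(f has_integral 2) {0..L/2}" by (simp add: o_def)
  obtain CN where CN: "\<And>s u. s \<in> {0..L} \<Longrightarrow> u \<noteq> 0 \<Longrightarrow> \<bar>u\<bar> \<le> L / 2 \<Longrightarrow> \<bar>N.\<kappa> (s, s + u) - 1 / \<bar>u\<bar>\<bar> \<le> CN"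
    using N.\<kappa>_defect_bound by metis
  obtain CW where CW: "\<And>s u. s \<in> {0..L} \<Longrightarrow> u \<noteq> 0 \<Longrightarrow> \<bar>u\<bar> \<le> L / 2 \<Longrightarrow> \<bar>W.\<kappa> (s, s + u) - 1 / \<bar>u\<bar>\<bar> \<le> CW"
    using W.\<kappa>_defect_bound by metis
  \<comment> \<open>The terms 1 / u cancel between the two densities, so f is bounded, and the gauge
    integral just computed is also its Lebesgue integral.\<close>
  have "set_integrable lborel {0<..<L/2} f"
  proof (rule set_integrable_bound[where f="\<lambda>u. 2 * (CN + CW) * u powr 0"])
    show "set_integrable lborel {0<..<L/2} (\<lambda>u. 2 * (CN + CW) * u powr 0)"
      by (intro set_integrable_mult_right set_integrable_powr_Ioo) simp
    have m: "(\<lambda>u. k (s, s + c * u)) \<in> borel_measurable borel" if "k \<in> borel_measurable borel" for k :: "real \<times> real \<Rightarrow> real" and c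
      by (rule measurable_compose[OF borel_measurable_continuous_onI that]) (intro continuous_intros)
    have "f \<in> borel_measurable borel"
      using m[OF N.\<kappa>_measurable, of 1] m[OF W.\<kappa>_measurable, of 1] m[OF N.\<kappa>_measurable, of "-1"] m[OF W.\<kappa>_measurable, of "-1"]
      unfolding f_def by simp
    then show "set_borel_measurable lborel {0<..<L/2} f" by (simp add: set_borel_measurable_def)
    have "\<bar>f u\<bar> \<le> 2 * (CN + CW)" if "0 < u" "u < L / 2" for u
      using CN[of s u] CW[of s u] CN[of s "-u"] CW[of s "-u"] s that by (simp add: f_def)
    then show "AE u in lborel. u \<in> {0<..<L/2} \<longrightarrow> norm (f u) \<le> norm (2 * (CN + CW) * u powr 0)"
      by (intro AE_I2) (force intro: order_trans[OF _ abs_ge_self])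
  qed
  then have "(LINT u:{0<..<L/2}|lborel. f u) = integral {0<..<L/2} f"
    by (rule set_borel_integral_eq_integral)
  also have "\<dots> = 2"
    using integral_unique[OF hi] by (simp add: integral_open_interval_real)
  finally show ?thesis by (simp add: f_def)
qed

text \<open>The subtracted 1 / u is common to both defects. What remains is the difference of the
  two \<kappa>, whose integral over u is 2 for every s.\<close>

lemma defect_difference: "W.defect - N.defect = 2 * L"
proof -
  note iN = N.\<kappa>_defect_integrable and iW = W.\<kappa>_defect_integrable
  define d where "d c p = W.\<kappa> (fst p, fst p + c * snd p) - N.\<kappa> (fst p, fst p + c * snd p)" for c p
  have d: "d c = (\<lambda>p. (W.\<kappa> (fst p, fst p + c * snd p) - 1 / snd p) - (N.\<kappa> (fst p, fst p + c * snd p) - 1 / snd p))" for c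
    by (auto simp: d_def)
  have i: "set_integrable lborel ({0..<L} \<times> {0<..<L/2}) (d c)" if "\<bar>c\<bar> = 1" for c
    unfolding d by (rule set_integral_diff(1)[OF iW[OF that] iN[OF that]])
  have eq: "(LINT p:{0..<L} \<times> {0<..<L/2}|lborel. d c p) =
      (LINT p:{0..<L} \<times> {0<..<L/2}|lborel. W.\<kappa> (fst p, fst p + c * snd p) - 1 / snd p) -
      (LINT p:{0..<L} \<times> {0<..<L/2}|lborel. N.\<kappa> (fst p, fst p + c * snd p) - 1 / snd p)" if "\<bar>c\<bar> = 1" for c
    unfolding d by (rule set_integral_diff(2)[OF iW[OF that] iN[OF that]])
  have "W.defect - N.defect = (LINT p:{0..<L} \<times> {0<..<L/2}|lborel. d 1 p) + (LINT p:{0..<L} \<times> {0<..<L/2}|lborel. d (-1) p)"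
    unfolding W.defect_def N.defect_def using eq[of 1] eq[of "-1"] by simp
  also have "\<dots> = (LINT p:{0..<L} \<times> {0<..<L/2}|lborel. d 1 p + d (-1) p)"
    by (rule set_integral_add(2)[symmetric]; rule i) auto
  also have "\<dots> = (LINT s:{0..<L}|lborel. LINT u:{0<..<L/2}|lborel. d 1 (s, u) + d (-1) (s, u))"
    by (rule set_integral_lborel_Times) (rule set_integral_add(1); rule i; simp)
  also have "\<dots> = (LINT s:{0..<L}|lborel. 2)"
    by (rule set_lebesgue_integral_cong) (simp_all add: d_def integral_defect_difference)
  also have "\<dots> = 2 * L" using L_pos by (simp add: set_integral_const)
  finally show ?thesis .
qed

end

theorem theorem2p1:
  fixes \<gamma> :: "real \<Rightarrow> real^3" and L mu0 :: real
  assumes curve: "arclength_simple_closed_curve \<gamma> L"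
    and mu0: "mu0 > 0"
  shows "\<exists>HN HW.
     (Hreg mu0 \<gamma> L (rhoN \<gamma>) \<longlongrightarrow> HN) (at_right 0) \<and>
     (Hreg mu0 \<gamma> L (rhoW \<gamma>) \<longlongrightarrow> HW) (at_right 0) \<and>
     (\<forall>z. Re z > -1 \<longrightarrow>
          set_integrable lborel (torus_dom L) (Fint_integrand \<gamma> (rhoN \<gamma>) z) \<and>
          set_integrable lborel (torus_dom L) (Fint_integrand \<gamma> (rhoW \<gamma>) z)) \<and>
     Fint mu0 \<gamma> L (rhoN \<gamma>) holomorphic_on {z. Re z > -1} \<and>
     Fint mu0 \<gamma> L (rhoW \<gamma>) holomorphic_on {z. Re z > -1} \<and>
     (\<exists>GN. good_continuation (Fint mu0 \<gamma> L (rhoN \<gamma>)) GN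
              (complex_of_real (mu0 * L / (2 * pi))) (complex_of_real HN)) \<and>
     (\<exists>GW. good_continuation (Fint mu0 \<gamma> L (rhoW \<gamma>)) GW
              (complex_of_real (mu0 * L / (2 * pi))) (complex_of_real HW)) \<and>
     HW = HN + mu0 / (2 * pi) * L"
proof -
  interpret arclength_curve \<gamma> L by unfold_locales (rule curve)
  show ?thesis
  \<comment> \<open>The witnesses are the limits of \<open>Hreg\<close>; the continuations have the
    same numbers as finite parts, which is the equality of the two regularizations. The defects
    differ by 2 L, and mu0 / (4 pi) times 2 L is mu0 L / (2 pi).\<close>
  proof (rule exI[of _ "mu0 / (4 * pi) * (N.defect + 2 * L * ln (L / 2))"],
      rule exI[of _ "mu0 / (4 * pi) * (W.defect + 2 * L * ln (L / 2))"], intro conjI allI impI)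
    show "mu0 / (4 * pi) * (W.defect + 2 * L * ln (L / 2)) =
        mu0 / (4 * pi) * (N.defect + 2 * L * ln (L / 2)) + mu0 / (2 * pi) * L"
      using defect_difference by (simp add: field_simps)
  qed (rule N.Hreg_limit W.Hreg_limit N.Fint_integrand_integral W.Fint_integrand_integral N.Fint_holomorphic
      W.Fint_holomorphic N.Fint_good_continuation W.Fint_good_continuation; assumption)+
qed

end
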